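(* Let $r\ge 0$ and let ${\boldsymbol{k}}=(k_1,\dots,k_r)\in\mathbb{Z}^r$ be an arbitrary integer index. Then there exist finitely many positive indices ${\boldsymbol{l}}$ and rational polynomials $c_{{\boldsymbol{k}},{\boldsymbol{l}}}(x)\in\mathbb{Q}[x]$ such that simultaneously \[\zeta_{\widehat{\mathcal{A}}}({\boldsymbol{k}})=\sum_{{\boldsymbol{l}}}c_{{\boldsymbol{k}},{\boldsymbol{l}}}({\boldsymbol{p}})\,\zeta_{\widehat{\mathcal{A}}}({\boldsymbol{l}})\ \text{ in } \widehat{\mathcal{A}} \qquad\text{and}\qquad \zeta_{\widehat{\mathcal{S}}}({\boldsymbol{k}})=\sum_{{\boldsymbol{l}}}c_{{\boldsymbol{k}},{\boldsymbol{l}}}(t)\,\zeta_{\widehat{\mathcal{S}}}({\boldsymbol{l}})\ \text{ in } \overline{\mathcal{Z}}[[t]].\] Moreover, each positive index ${\boldsymbol{l}}$ occurring has depth at most the number of positive entries of ${\boldsymbol{k}}$, and weight at most the sum of the positive entries of ${\boldsymbol{k}}$.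
   Context: An index is a tuple ${\boldsymbol{k}}=(k_1,\dots,k_r)$ of integers, $r\ge0$ being its depth; it is positive if all $k_i>0$, and then its weight is $k_1+\cdots+k_r$. The empty index $\varnothing$ (depth 0) is positive of weight 0. $\widehat{\mathcal{A}}$-MZVs: Let $\widehat{\mathcal{A}}=\varprojlim_n\bigl[(\prod_{p}\mathbb{Z}/p^n\mathbb{Z})/(\bigoplus_p\mathbb{Z}/p^n\mathbb{Z})\bigr]$ ($p$ over primes), a $\mathbb{Q}$-algebra with $\mathbb{Q}$ diagonally embedded. For any index ${\boldsymbol{k}}$ and prime $p$ put $\zeta_p({\boldsymbol{k}})=\sum_{0<n_1<\cdots<n_r<p}n_1^{-k_1}\cdots n_r^{-k_r}\in\mathbb{Z}_{(p)}$ (empty sum conventions: $\zeta_p(\varnothing)=1$), and $\zeta_{\widehat{\mathcal{A}}}({\boldsymbol{k}})=\bigl((\zeta_p({\boldsymbol{k}})\bmod p^n)_p\bigr)_n\in\widehat{\mathcal{A}}$. Let ${\boldsymbol{p}}=((p\bmod p^n)_p)_n\in\widehat{\mathcal{A}}$. $\widehat{\mathcal{S}}$-MZVs: Let $\mathcal{Z}\subset\mathbb{R}$ be the $\mathbb{Q}$-algebra generated by all multiple zeta values $\zeta(k_1,\dots,k_r)=\sum_{0<n_1<\cdots<n_r}n_1^{-k_1}\cdots n_r^{-k_r}$ ($k_i\ge1$, $k_r\ge2$), and $\overline{\mathcal{Z}}=\mathcal{Z}/\pi^2\mathcal{Z}\cong\mathcal{Z}[\pi i]/\pi i\mathcal{Z}[\pi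 i]$. For $t\in\mathbb{C}\setminus[1,\infty)$ let $\zeta(s_1,\dots,s_r;t)=\sum_{0<n_1<\cdots<n_r}\prod_{j}(n_j-t)^{-s_j}$ (principal branch of $\log(n-t)$; $\zeta(\varnothing;t)=1$), absolutely convergent when $\Re(s_j)+\cdots+\Re(s_r)>r+1-j$ for all $j$, and meromorphically continued to $\mathbb{C}^r$. For $t_+\in\mathbb{C}\setminus(-\infty,-1]$, $t_-\in\mathbb{C}\setminus[1,\infty)$ define $\zeta_{\widehat{\mathcal{U}}}(s_1,\dots,s_r;t_+,t_-)=\sum_{i=0}^r e^{\pi i(s_{i+1}+\cdots+s_r)}\zeta(s_1,\dots,s_i;-t_+)\,\zeta(s_r,\dots,s_{i+1};t_-)$; it is known (Komori) that this extends holomorphically in $(s_1,\dots,s_r,t_+,t_-)$, in particular entire in ${\boldsymbol{s}}$ for fixed $t_\pm$. For an integer index ${\boldsymbol{k}}$, $\zeta_{\widehat{\mathcal{S}}}({\boldsymbol{k}})$ is the Taylor expansion at $t=0$ of $t\mapsto\zeta_{\widehat{\mathcal{U}}}({\boldsymbol{k}};0,t)$, whose coefficients lie in $\mathcal{Z}[\pi i]$, taken modulo $\pi i\mathcal{Z}[\pi i][[t]]$; thus $\zeta_{\widehat{\mathcal{S}}}({\boldsymbol{k}})\in\mathcal{Z}[\pi i][[t]]/\pi i\mathcal{Z}[\pi i][[t]]\cong\overline{\mathcal{Z}}[[t]]$. Conventions: $\zeta_{\widehat{\mathcal{A}}}(\varnothing)=\zeta_{\widehat{\mathcal{S}}}(\varnothing)=1$.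 *)

theory Defs
  imports "HOL-Complex_Analysis.Complex_Analysis" "HOL-Computational_Algebra.Polynomial_FPS"
    "HOL-Computational_Algebra.Primes"
begin

fun nsum :: "(nat \<Rightarrow> 'x \<Rightarrow> 'b::comm_ring_1) \<Rightarrow> 'x list \<Rightarrow> nat \<Rightarrow> nat \<Rightarrow> 'b" where
  "nsum f [] m N = 1"
| "nsum f (x # xs) m N = (\<Sum>n\<in>{m<..<N}. f n x * nsum f xs n N)"

definition zeta_p :: "int list \<Rightarrow> nat \<Rightarrow> rat" where
  "zeta_p k p = nsum (\<lambda>n e. (of_nat n :: rat) powi (- e)) k 0 p"

definition padic_div :: "nat \<Rightarrow> nat \<Rightarrow> rat \<Rightarrow> bool" where
  "padic_div p n q \<longleftrightarrow> (\<exists>a b :: int. b \<noteq> 0 \<and> \<not> int p dvd b \<and> (int p) ^ n dvd a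
                                  \<and> q = of_int a / of_int b)"

text \<open>Equality in A-hat of the elements ((f p mod p^n)_p)_n and ((g p mod p^n)_p)_n
  attached to rational families: for every n, the two families agree modulo p^n
  for all but finitely many primes p.\<close>
definition Ahat_eq :: "(nat \<Rightarrow> rat) \<Rightarrow> (nat \<Rightarrow> rat) \<Rightarrow> bool" where
  "Ahat_eq f g \<longleftrightarrow> (\<forall>n. finite {p. prime p \<and> \<not> padic_div p n (f p - g p)})"

definition mzv :: "nat list \<Rightarrow> real" where
  "mzv k = lim (\<lambda>N. nsum (\<lambda>n e. 1 / (real n) ^ e) k 0 N)"

definition admissible :: "nat list \<Rightarrow> bool" where
  "admissible k \<longleftrightarrow> k \<noteq> [] \<and> (\<forall>e\<in>set k. e \<ge> 1) \<and> last k \<ge> 2"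

inductive_set MZV_alg :: "complex set" where
  rat: "of_rat q \<in> MZV_alg"
| mzv: "admissible k \<Longrightarrow> complex_of_real (mzv k) \<in> MZV_alg"
| add: "x \<in> MZV_alg \<Longrightarrow> y \<in> MZV_alg \<Longrightarrow> x + y \<in> MZV_alg"
| mult: "x \<in> MZV_alg \<Longrightarrow> y \<in> MZV_alg \<Longrightarrow> x * y \<in> MZV_alg"

definition MZV_alg_piI :: "complex set" where
  "MZV_alg_piI = {x. \<exists>m z. (\<forall>j\<le>m. z j \<in> MZV_alg) \<and>
                         x = (\<Sum>j\<le>m. z j * (complex_of_real pi * \<i>) ^ j)}"

definition piI_ideal :: "complex set" where
  "piI_ideal = {complex_of_real pi * \<i> * w | w. w \<in> MZV_alg_piI}"

text \<open>zeta(s_1,...,s_r; t) as limit of truncations (on its domain of absolute convergence),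
  with principal branch powers.\<close>
definition zeta_t :: "complex list \<Rightarrow> complex \<Rightarrow> complex" where
  "zeta_t s t = lim (\<lambda>N. nsum (\<lambda>n e. (of_nat n - t) powr (- e)) s 0 N)"

definition zetaU_series :: "complex list \<Rightarrow> complex \<Rightarrow> complex \<Rightarrow> complex" where
  "zetaU_series s tp tm =
     (\<Sum>i\<le>length s. exp (complex_of_real pi * \<i> * sum_list (drop i s))
                     * zeta_t (take i s) (- tp) * zeta_t (rev (drop i s)) tm)"

text \<open>zeta_U(s; t_+, t_-): the value at s of the (unique) function of r = length s complex
  variables which is entire in each variable separately and agrees with the series
  on the region where all Re s_j > 2 (contained in the region of absolute convergence
  of every term).\<close>
definition zetaU :: "complex list \<Rightarrow> complex \<Rightarrow> complex \<Rightarrow> complex" where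
  "zetaU s tp tm = (THE v. \<exists>F :: complex list \<Rightarrow> complex.
      (\<forall>zs. length zs = length s \<longrightarrow>
          (\<forall>j<length s. (\<lambda>z. F (zs[j := z])) holomorphic_on UNIV)) \<and>
      (\<forall>zs. length zs = length s \<and> (\<forall>z\<in>set zs. Re z > 2) \<longrightarrow> F zs = zetaU_series zs tp tm) \<and>
      v = F s)"

text \<open>zeta_S-hat(k): Taylor expansion at t = 0 of t \<mapsto> zeta_U(k; 0, t), as a complex
  power series (to be read modulo pi i Z[pi i][[t]]).\<close>
definition zetaS :: "int list \<Rightarrow> complex fps" where
  "zetaS k = Abs_fps (\<lambda>m. (deriv ^^ m) (\<lambda>t. zetaU (map of_int k) 0 t) 0 / fact m)"

end

(*
  Komori's function zeta_U(s; 0, t) is a regularised nested sum over the circle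
  1, 2, 3, ..., infinity = -infinity, ..., t - 3, t - 2, t - 1. A tail sum of x^(-s) times an
  earlier tail sum is well defined because both sides share one asymptotic expansion at infinity,
  continued from arg x = 0 to arg x = -pi through the lower half plane; this common expansion
  transports the constant of summation from the negative side, where all sums are finite, to the
  positive side. In the coordinate u = log x the expansions are entire functions of exponential
  growth on half strips, so the construction is holomorphic in s and t and gives the continuation.

  If an entry of the index is -m, choose a rational polynomial P with P(x) - P(x - 1) = x^m and
  P(0) = 0. Summation by parts, which passes through infinity without a boundary term, removes
  the entry and lowers a neighbouring entry by at most m + 1; the ends contribute P(0) = 0 and
  P(t - 1). The sums zeta_p satisfy the same identity with p in place of t, so both reductions to
  positive indices have the same coefficients, and both hold exactly.
*)
theory Submission
  imports Defs
begin

text \<open>The separate terms of Komori's sum may have poles at integer points, so the value there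
  cannot be computed term by term. The sum over the whole circle is therefore built as one object.
  Expansions at infinity are used only to finite order: an entire function \<open>h\<close>, itself
  fixed only up to \<open>O(x^(-M))\<close>, stands for an asymptotic series. The sequences attached
  to it are nevertheless unique. The reason is that solutions of
  \<open>H(x - 1) - H(x) = G(x)\<close> with polynomial growth on all sectors are unique up to a
  constant and a small error: the usual ambiguity, functions periodic in \<open>x\<close>, grows
  exponentially off the real axis. Every product with a power and every summation loses a bounded
  amount of precision, so existence is proved for each \<open>M\<close> and the loss is paid in
  advance at the inner sums. The thresholds 1/2 for \<open>t\<close>, 2 for \<open>Re u\<close> and
  9 for \<open>n\<close> keep every shift inside the region where principal logarithms add without
  correction.\<close>

section \<open>Symbols in the logarithmic coordinate\<close>

text \<open>
  With \<open>u = log x\<close>, growth of exponent \<open>c\<close> on half strips of every width means \<open>O(|x|^c)\<close> on sectors of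
  every opening. Symbols are entire in \<open>u\<close>, so Cauchy estimates do not shrink the domain.
\<close>

definition growth :: "'p set \<Rightarrow> (real \<Rightarrow> real) \<Rightarrow> real \<Rightarrow> ('p \<Rightarrow> complex \<Rightarrow> complex) \<Rightarrow> bool" where
  "growth Z b c E \<longleftrightarrow>
     (\<forall>a. \<exists>C\<ge>0. \<forall>z\<in>Z. \<forall>u. \<bar>Im u\<bar> \<le> a \<longrightarrow> Re u \<ge> b a \<longrightarrow> cmod (E z u) \<le> C * exp (c * Re u))"

text \<open>The half strips start at \<open>-a\<close>, so they exhaust the plane as
  \<open>a\<close> grows, and one estimate controls compact sets as well as infinity.\<close>

definition symbol :: "'p set \<Rightarrow> real \<Rightarrow> ('p \<Rightarrow> complex \<Rightarrow> complex) \<Rightarrow> bool" where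
  "symbol Z c H \<longleftrightarrow> (\<forall>z\<in>Z. H z holomorphic_on UNIV) \<and> growth Z uminus c H"

text \<open>Errors contain compositions with \<open>log_shift\<close>. They are therefore estimated
  only where that map is under control, and only their size is recorded.\<close>

definition small :: "'p set \<Rightarrow> real \<Rightarrow> ('p \<Rightarrow> complex \<Rightarrow> complex) \<Rightarrow> bool" where
  "small Z M E \<longleftrightarrow> growth Z (\<lambda>_. 2) (- M) E"

text \<open>Stated for compositions because the points \<open>logm t n\<close> below move with the parameter \<open>t\<close>.\<close>

definition hol_param :: "complex set \<Rightarrow> (complex \<Rightarrow> complex \<Rightarrow> complex) \<Rightarrow> bool" where
  "hol_param Z H \<longleftrightarrow> (\<forall>v. v holomorphic_on Z \<longrightarrow> (\<lambda>z. H z (v z)) holomorphic_on Z)"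

text \<open>The translation \<open>x \<mapsto> x - 1\<close> and the derivative \<open>d/dx\<close> in the coordinate \<open>u = log x\<close>.\<close>

definition log_shift :: "complex \<Rightarrow> complex" where
  "log_shift u = u + Ln (1 - exp (-u))"

definition x_deriv :: "(complex \<Rightarrow> complex) \<Rightarrow> complex \<Rightarrow> complex" where
  "x_deriv h u = exp (-u) * deriv h u"

lemma symbol_holomorphic: "symbol Z c H \<Longrightarrow> z \<in> Z \<Longrightarrow> H z holomorphic_on UNIV"
  by (auto simp: symbol_def)

lemma growthE:
  assumes "growth Z b c E"
  obtains C where "C \<ge> 0" "\<And>z u. z \<in> Z \<Longrightarrow> \<bar>Im u\<bar> \<le> a \<Longrightarrow> Re u \<ge> b a \<Longrightarrow> cmod (E z u) \<le> C * exp (c * Re u)"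
  using assms unfolding growth_def by meson

lemma symbolE:
  assumes "symbol Z c H"
  obtains C where "C \<ge> 0" "\<And>z u. z \<in> Z \<Longrightarrow> \<bar>Im u\<bar> \<le> a \<Longrightarrow> Re u \<ge> -a \<Longrightarrow> cmod (H z u) \<le> C * exp (c * Re u)"
  using assms growthE[of Z uminus c H a] unfolding symbol_def by blast

lemma smallE:
  assumes "small Z M E"
  obtains C where "C \<ge> 0" "\<And>z u. z \<in> Z \<Longrightarrow> \<bar>Im u\<bar> \<le> a \<Longrightarrow> Re u \<ge> 2 \<Longrightarrow> cmod (E z u) \<le> C * exp (- M * Re u)"
  using assms growthE[of Z "\<lambda>_. 2" "-M" E a] unfolding small_def by blast

lemma growth_mono: assumes "growth Z b c H" "c \<le> c'" shows "growth Z b c' H"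
  unfolding growth_def
proof
  fix a
  obtain C where C: "C \<ge> 0" "\<And>z u. z \<in> Z \<Longrightarrow> \<bar>Im u\<bar> \<le> a \<Longrightarrow> Re u \<ge> b a \<Longrightarrow> cmod (H z u) \<le> C * exp (c * Re u)"
    using growthE[OF assms(1)] by blast
  \<comment> \<open>Where \<open>Re u\<close> is negative, a larger exponent gives a smaller
    exponential; \<open>exp K\<close> compensates for this on the bounded part of the half
    strip.\<close>
  define K where "K = (c' - c) * \<bar>b a\<bar>"
  show "\<exists>C\<ge>0. \<forall>z\<in>Z. \<forall>u. \<bar>Im u\<bar> \<le> a \<longrightarrow> Re u \<ge> b a \<longrightarrow> cmod (H z u) \<le> C * exp (c' * Re u)"
  proof (intro exI[of _ "C * exp K"] conjI ballI allI impI)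
    fix z u assume *: "z \<in> Z" "\<bar>Im u\<bar> \<le> a" "Re u \<ge> b a"
    have "(c' - c) * (\<bar>b a\<bar> + Re u) \<ge> 0" using assms * by (intro mult_nonneg_nonneg) auto
    hence "exp (c * Re u) \<le> exp (K + c' * Re u)" by (simp add: K_def algebra_simps)
    hence "C * exp (c * Re u) \<le> C * exp K * exp (c' * Re u)"
      unfolding mult.assoc exp_add[symmetric] using C(1) by (intro mult_left_mono)
    moreover have "cmod (H z u) \<le> C * exp (c * Re u)" using C * by blast
    ultimately show "cmod (H z u) \<le> C * exp K * exp (c' * Re u)" by (rule order_trans[rotated])
  qed (use C in auto)
qed

lemma growth_add: assumes "growth Z b c G" "growth Z b c H" shows "growth Z b c (\<lambda>z u. G z u + H z u)"
  unfolding growth_def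
proof
  fix a
  obtain C where C: "C \<ge> 0" "\<And>z u. z \<in> Z \<Longrightarrow> \<bar>Im u\<bar> \<le> a \<Longrightarrow> Re u \<ge> b a \<Longrightarrow> cmod (G z u) \<le> C * exp (c * Re u)"
    using growthE[OF assms(1)] by blast
  obtain D where D: "D \<ge> 0" "\<And>z u. z \<in> Z \<Longrightarrow> \<bar>Im u\<bar> \<le> a \<Longrightarrow> Re u \<ge> b a \<Longrightarrow> cmod (H z u) \<le> D * exp (c * Re u)"
    using growthE[OF assms(2)] by blast
  show "\<exists>C\<ge>0. \<forall>z\<in>Z. \<forall>u. \<bar>Im u\<bar> \<le> a \<longrightarrow> Re u \<ge> b a \<longrightarrow> cmod (G z u + H z u) \<le> C * exp (c * Re u)"
    by (rule exI[of _ "C + D"]) (use C D in \<open>auto simp: distrib_right intro!: order_trans[OF norm_triangle_ineq] add_mono\<close>)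
qed

lemma growth_mult: assumes "growth Z b c G" "growth Z b d H" shows "growth Z b (c+d) (\<lambda>z u. G z u * H z u)"
  unfolding growth_def
proof
  fix a
  obtain C where C: "C \<ge> 0" "\<And>z u. z \<in> Z \<Longrightarrow> \<bar>Im u\<bar> \<le> a \<Longrightarrow> Re u \<ge> b a \<Longrightarrow> cmod (G z u) \<le> C * exp (c * Re u)"
    using growthE[OF assms(1)] by blast
  obtain D where D: "D \<ge> 0" "\<And>z u. z \<in> Z \<Longrightarrow> \<bar>Im u\<bar> \<le> a \<Longrightarrow> Re u \<ge> b a \<Longrightarrow> cmod (H z u) \<le> D * exp (d * Re u)"
    using growthE[OF assms(2)] by blast
  show "\<exists>C\<ge>0. \<forall>z\<in>Z. \<forall>u. \<bar>Im u\<bar> \<le> a \<longrightarrow> Re u \<ge> b a \<longrightarrow> cmod (G z u * H z u) \<le> C * exp ((c+d) * Re u)"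
  proof (intro exI[of _ "C * D"] conjI ballI allI impI)
    fix z u assume *: "z \<in> Z" "\<bar>Im u\<bar> \<le> a" "Re u \<ge> b a"
    have "cmod (G z u * H z u) \<le> (C * exp (c * Re u)) * (D * exp (d * Re u))"
      unfolding norm_mult using C D * by (intro mult_mono) auto
    thus "cmod (G z u * H z u) \<le> C * D * exp ((c+d) * Re u)" by (simp add: exp_add algebra_simps)
  qed (use C D in auto)
qed

lemma symbol_mono: "symbol Z c H \<Longrightarrow> c \<le> c' \<Longrightarrow> symbol Z c' H"
  by (auto simp: symbol_def intro: growth_mono)

lemma small_mono: "small Z M E \<Longrightarrow> M' \<le> M \<Longrightarrow> small Z M' E"
  by (auto simp: small_def intro: growth_mono)

lemma symbol_add: "symbol Z c G \<Longrightarrow> symbol Z c H \<Longrightarrow> symbol Z c (\<lambda>z u. G z u + H z u)"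
  by (simp add: symbol_def growth_add holomorphic_on_add)

lemma small_add: "small Z c G \<Longrightarrow> small Z c H \<Longrightarrow> small Z c (\<lambda>z u. G z u + H z u)"
  by (simp add: small_def growth_add)

lemma symbol_mult: "symbol Z c G \<Longrightarrow> symbol Z d H \<Longrightarrow> symbol Z (c+d) (\<lambda>z u. G z u * H z u)"
  by (simp add: symbol_def growth_mult holomorphic_on_mult)

lemma symbol_imp_small: assumes "symbol Z c H" shows "small Z (-c) H"
  unfolding small_def growth_def
proof
  fix a
  obtain C where C: "C \<ge> 0" "\<And>z u. z \<in> Z \<Longrightarrow> \<bar>Im u\<bar> \<le> \<bar>a\<bar> \<Longrightarrow> Re u \<ge> -\<bar>a\<bar> \<Longrightarrow> cmod (H z u) \<le> C * exp (c * Re u)"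
    using symbolE[OF assms(1)] by blast
  thus "\<exists>C\<ge>0. \<forall>z\<in>Z. \<forall>u. \<bar>Im u\<bar> \<le> a \<longrightarrow> Re u \<ge> 2 \<longrightarrow> cmod (H z u) \<le> C * exp (- (-c) * Re u)"
    by (intro exI[of _ C]) auto
qed

lemma symbol_mult_small: assumes "symbol Z c G" "small Z M E" shows "small Z (M - c) (\<lambda>z u. G z u * E z u)"
  using growth_mult[OF symbol_imp_small[OF assms(1), unfolded small_def] assms(2)[unfolded small_def]] by (simp add: small_def)

text \<open>On \<open>-a \<le> Re u < 2\<close> any two exponentials are comparable, so the exponent
  is decided at infinity alone. Decay found where \<open>log_shift\<close> is controlled thus
  becomes a statement about symbols, which can be differentiated again.\<close>

lemma symbol_of_small: assumes "symbol Z c H" "small Z M H" shows "symbol Z (-M) H"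
  unfolding symbol_def growth_def
proof (intro conjI allI ballI)
  fix z assume "z \<in> Z" thus "H z holomorphic_on UNIV" by (rule symbol_holomorphic[OF assms(1)])
next
  fix a
  obtain C where C: "C \<ge> 0" "\<And>z u. z \<in> Z \<Longrightarrow> \<bar>Im u\<bar> \<le> a \<Longrightarrow> Re u \<ge> -a \<Longrightarrow> cmod (H z u) \<le> C * exp (c * Re u)"
    using symbolE[OF assms(1)] by blast
  obtain D where D: "D \<ge> 0" "\<And>z u. z \<in> Z \<Longrightarrow> \<bar>Im u\<bar> \<le> a \<Longrightarrow> Re u \<ge> 2 \<Longrightarrow> cmod (H z u) \<le> D * exp (- M * Re u)"
    using smallE[OF assms(2)] by blast
  define K where "K = C * exp (\<bar>c + M\<bar> * (\<bar>a\<bar> + 2))"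
  show "\<exists>C\<ge>0. \<forall>z\<in>Z. \<forall>u. \<bar>Im u\<bar> \<le> a \<longrightarrow> Re u \<ge> -a \<longrightarrow> cmod (H z u) \<le> C * exp (- M * Re u)"
  proof (intro exI[of _ "K + D"] conjI ballI allI impI)
    fix z u assume *: "z \<in> Z" "\<bar>Im u\<bar> \<le> a" "Re u \<ge> -a"
    show "cmod (H z u) \<le> (K + D) * exp (- M * Re u)"
    proof (cases "Re u \<ge> 2")
      case True
      hence "cmod (H z u) \<le> D * exp (- M * Re u)" using D * by blast
      also have "\<dots> \<le> (K + D) * exp (- M * Re u)" using C(1) by (auto simp: K_def)
      finally show ?thesis .
    next
      case False
      have "cmod (H z u) \<le> C * exp (c * Re u)" using C * by blast
      also have "c * Re u = (c + M) * Re u - M * Re u" by (simp add: algebra_simps)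
      also have "(c + M) * Re u \<le> \<bar>c + M\<bar> * (\<bar>a\<bar> + 2)"
      proof -
        have "(c + M) * Re u \<le> \<bar>c + M\<bar> * \<bar>Re u\<bar>" by (metis abs_ge_self abs_mult)
        also have "\<dots> \<le> \<bar>c + M\<bar> * (\<bar>a\<bar> + 2)" using * False by (intro mult_left_mono) auto
        finally show ?thesis .
      qed
      hence "C * exp ((c + M) * Re u - M * Re u) \<le> C * exp (\<bar>c + M\<bar> * (\<bar>a\<bar> + 2) - M * Re u)"
        using C(1) by (intro mult_left_mono) auto
      also have "\<dots> = K * exp (- M * Re u)" by (simp add: K_def exp_diff exp_minus divide_simps)
      also have "\<dots> \<le> (K + D) * exp (- M * Re u)" using D(1) by (auto)
      finally show ?thesis .
    qed
  qed (use C D in \<open>auto simp: K_def\<close>)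
qed

lemma symbol_coeff:
  assumes "\<And>z. z \<in> Z \<Longrightarrow> cmod (q z) \<le> K" shows "symbol Z 0 (\<lambda>z u. q z)"
  unfolding symbol_def growth_def
  by (auto intro!: exI[of _ "max K 0"] intro: order_trans[OF assms])

text \<open>On a strip the imaginary part of \<open>s z\<close> costs only a bounded factor, and the
  real part alone sets the exponent. The bound \<open>B\<close> makes that factor uniform in
  \<open>z\<close>.\<close>

lemma symbol_exp:
  assumes B: "\<And>z. z \<in> Z \<Longrightarrow> cmod (s z) \<le> B" and R: "\<And>z. z \<in> Z \<Longrightarrow> - Re (s z) \<le> c"
  shows "symbol Z c (\<lambda>z u. exp (- s z * u))"
  unfolding symbol_def growth_def
proof (intro conjI allI ballI)
  fix z show "(\<lambda>u. exp (- s z * u)) holomorphic_on UNIV" by (intro holomorphic_intros)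
next
  fix a
  show "\<exists>C\<ge>0. \<forall>z\<in>Z. \<forall>u. \<bar>Im u\<bar> \<le> a \<longrightarrow> Re u \<ge> -a \<longrightarrow> cmod (exp (- s z * u)) \<le> C * exp (c * Re u)"
  proof (intro exI[of _ "exp (2 * (\<bar>B\<bar> + \<bar>c\<bar>) * \<bar>a\<bar>)"] conjI ballI allI impI)
    fix z u assume *: "z \<in> Z" "\<bar>Im u\<bar> \<le> a" "Re u \<ge> -a"
    have "\<bar>Im (s z)\<bar> \<le> \<bar>B\<bar>" "\<bar>Re (s z)\<bar> \<le> \<bar>B\<bar>" using B[OF *(1)] abs_Im_le_cmod[of "s z"] abs_Re_le_cmod[of "s z"] by linarith+
    have "Im (s z) * Im u \<le> \<bar>Im (s z)\<bar> * \<bar>Im u\<bar>" by (metis abs_ge_self abs_mult)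
    also have "\<dots> \<le> \<bar>B\<bar> * \<bar>a\<bar>" using * \<open>\<bar>Im (s z)\<bar> \<le> \<bar>B\<bar>\<close> by (intro mult_mono) auto
    finally have "Im (s z) * Im u \<le> \<bar>B\<bar> * \<bar>a\<bar>" .
    moreover have "(c + Re (s z)) * (Re u + \<bar>a\<bar>) \<ge> 0" using R[OF *(1)] * by (intro mult_nonneg_nonneg) auto
    moreover have "(c + Re (s z)) * \<bar>a\<bar> \<le> (\<bar>B\<bar> + \<bar>c\<bar>) * \<bar>a\<bar>" using \<open>\<bar>Re (s z)\<bar> \<le> \<bar>B\<bar>\<close> by (intro mult_right_mono) auto
    ultimately have "Re (- s z * u) \<le> \<bar>B\<bar> * \<bar>a\<bar> + (\<bar>B\<bar> + \<bar>c\<bar>) * \<bar>a\<bar> + c * Re u"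
      by (simp add: algebra_simps)
    also have "\<bar>B\<bar> * \<bar>a\<bar> \<le> (\<bar>B\<bar> + \<bar>c\<bar>) * \<bar>a\<bar>" by (intro mult_right_mono) auto
    finally have "Re (- s z * u) \<le> 2 * (\<bar>B\<bar> + \<bar>c\<bar>) * \<bar>a\<bar> + c * Re u" by (simp add: algebra_simps)
    thus "cmod (exp (- s z * u)) \<le> exp (2 * (\<bar>B\<bar> + \<bar>c\<bar>) * \<bar>a\<bar>) * exp (c * Re u)"
      by (simp add: norm_exp_eq_Re exp_add[symmetric])
  qed auto
qed

lemma symbol_exp':
  assumes B: "\<And>z. z \<in> Z \<Longrightarrow> cmod (s z) \<le> B" shows "symbol Z B (\<lambda>z u. exp (- s z * u))"
  by (rule symbol_exp[OF B]) (use B abs_Re_le_cmod in \<open>fastforce simp: abs_le_iff intro: order_trans\<close>)+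

lemma symbol_cmult: "symbol Z c H \<Longrightarrow> symbol Z c (\<lambda>z u. (k::complex) * H z u)"
  using symbol_mult[OF symbol_coeff[of Z "\<lambda>_. k" "cmod k"], of c H] by simp

lemma small_cmult: "small Z c H \<Longrightarrow> small Z c (\<lambda>z u. (k::complex) * H z u)"
  using symbol_mult_small[OF symbol_coeff[of Z "\<lambda>_. k" "cmod k"], of c H] by simp

lemma symbol_uminus: "symbol Z c H \<Longrightarrow> symbol Z c (\<lambda>z u. - H z u)"
  using symbol_cmult[of Z c H "-1"] by simp

lemma small_uminus: "small Z c H \<Longrightarrow> small Z c (\<lambda>z u. - H z u)"
  using small_cmult[of Z c H "-1"] by simp

lemma symbol_diff: "symbol Z c G \<Longrightarrow> symbol Z c H \<Longrightarrow> symbol Z c (\<lambda>z u. G z u - H z u)"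
  using symbol_add[OF _ symbol_uminus, of Z c G H] by simp

lemma small_diff: "small Z c G \<Longrightarrow> small Z c H \<Longrightarrow> small Z c (\<lambda>z u. G z u - H z u)"
  using small_add[OF _ small_uminus, of Z c G H] by simp

lemma symbol_zero: "symbol Z c (\<lambda>z u. 0)" by (auto simp: symbol_def growth_def)

lemma small_zero: "small Z c (\<lambda>z u. 0)" by (auto simp: small_def growth_def)

lemma symbol_sum: "finite I \<Longrightarrow> (\<And>i. i \<in> I \<Longrightarrow> symbol Z c (H i)) \<Longrightarrow> symbol Z c (\<lambda>z u. \<Sum>i\<in>I. H i z u)"
  by (induction I rule: finite_induct) (auto intro: symbol_zero symbol_add)

lemma small_cong: "small Z M E \<Longrightarrow> (\<And>z u. z \<in> Z \<Longrightarrow> Re u \<ge> 2 \<Longrightarrow> E z u = E' z u) \<Longrightarrow> small Z M E'"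
  unfolding small_def growth_def by (metis (no_types, lifting))

text \<open>Cauchy's inequality on unit discs in \<open>u\<close>: they stay in the strip of width
  \<open>a + 1\<close>, and \<open>exp (c * Re x)\<close> varies on them by at most the factor
  \<open>exp \<bar>c\<bar>\<close>.\<close>

lemma symbol_deriv: assumes "symbol Z c H" shows "symbol Z c (\<lambda>z. deriv (H z))"
  unfolding symbol_def growth_def
proof (intro conjI allI ballI)
  fix z assume "z \<in> Z" thus "deriv (H z) holomorphic_on UNIV" using assms symbol_holomorphic by (intro holomorphic_deriv) auto
next
  fix a
  obtain C where C: "C \<ge> 0" "\<And>z u. z \<in> Z \<Longrightarrow> \<bar>Im u\<bar> \<le> a+1 \<Longrightarrow> Re u \<ge> -(a+1) \<Longrightarrow> cmod (H z u) \<le> C * exp (c * Re u)"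
    using symbolE[OF assms(1)] by blast
  show "\<exists>C\<ge>0. \<forall>z\<in>Z. \<forall>u. \<bar>Im u\<bar> \<le> a \<longrightarrow> Re u \<ge> -a \<longrightarrow> cmod (deriv (H z) u) \<le> C * exp (c * Re u)"
  proof (intro exI[of _ "C * exp \<bar>c\<bar>"] conjI ballI allI impI)
    fix z u assume *: "z \<in> Z" "\<bar>Im u\<bar> \<le> a" "Re u \<ge> -a"
    have hz: "H z holomorphic_on UNIV" using symbol_holomorphic[OF assms *(1)] .
    have "cmod ((deriv ^^ 1) (H z) u) \<le> fact 1 * (C * exp \<bar>c\<bar> * exp (c * Re u)) / 1 ^ 1"
    proof (rule Cauchy_inequality)
      show "H z holomorphic_on ball u 1" using hz holomorphic_on_subset by blast
      show "continuous_on (cball u 1) (H z)" using hz holomorphic_on_imp_continuous_on holomorphic_on_subset by blast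
      fix x assume x: "cmod (u - x) = 1"
      have "\<bar>Im u - Im x\<bar> \<le> 1" "\<bar>Re u - Re x\<bar> \<le> 1" using x abs_Im_le_cmod[of "u-x"] abs_Re_le_cmod[of "u-x"] by auto
      moreover have "\<bar>c * (Re x - Re u)\<bar> \<le> \<bar>c\<bar> * 1" unfolding abs_mult using \<open>\<bar>Re u - Re x\<bar> \<le> 1\<close> by (intro mult_left_mono) auto
      ultimately have "cmod (H z x) \<le> C * exp (c * Re x)" "c * Re x \<le> \<bar>c\<bar> + c * Re u"
        using C(2)[OF *(1), of x] * by (auto simp: algebra_simps)
      moreover from this(2) have "C * exp (c * Re x) \<le> C * exp (\<bar>c\<bar> + c * Re u)" using C(1) by (intro mult_left_mono) auto
      ultimately show "cmod (H z x) \<le> C * exp \<bar>c\<bar> * exp (c * Re u)" by (simp add: exp_add)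
    qed auto
    thus "cmod (deriv (H z) u) \<le> C * exp \<bar>c\<bar> * exp (c * Re u)" by simp
  qed (use C in auto)
qed

text \<open>A unit disc in \<open>u\<close> has a radius comparable to \<open>\<bar>x\<bar>\<close>
  in the variable \<open>x\<close>. Hence each \<open>d/dx\<close> gains one order; all expansions
  below rest on this gain.\<close>

lemma symbol_x_deriv: "symbol Z c H \<Longrightarrow> symbol Z (c - 1) (\<lambda>z. x_deriv (H z))"
  using symbol_mult[OF symbol_exp[of Z "\<lambda>_. 1" 1 "-1"] symbol_deriv, of c H] by (simp add: x_deriv_def[abs_def])

lemma symbol_x_deriv_funpow: "symbol Z c H \<Longrightarrow> symbol Z (c - real i) (\<lambda>z. (x_deriv ^^ i) (H z))"
proof (induction i)
  case (Suc i)
  from symbol_x_deriv[OF Suc.IH[OF Suc.prems]] show ?case by (simp add: algebra_simps)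
qed simp

section \<open>Taylor estimates and holomorphic dependence on a parameter\<close>

lemma entire_has_deriv: "h holomorphic_on UNIV \<Longrightarrow> (h has_field_derivative deriv h u) (at u)"
  by (rule holomorphic_derivI) auto

lemma entire_taylor1:
  assumes "\<And>x. x \<in> closed_segment a b \<Longrightarrow> (J has_field_derivative g x) (at x)"
   and "\<And>x. x \<in> closed_segment a b \<Longrightarrow> (g has_field_derivative g' x) (at x)"
   and "\<And>x. x \<in> closed_segment a b \<Longrightarrow> cmod (g' x) \<le> B"
  shows "cmod (J b - J a - (b - a) * g a) \<le> B * (cmod (b - a))\<^sup>2"
proof -
  define f where "f = (\<lambda>i::nat. if i = 0 then J else if i = 1 then g else g')"
  have "cmod (f 0 b - (\<Sum>i\<le>1. f i a * (b - a)^i / fact i)) \<le> B * cmod (b - a) ^ Suc 1 / fact 1"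
  proof (rule complex_Taylor)
    fix i :: nat and x assume "x \<in> closed_segment a b" "i \<le> 1"
    hence "i = 0 \<or> i = 1" by auto
    thus "(f i has_field_derivative f (Suc i) x) (at x within closed_segment a b)"
      using assms \<open>x \<in> _\<close> by (auto simp: f_def intro: has_field_derivative_at_within)
  qed (use assms in \<open>auto simp: f_def\<close>)
  thus ?thesis by (simp add: f_def algebra_simps power2_eq_square)
qed

lemma entire_bound:
  assumes "\<And>x. x \<in> closed_segment a b \<Longrightarrow> (J has_field_derivative g x) (at x)"
   and "\<And>x. x \<in> closed_segment a b \<Longrightarrow> cmod (g x) \<le> B"
  shows "cmod (J b - J a) \<le> B * cmod (b - a)"
  by (rule field_differentiable_bound[where S="closed_segment a b"])
    (use assms in \<open>auto intro: has_field_derivative_at_within\<close>)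

text \<open>The rate may depend on a bound for \<open>v\<close>, since \<open>v\<close> is bounded
  on every closed disc in \<open>Z\<close>. Convergence is thus locally uniform and Weierstrass'
  theorem applies.\<close>

lemma holomorphic_rate_limit:
  assumes Z: "open Z" and v: "v holomorphic_on Z" and f: "\<And>n::nat. f n holomorphic_on Z"
   and r: "\<And>A. A \<ge> 0 \<Longrightarrow> \<exists>K. \<forall>n. \<forall>z\<in>Z. cmod (v z) \<le> A \<longrightarrow> cmod (f n z - g z) \<le> K / real (Suc n)"
  shows "g holomorphic_on Z"
proof (rule holomorphic_uniform_sequence[OF Z f])
  fix x assume "x \<in> Z"
  then obtain d where d: "d > 0" "cball x d \<subseteq> Z" using Z open_contains_cball by blast
  have "compact (v ` cball x d)"
    by (intro compact_continuous_image holomorphic_on_imp_continuous_on holomorphic_on_subset[OF v d(2)] compact_cball)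
  then obtain A where A: "\<And>z. z \<in> cball x d \<Longrightarrow> cmod (v z) \<le> A" using compact_imp_bounded bounded_iff by (metis imageI)
  have "A \<ge> 0" using A[of x] d norm_ge_zero[of "v x"] by (auto intro: order_trans[OF norm_ge_zero])
  then obtain K where K: "\<And>n z. z \<in> Z \<Longrightarrow> cmod (v z) \<le> A \<Longrightarrow> cmod (f n z - g z) \<le> K / real (Suc n)" using r by blast
  have "uniform_limit (cball x d) f g sequentially"
  proof (rule uniform_limitI)
    fix e :: real assume e: "e > 0"
    have "(\<lambda>n. K / real (Suc n)) \<longlonglongrightarrow> 0" using LIMSEQ_Suc[OF lim_const_over_n[of K]] by simp
    hence "\<forall>\<^sub>F n in sequentially. K / real (Suc n) < e" using e by (rule order_tendstoD)
    thus "\<forall>\<^sub>F n in sequentially. \<forall>z\<in>cball x d. dist (f n z) (g z) < e"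
    proof eventually_elim
      case (elim n)
      show ?case
      proof
        fix z assume z: "z \<in> cball x d"
        have "cmod (f n z - g z) \<le> K / real (Suc n)" using z d by (intro K A) auto
        thus "dist (f n z) (g z) < e" using elim by (simp add: dist_norm)
      qed
    qed
  qed
  thus "\<exists>d. 0 < d \<and> cball x d \<subseteq> Z \<and> uniform_limit (cball x d) f g sequentially" using d by blast
qed

lemma symbol_disc_bound:
  assumes "symbol Z c H"
  shows "\<exists>K\<ge>0. \<forall>z\<in>Z. \<forall>u. cmod u \<le> A \<longrightarrow> cmod (H z u) \<le> K"
proof -
  obtain C where C: "C \<ge> 0" "\<And>z u. z \<in> Z \<Longrightarrow> \<bar>Im u\<bar> \<le> A \<Longrightarrow> Re u \<ge> -A \<Longrightarrow> cmod (H z u) \<le> C * exp (c * Re u)"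
    using symbolE[OF assms(1)] by blast
  show ?thesis
  proof (intro exI[of _ "C * exp (\<bar>c\<bar> * \<bar>A\<bar>)"] conjI ballI allI impI)
    fix z u assume *: "z \<in> Z" "cmod u \<le> A"
    have h: "\<bar>Im u\<bar> \<le> A" "\<bar>Re u\<bar> \<le> A" using * abs_Im_le_cmod[of u] abs_Re_le_cmod[of u] by auto
    have "cmod (H z u) \<le> C * exp (c * Re u)" using C(2)[OF *(1), of u] h by auto
    moreover have "c * Re u \<le> \<bar>c\<bar> * \<bar>A\<bar>" using h by (metis abs_ge_self abs_ge_zero abs_mult abs_of_nonneg mult_left_mono order_trans)
    hence "C * exp (c * Re u) \<le> C * exp (\<bar>c\<bar> * \<bar>A\<bar>)" using C(1) by (intro mult_left_mono) auto
    ultimately show "cmod (H z u) \<le> C * exp (\<bar>c\<bar> * \<bar>A\<bar>)" by linarith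
  qed (use C in auto)
qed

lemma hol_paramD: "hol_param Z H \<Longrightarrow> v holomorphic_on Z \<Longrightarrow> (\<lambda>z. H z (v z)) holomorphic_on Z"
  by (auto simp: hol_param_def)

lemma closed_segment_cmod: "x \<in> closed_segment a b \<Longrightarrow> cmod a \<le> A \<Longrightarrow> cmod b \<le> A \<Longrightarrow> cmod x \<le> A"
  using closed_segment_subset[of a "cball 0 A" b] by (auto simp: subset_iff)

text \<open>Difference quotients with step \<open>1 / (n + 1)\<close> are again compositions of
  \<open>H\<close> with holomorphic functions, and the second derivative bounds their error.\<close>

lemma hol_param_deriv: assumes Z: "open Z" and s: "symbol Z c H" and h: "hol_param Z H" shows "hol_param Z (\<lambda>z. deriv (H z))"
  unfolding hol_param_def
proof (intro allI impI)
  fix v assume v: "v holomorphic_on Z"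
  let ?f = "\<lambda>n z. of_nat (Suc n) * (H z (v z + 1 / of_nat (Suc n)) - H z (v z))"
  show "(\<lambda>z. deriv (H z) (v z)) holomorphic_on Z"
  proof (rule holomorphic_rate_limit[OF Z v, of ?f])
    fix n show "?f n holomorphic_on Z" by (intro holomorphic_intros hol_paramD[OF h] v)
  next
    fix A :: real assume "A \<ge> 0"
    obtain K where K: "K \<ge> 0" "\<And>z u. z \<in> Z \<Longrightarrow> cmod u \<le> A + 1 \<Longrightarrow> cmod (deriv (deriv (H z)) u) \<le> K"
      using symbol_disc_bound[OF symbol_deriv[OF symbol_deriv[OF s]]] by metis
    show "\<exists>K. \<forall>n. \<forall>z\<in>Z. cmod (v z) \<le> A \<longrightarrow> cmod (?f n z - deriv (H z) (v z)) \<le> K / real (Suc n)"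
    proof (intro exI[of _ K] allI ballI impI)
      fix n z assume z: "z \<in> Z" "cmod (v z) \<le> A"
      define e :: complex where "e = 1 / of_nat (Suc n)"
      have e: "cmod e = 1 / real (Suc n)" "e \<noteq> 0" "of_nat (Suc n) = 1 / e" by (auto simp: e_def norm_divide simp del: of_nat_Suc)
      have "cmod e \<le> 1" unfolding e by simp
      have hz: "H z holomorphic_on UNIV" using symbol_holomorphic[OF s z(1)] .
      have dhz: "deriv (H z) holomorphic_on UNIV" using hz by (rule holomorphic_deriv) auto
      have "cmod (H z (v z + e) - H z (v z) - (v z + e - v z) * deriv (H z) (v z)) \<le> K * (cmod (v z + e - v z))\<^sup>2"
      proof (rule entire_taylor1)
        fix x assume x: "x \<in> closed_segment (v z) (v z + e)"
        show "cmod (deriv (deriv (H z)) x) \<le> K"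
          by (intro K z closed_segment_cmod[OF x]) (use z \<open>cmod e \<le> 1\<close> norm_triangle_ineq[of "v z" e] in auto)
      qed (use hz dhz entire_has_deriv in auto)
      hence 1: "cmod (H z (v z + e) - H z (v z) - e * deriv (H z) (v z)) \<le> K * (cmod e)\<^sup>2" by simp
      have "?f n z - deriv (H z) (v z) = (H z (v z + e) - H z (v z) - e * deriv (H z) (v z)) / e"
        using e(2) unfolding e(3) e_def[symmetric] by (simp add: field_simps)
      also have "cmod \<dots> \<le> K * (cmod e)\<^sup>2 / cmod e" using 1 by (simp add: norm_divide divide_right_mono)
      also have "\<dots> = K / real (Suc n)" using e by (simp add: power2_eq_square)
      finally show "cmod (?f n z - deriv (H z) (v z)) \<le> K / real (Suc n)" .
    qed
  qed
qed

lemma hol_param_mult: "hol_param Z G \<Longrightarrow> hol_param Z H \<Longrightarrow> hol_param Z (\<lambda>z u. G z u * H z u)"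
  by (simp add: hol_param_def holomorphic_on_mult holomorphic_on_add holomorphic_on_minus)

lemma hol_param_add: "hol_param Z G \<Longrightarrow> hol_param Z H \<Longrightarrow> hol_param Z (\<lambda>z u. G z u + H z u)"
  by (simp add: hol_param_def holomorphic_on_mult holomorphic_on_add holomorphic_on_minus)

lemma hol_param_coeff: "q holomorphic_on Z \<Longrightarrow> hol_param Z (\<lambda>z u. q z)"
  unfolding hol_param_def by auto

lemma hol_param_cmult: "hol_param Z G \<Longrightarrow> hol_param Z (\<lambda>z u. k * G z u)"
  by (simp add: hol_param_def holomorphic_on_mult holomorphic_on_add holomorphic_on_minus)

lemma hol_param_uminus: "hol_param Z G \<Longrightarrow> hol_param Z (\<lambda>z u. - G z u)"
  by (simp add: hol_param_def holomorphic_on_mult holomorphic_on_add holomorphic_on_minus)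

lemma hol_param_sum: "(\<And>i. i \<in> I \<Longrightarrow> hol_param Z (H i)) \<Longrightarrow> hol_param Z (\<lambda>z u. \<Sum>i\<in>I. H i z u)"
  unfolding hol_param_def by (auto intro!: holomorphic_intros)

lemma hol_param_exp: "s holomorphic_on Z \<Longrightarrow> hol_param Z (\<lambda>z u. exp (- s z * u))"
  unfolding hol_param_def by (auto intro!: holomorphic_intros)

lemma hol_param_x_deriv: assumes "open Z" "symbol Z c H" "hol_param Z H" shows "hol_param Z (\<lambda>z. x_deriv (H z))"
  using hol_param_mult[OF hol_param_exp[of "\<lambda>_. 1" Z] hol_param_deriv[OF assms]] by (simp add: x_deriv_def[abs_def])

lemma hol_param_x_deriv_funpow: "open Z \<Longrightarrow> symbol Z c H \<Longrightarrow> hol_param Z H \<Longrightarrow> hol_param Z (\<lambda>z. (x_deriv ^^ i) (H z))"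
proof (induction i)
  case (Suc i)
  from hol_param_x_deriv[OF Suc.prems(1) symbol_x_deriv_funpow[OF Suc.prems(2)] Suc.IH[OF Suc.prems]] show ?case by simp
qed simp

text \<open>The primitive that vanishes at \<open>u = 0\<close> is chosen for every parameter, so it
  is a limit of Riemann sums over the segment from 0 to \<open>v z\<close> and inherits holomorphy
  in \<open>z\<close>.\<close>

lemma ex_primitive:
  assumes Z: "open Z" and s: "symbol Z c G" and h: "hol_param Z G"
  shows "\<exists>J c'. symbol Z c' J \<and> hol_param Z J \<and> (\<forall>z\<in>Z. \<forall>u. (J z has_field_derivative G z u) (at u))"
proof -
  have "\<exists>j. j 0 = 0 \<and> (\<forall>u. (j has_field_derivative G z u) (at u))" if z: "z \<in> Z" for z
  proof -
    obtain g where g: "\<And>x. (g has_field_derivative G z x) (at x)"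
      using holomorphic_convex_primitive'[OF convex_UNIV open_UNIV symbol_holomorphic[OF s z]] by auto
    show ?thesis by (rule exI[of _ "\<lambda>u. g u - g 0"]) (auto intro!: derivative_eq_intros g)
  qed
  then obtain J where J0: "\<And>z. z \<in> Z \<Longrightarrow> J z 0 = 0" and J: "\<And>z u. z \<in> Z \<Longrightarrow> (J z has_field_derivative G z u) (at u)" by metis
  have "symbol Z (\<bar>c\<bar> + 1) J"
    unfolding symbol_def growth_def
  proof (intro conjI allI ballI)
    fix z assume "z \<in> Z"
    thus "J z holomorphic_on UNIV" using J by (metis field_differentiable_def field_differentiable_at_within holomorphic_on_def)
  next
    fix a
    obtain C where C: "C \<ge> 0" "\<And>z u. z \<in> Z \<Longrightarrow> \<bar>Im u\<bar> \<le> a \<Longrightarrow> Re u \<ge> -a \<Longrightarrow> cmod (G z u) \<le> C * exp (\<bar>c\<bar> * Re u)"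
      using symbolE[OF symbol_mono[OF s abs_ge_self], of a] by blast
    \<comment> \<open>On the segment from 0 to \<open>u\<close> the real part is at most
      \<open>Re u + 2 * a\<close>. The length of the segment is at most
      \<open>exp (Re u + 2 * a) * (1 + 2 * a)\<close>, which raises the exponent by 1.\<close>
    define K where "K = C * exp (2 * (\<bar>c\<bar> + 1) * \<bar>a\<bar>) * (1 + 2 * \<bar>a\<bar>)"
    show "\<exists>C\<ge>0. \<forall>z\<in>Z. \<forall>u. \<bar>Im u\<bar> \<le> a \<longrightarrow> Re u \<ge> -a \<longrightarrow> cmod (J z u) \<le> C * exp ((\<bar>c\<bar>+1) * Re u)"
    proof (intro exI[of _ K] conjI ballI allI impI)
      fix z u assume *: "z \<in> Z" "\<bar>Im u\<bar> \<le> a" "Re u \<ge> -a"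
      have a: "a \<ge> 0" using * by linarith
      have "cmod (J z u - J z 0) \<le> (C * exp (\<bar>c\<bar> * (Re u + 2 * a))) * cmod (u - 0)"
      proof (rule entire_bound)
        fix x assume "x \<in> closed_segment 0 u"
        then obtain \<tau> where x: "x = of_real \<tau> * u" "0 \<le> \<tau>" "\<tau> \<le> 1" by (auto simp: closed_segment_def scaleR_conv_of_real)
        have "\<bar>Im x\<bar> \<le> 1 * \<bar>Im u\<bar>" unfolding x using x(2,3) by (auto simp: abs_mult intro: mult_left_le_one_le)
        have "\<tau> * Re u \<le> Re u + 2 * a"
        proof -
          have "(1 - \<tau>) * (Re u + 2 * a) \<ge> 0" using x * a by (intro mult_nonneg_nonneg) auto
          moreover have "\<tau> * a \<ge> 0" using x a by auto
          ultimately show ?thesis by (simp add: algebra_simps)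
        qed
        have "\<tau> * Re u \<ge> \<tau> * (-a)" using x * by (intro mult_left_mono) auto
        hence "\<tau> * Re u \<ge> -a" using mult_right_mono[OF x(3) a] by auto
        have "cmod (G z x) \<le> C * exp (\<bar>c\<bar> * Re x)"
          by (rule C) (use * x \<open>\<bar>Im x\<bar> \<le> 1 * \<bar>Im u\<bar>\<close> \<open>\<tau> * Re u \<ge> -a\<close> in auto)
        also have "\<dots> \<le> C * exp (\<bar>c\<bar> * (Re u + 2 * a))"
          using C(1) \<open>\<tau> * Re u \<le> Re u + 2 * a\<close> x by (intro mult_left_mono) (auto intro: mult_left_mono)
        finally show "cmod (G z x) \<le> C * exp (\<bar>c\<bar> * (Re u + 2 * a))" .
      qed (use J * in auto)
      hence "cmod (J z u) \<le> (C * exp (\<bar>c\<bar> * (Re u + 2 * a))) * cmod u" using J0 * by simp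
      also have "cmod u \<le> exp (Re u + 2 * a) * (1 + 2 * a)"
      proof -
        have "cmod u \<le> \<bar>Re u\<bar> + \<bar>Im u\<bar>" by (rule cmod_le)
        also have "\<dots> \<le> (Re u + 2 * a) + a" using * by auto
        also have "\<dots> \<le> (1 + (Re u + 2 * a)) * (1 + 2 * a)"
        proof -
          have "0 \<le> (Re u + 2 * a) * (2 * a)" using * a by (intro mult_nonneg_nonneg) auto
          thus ?thesis using a by (simp add: algebra_simps)
        qed
        also have "\<dots> \<le> exp (Re u + 2 * a) * (1 + 2 * a)" using a exp_ge_add_one_self[of "Re u + 2 * a"] by (intro mult_right_mono) auto
        finally show ?thesis .
      qed
      hence "(C * exp (\<bar>c\<bar> * (Re u + 2 * a))) * cmod u \<le> (C * exp (\<bar>c\<bar> * (Re u + 2 * a))) * (exp (Re u + 2 * a) * (1 + 2 * a))"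
        using C(1) by (intro mult_left_mono) auto
      also have "\<dots> = K * exp ((\<bar>c\<bar>+1) * Re u)" using a by (simp add: K_def exp_add[symmetric] algebra_simps)
      finally show "cmod (J z u) \<le> K * exp ((\<bar>c\<bar>+1) * Re u)" .
    qed (use C in \<open>auto simp: K_def\<close>)
  qed
  moreover have "hol_param Z J"
    unfolding hol_param_def
  proof (intro allI impI)
    fix v assume v: "v holomorphic_on Z"
    \<comment> \<open>Left Riemann sums: each of the \<open>n + 1\<close> cells has a Taylor error
      of at most \<open>K * (A / (n + 1))^2\<close>, so the total error is
      \<open>O(1 / n)\<close>.\<close>
    let ?f = "\<lambda>n z. \<Sum>k<Suc n. v z / of_nat (Suc n) * G z (v z * of_nat k / of_nat (Suc n))"
    show "(\<lambda>z. J z (v z)) holomorphic_on Z"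
    proof (rule holomorphic_rate_limit[OF Z v, of ?f])
      fix n show "?f n holomorphic_on Z" by (intro holomorphic_intros hol_paramD[OF h] v) auto
    next
      fix A :: real assume A: "A \<ge> 0"
      obtain K where K: "K \<ge> 0" "\<And>z u. z \<in> Z \<Longrightarrow> cmod u \<le> A \<Longrightarrow> cmod (deriv (G z) u) \<le> K"
        using symbol_disc_bound[OF symbol_deriv[OF s]] by metis
      show "\<exists>K. \<forall>n. \<forall>z\<in>Z. cmod (v z) \<le> A \<longrightarrow> cmod (?f n z - J z (v z)) \<le> K / real (Suc n)"
      proof (intro exI[of _ "K * A\<^sup>2"] allI ballI impI)
        fix n z assume z: "z \<in> Z" "cmod (v z) \<le> A"
        define w where "w k = v z * of_nat k / of_nat (Suc n)" for k
        have w0: "w 0 = 0" "w (Suc n) = v z" by (auto simp: w_def simp del: of_nat_Suc)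
        have wd: "w (Suc k) - w k = v z / of_nat (Suc n)" for k
          unfolding w_def diff_divide_distrib[symmetric] by (simp add: algebra_simps)
        have wA: "cmod (w k) \<le> A" if "k \<le> Suc n" for k
        proof -
          have "cmod (w k) = cmod (v z) * (real k / real (Suc n))" unfolding w_def by (simp add: norm_mult norm_divide del: of_nat_Suc)
          also have "\<dots> \<le> A * 1" using that z order_trans[OF norm_ge_zero z(2)] by (intro mult_mono) (auto simp: divide_simps)
          finally show ?thesis by simp
        qed
        have "J z (v z) = (\<Sum>k<Suc n. J z (w (Suc k)) - J z (w k))"
          using sum_lessThan_telescope[of "\<lambda>k. J z (w k)" "Suc n"] w0 J0[OF z(1)] by simp
        hence "?f n z - J z (v z) = (\<Sum>k<Suc n. (w (Suc k) - w k) * G z (w k) - (J z (w (Suc k)) - J z (w k)))"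
          unfolding sum_subtractf wd by (simp add: w_def)
        also have "cmod \<dots> \<le> (\<Sum>k<Suc n. K * (A / real (Suc n))\<^sup>2)"
        proof (rule sum_norm_le)
          fix k assume k: "k \<in> {..<Suc n}"
          have "cmod (J z (w (Suc k)) - J z (w k) - (w (Suc k) - w k) * G z (w k)) \<le> K * (cmod (w (Suc k) - w k))\<^sup>2"
          proof (rule entire_taylor1)
            fix x assume x: "x \<in> closed_segment (w k) (w (Suc k))"
            show "cmod (deriv (G z) x) \<le> K"
              by (intro K z closed_segment_cmod[OF x] wA) (use k in auto)
          qed (use J z symbol_holomorphic[OF s] entire_has_deriv in auto)
          also have "cmod (w (Suc k) - w k) \<le> A / real (Suc n)" unfolding wd using z by (simp add: norm_divide divide_right_mono del: of_nat_Suc)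
          hence "K * (cmod (w (Suc k) - w k))\<^sup>2 \<le> K * (A / real (Suc n))\<^sup>2" using K by (intro mult_left_mono power_mono) auto
          finally show "cmod ((w (Suc k) - w k) * G z (w k) - (J z (w (Suc k)) - J z (w k))) \<le> K * (A / real (Suc n))\<^sup>2"
            by (subst norm_minus_commute) (simp add: algebra_simps)
        qed
        also have "\<dots> = K * A\<^sup>2 / real (Suc n)" by (simp add: power2_eq_square divide_simps del: of_nat_Suc)
        finally show "cmod (?f n z - J z (v z)) \<le> K * A\<^sup>2 / real (Suc n)" .
      qed
    qed
  qed
  ultimately show ?thesis using J by blast
qed

section \<open>Solving the difference equation\<close>

lemma exp_neg_2_le: "exp (-2::real) \<le> 1/2"
proof -
  have "exp (2::real) \<ge> 1 + 2" by (rule exp_ge_add_one_self)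
  thus ?thesis by (simp add: exp_minus field_simps)
qed

text \<open>This is the origin of the threshold 2: it makes
  \<open>cmod (exp (-u)) \<le> 1/2\<close>, so the whole path from \<open>x\<close> to
  \<open>x - 1\<close>, divided by \<open>x\<close>, stays in the right half plane.\<close>

lemma one_minus_bounds:
  assumes u: "Re u \<ge> 2" and \<tau>: "cmod \<tau> \<le> 1"
  defines "w \<equiv> 1 - \<tau> * exp (-u)"
  shows "cmod w \<ge> 1/2" "cmod w \<le> 3/2" "Re w > 0"
proof -
  have "exp (- Re u) \<le> exp (-2)" using u by simp
  hence "exp (- Re u) \<le> 1/2" using exp_neg_2_le by linarith
  hence "cmod (\<tau> * exp (-u)) \<le> 1 * (1/2)"
    unfolding norm_mult using \<tau> by (intro mult_mono) (auto simp: norm_exp_eq_Re)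
  hence *: "cmod (\<tau> * exp (-u)) \<le> 1/2" by simp
  show "cmod w \<ge> 1/2" using norm_triangle_ineq2[of 1 "\<tau> * exp (-u)"] * by (simp add: w_def)
  show "cmod w \<le> 3/2" using norm_triangle_ineq4[of 1 "\<tau> * exp (-u)"] * by (simp add: w_def)
  show "Re w > 0" using complex_Re_le_cmod[of "\<tau> * exp (-u)"] * by (simp add: w_def)
qed

lemma log_shift_strip:
  assumes u: "Re u \<ge> 2" and \<tau>: "cmod \<tau> \<le> 1"
  defines "v \<equiv> u + Ln (1 - \<tau> * exp (-u))"
  shows "\<bar>Im v - Im u\<bar> \<le> 4" "\<bar>Re v - Re u\<bar> \<le> 1"
proof -
  define w where "w = 1 - \<tau> * exp (-u)"
  note b = one_minus_bounds[OF u \<tau>, folded w_def]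
  have w0: "w \<noteq> 0" using b(3) by auto
  show "\<bar>Im v - Im u\<bar> \<le> 4" using mpi_less_Im_Ln[OF w0] Im_Ln_le_pi[OF w0] pi_less_4 by (simp add: v_def w_def)
  have "ln (cmod w) \<le> cmod w - 1" using w0 by (intro ln_le_minus_one) auto
  moreover have "ln (1 / cmod w) \<le> 1 / cmod w - 1" using w0 by (intro ln_le_minus_one) auto
  moreover have "1 / cmod w \<le> 2" using b(1) w0 by (simp add: field_simps)
  ultimately have "\<bar>ln (cmod w)\<bar> \<le> 1" using b(2) w0 by (simp add: ln_div abs_le_iff)
  thus "\<bar>Re v - Re u\<bar> \<le> 1" using w0 by (simp add: v_def w_def[symmetric])
qed

text \<open>With \<open>x = exp u\<close> the argument of \<open>h\<close> is a logarithm of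
  \<open>x - \<tau>\<close>, so differentiation in \<open>\<tau>\<close> is
  \<open>- d/dx\<close>.\<close>

lemma x_deriv_along_log:
  assumes h: "h holomorphic_on UNIV" and u: "Re u \<ge> 2" and \<tau>: "cmod \<tau> \<le> 1"
  shows "((\<lambda>\<tau>. h (u + Ln (1 - \<tau> * exp (-u)))) has_field_derivative - x_deriv h (u + Ln (1 - \<tau> * exp (-u)))) (at \<tau>)"
proof -
  define w where "w = 1 - \<tau> * exp (-u)"
  have w: "Re w > 0" using one_minus_bounds(3)[OF u \<tau>] by (simp add: w_def)
  hence w': "w \<notin> \<real>\<^sub>\<le>\<^sub>0" "w \<noteq> 0" by (auto simp: complex_nonpos_Reals_iff)
  have "((\<lambda>\<tau>. u + Ln (1 - \<tau> * exp (-u))) has_field_derivative - exp (-u) / w) (at \<tau>)"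
    using w' by (auto intro!: derivative_eq_intros simp: w_def divide_inverse)
  from DERIV_chain2[OF entire_has_deriv[OF h] this]
  have "((\<lambda>\<tau>. h (u + Ln (1 - \<tau> * exp (-u)))) has_field_derivative deriv h (u + Ln w) * (- exp (-u) / w)) (at \<tau>)"
    by (simp add: w_def)
  moreover have "deriv h (u + Ln w) * (- exp (-u) / w) = - x_deriv h (u + Ln w)"
    using w' by (simp add: x_deriv_def exp_add exp_diff exp_minus field_simps)
  ultimately show ?thesis by (simp add: w_def)
qed

lemma exp_log_shift: assumes "Re u \<ge> 2" shows "exp (log_shift u) = exp u - 1"
proof -
  have "1 - exp (-u) \<noteq> 0" using one_minus_bounds(3)[OF assms, of 1] by auto
  thus ?thesis by (simp add: log_shift_def exp_add algebra_simps exp_minus)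
qed

lemma x_deriv_funpow_holomorphic: "h holomorphic_on UNIV \<Longrightarrow> (x_deriv ^^ i) h holomorphic_on UNIV"
proof (induction i)
  case (Suc i)
  show ?case using holomorphic_deriv[OF Suc.IH[OF Suc.prems] open_UNIV]
    by (auto simp: x_deriv_def[abs_def] intro!: holomorphic_intros)
qed simp

text \<open>Taylor's formula in \<open>\<tau>\<close> at 0, evaluated at 1. The growth hypothesis
  concerns only the derivative in the remainder, so the formula profits from decay of derivatives
  even when \<open>H\<close> itself is not known to decay.\<close>

lemma log_shift_taylor_gen:
  assumes h: "\<And>z. z \<in> Z \<Longrightarrow> H z holomorphic_on UNIV" and s: "symbol Z c (\<lambda>z. (x_deriv ^^ Suc K) (H z))"
  shows "small Z (- c) (\<lambda>z u. H z (log_shift u) - (\<Sum>i\<le>K. (-1)^i / fact i * (x_deriv ^^ i) (H z) u))"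
  unfolding small_def growth_def
proof
  fix a
  \<comment> \<open>The path to the shifted point changes the imaginary part of \<open>u\<close> by
    at most 4, by \<open>log_shift_strip\<close>, so the bound is taken on a strip wider by
    4.\<close>
  obtain C where C: "C \<ge> 0" "\<And>z u. z \<in> Z \<Longrightarrow> \<bar>Im u\<bar> \<le> \<bar>a\<bar> + 4 \<Longrightarrow> Re u \<ge> -(\<bar>a\<bar> + 4) \<Longrightarrow> cmod ((x_deriv ^^ Suc K) (H z) u) \<le> C * exp (c * Re u)"
    using symbolE[OF s, of "\<bar>a\<bar> + 4"] by blast
  show "\<exists>C\<ge>0. \<forall>z\<in>Z. \<forall>u. \<bar>Im u\<bar> \<le> a \<longrightarrow> Re u \<ge> 2 \<longrightarrow>
     cmod (H z (log_shift u) - (\<Sum>i\<le>K. (-1)^i / fact i * (x_deriv ^^ i) (H z) u)) \<le> C * exp (- (- c) * Re u)"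
  proof (intro exI[of _ "C * exp \<bar>c\<bar>"] conjI ballI allI impI)
    fix z u assume *: "z \<in> Z" "\<bar>Im u\<bar> \<le> a" "Re u \<ge> 2"
    define l where "l \<tau> = u + Ln (1 - \<tau> * exp (-u))" for \<tau>
    define f where "f i \<tau> = (-1)^i * (x_deriv ^^ i) (H z) (l \<tau>)" for i \<tau>
    have seg: "cmod \<tau> \<le> 1" if "\<tau> \<in> closed_segment 0 1" for \<tau> :: complex
      using closed_segment_cmod[OF that, of 1] by simp
    have "cmod (f 0 1 - (\<Sum>i\<le>K. f i 0 * (1 - 0)^i / fact i)) \<le> (C * exp \<bar>c\<bar> * exp (c * Re u)) * cmod (1 - 0 :: complex) ^ Suc K / fact K"
    proof (rule complex_Taylor)
      fix i \<tau> assume \<tau>: "\<tau> \<in> closed_segment (0::complex) 1"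
      have "((\<lambda>\<tau>. (x_deriv ^^ i) (H z) (l \<tau>)) has_field_derivative - x_deriv ((x_deriv ^^ i) (H z)) (l \<tau>)) (at \<tau>)"
        unfolding l_def by (rule x_deriv_along_log) (use * seg[OF \<tau>] x_deriv_funpow_holomorphic h in auto)
      from DERIV_cmult[OF this, of "(-1)^i"]
      show "(f i has_field_derivative f (Suc i) \<tau>) (at \<tau> within closed_segment 0 1)"
        by (auto simp: f_def[abs_def] intro: has_field_derivative_at_within)
    next
      fix \<tau> assume \<tau>: "\<tau> \<in> closed_segment (0::complex) 1"
      note st = log_shift_strip[OF *(3) seg[OF \<tau>], folded l_def]
      have "cmod (f (Suc K) \<tau>) = cmod ((x_deriv ^^ Suc K) (H z) (l \<tau>))" by (simp only: f_def norm_mult norm_power) simp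
      also have "\<dots> \<le> C * exp (c * Re (l \<tau>))" by (rule C) (use * st in auto)
      also have "\<dots> \<le> C * (exp \<bar>c\<bar> * exp (c * Re u))"
      proof -
        have "c * (Re (l \<tau>) - Re u) \<le> \<bar>c\<bar> * \<bar>Re (l \<tau>) - Re u\<bar>" by (metis abs_ge_self abs_mult)
        also have "\<dots> \<le> \<bar>c\<bar> * 1" using st by (intro mult_left_mono) auto
        finally have "exp (c * Re (l \<tau>)) \<le> exp (\<bar>c\<bar> + c * Re u)" by (simp add: algebra_simps)
        thus ?thesis unfolding exp_add[symmetric] using C(1) by (intro mult_left_mono)
      qed
      finally show "cmod (f (Suc K) \<tau>) \<le> C * exp \<bar>c\<bar> * exp (c * Re u)" by (simp add: mult.assoc)
    qed auto
    also have "\<dots> \<le> C * exp \<bar>c\<bar> * exp (c * Re u)"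
      using mult_left_mono[OF fact_ge_1[of K, where 'a=real], of "C * exp \<bar>c\<bar> * exp (c * Re u)"] C(1)
      by (simp add: divide_le_eq)
    finally show "cmod (H z (log_shift u) - (\<Sum>i\<le>K. (-1)^i / fact i * (x_deriv ^^ i) (H z) u)) \<le> C * exp \<bar>c\<bar> * exp (- (- c) * Re u)"
      by (simp add: f_def l_def log_shift_def algebra_simps)
  qed (use C in auto)
qed

lemma log_shift_taylor:
  assumes s: "symbol Z c H"
  shows "small Z (real (Suc K) - c) (\<lambda>z u. H z (log_shift u) - (\<Sum>i\<le>K. (-1)^i / fact i * (x_deriv ^^ i) (H z) u))"
  using log_shift_taylor_gen[OF symbol_holomorphic[OF s] symbol_x_deriv_funpow[OF s, of "Suc K"]] by (simp only: minus_diff_eq)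

lemma x_deriv_primitive:
  assumes "\<And>u. (J has_field_derivative exp u * G u) (at u)" shows "x_deriv J = G"
  by (rule ext) (simp add: x_deriv_def DERIV_imp_deriv[OF assms] exp_minus)

text \<open>
  Minus a primitive solves the equation up to the higher Taylor terms, whose order is lower by one;
  iterating replaces the Bernoulli numbers of the usual formula.
\<close>
lemma euler_maclaurin_aux:
  assumes Z: "open Z"
  shows "symbol Z c G \<Longrightarrow> hol_param Z G \<Longrightarrow> c + M \<le> real N \<Longrightarrow>
    \<exists>H c'. symbol Z c' H \<and> hol_param Z H \<and> small Z M (\<lambda>z u. H z (log_shift u) - H z u - G z u)"
proof (induction N arbitrary: c G)
  case 0
  have "small Z M (\<lambda>z u. - G z u)" by (rule small_uminus, rule small_mono[OF symbol_imp_small[OF 0(1)]]) (use 0 in auto)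
  thus ?case using hol_param_coeff[of "\<lambda>_. 0" Z] by (intro exI[of _ "\<lambda>z u. 0"] exI[of _ 0]) (auto simp: symbol_zero)
next
  case (Suc N)
  have sE: "symbol Z (1 + c) (\<lambda>z u. exp u * G z u)" using symbol_mult[OF symbol_exp[of Z "\<lambda>_. -1" 1 1] Suc.prems(1)] by simp
  have hE: "hol_param Z (\<lambda>z u. exp u * G z u)" using hol_param_mult[OF hol_param_exp[of "\<lambda>_. -1" Z] Suc.prems(2)] by simp
  obtain J d where J: "symbol Z d J" "hol_param Z J" "\<And>z u. z \<in> Z \<Longrightarrow> (J z has_field_derivative exp u * G z u) (at u)"
    using ex_primitive[OF Z sE hE] by blast
  have dJ: "x_deriv (J z) = G z" if "z \<in> Z" for z by (rule x_deriv_primitive) (rule J(3)[OF that])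
  \<comment> \<open>Enough Taylor terms for a remainder of order at most \<open>-M\<close>, and at
    least one, so that the terms of index 0 and 1 can be split off.\<close>
  define K where "K = Suc (nat \<lceil>\<bar>d\<bar> + \<bar>M\<bar>\<rceil>)"
  have K: "real (Suc K) - d \<ge> M" unfolding K_def by linarith
  \<comment> \<open>The Taylor terms of \<open>J\<close> from the second on, written with
    \<open>x_deriv J = G\<close>. Each contains at least one derivative of \<open>G\<close>, whence
    the order \<open>c - 1\<close> that feeds the induction.\<close>
  define G2 where "G2 z u = (\<Sum>i\<in>{2..K}. (-1)^i / fact i * (x_deriv ^^ (i-1)) (G z) u)" for z u
  have s2: "symbol Z (c - 1) G2" unfolding G2_def
  proof (intro symbol_sum symbol_cmult)
    fix i assume "i \<in> {2..K}"
    show "symbol Z (c - 1) (\<lambda>z. (x_deriv ^^ (i - 1)) (G z))"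
      by (rule symbol_mono[OF symbol_x_deriv_funpow[OF Suc.prems(1), of "i-1"]]) (use \<open>i \<in> _\<close> in auto)
  qed auto
  have h2: "hol_param Z G2" unfolding G2_def
    by (intro hol_param_sum hol_param_cmult hol_param_x_deriv_funpow[OF Z Suc.prems(1,2)])
  obtain H2 c2 where H2: "symbol Z c2 H2" "hol_param Z H2" "small Z M (\<lambda>z u. H2 z (log_shift u) - H2 z u - G2 z u)"
    using Suc.IH[OF s2 h2] Suc.prems(3) by (auto simp: algebra_simps)
  have main: "(\<Sum>i\<le>K. (-1)^i / fact i * (x_deriv ^^ i) (J z) u) = J z u - G z u + G2 z u" if "z \<in> Z" for z u
  proof -
    have "K \<ge> 1" by (simp add: K_def)
    hence "{..K} = insert 0 (insert 1 {2..K})" by auto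
    moreover have "(\<Sum>i\<in>{2..K}. (-1)^i / fact i * (x_deriv ^^ i) (J z) u) = G2 z u"
      unfolding G2_def
    proof (rule sum.cong[OF refl])
      fix i assume "i \<in> {2..K}"
      hence "i = Suc (i - 1)" by auto
      hence "(x_deriv ^^ i) (J z) = (x_deriv ^^ (i-1)) (x_deriv (J z))" by (metis funpow_Suc_right o_apply)
      thus "(-1)^i / fact i * (x_deriv ^^ i) (J z) u = (-1)^i / fact i * (x_deriv ^^ (i-1)) (G z) u" using dJ[OF that] by simp
    qed
    ultimately show ?thesis using dJ[OF that] by simp
  qed
  have "small Z M (\<lambda>z u. J z (log_shift u) - (J z u - G z u + G2 z u))"
    by (rule small_cong[OF small_mono[OF log_shift_taylor[OF J(1)] K]]) (simp only: main)
  from small_diff[OF H2(3) this]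
  have "small Z M (\<lambda>z u. (H2 z (log_shift u) - J z (log_shift u)) - (H2 z u - J z u) - G z u)"
    by (rule small_cong) (simp add: algebra_simps)
  moreover have "symbol Z (max d c2) (\<lambda>z u. H2 z u - J z u)"
    by (rule symbol_diff; rule symbol_mono[OF H2(1)] symbol_mono[OF J(1)]) auto
  moreover have "hol_param Z (\<lambda>z u. H2 z u - J z u)" using hol_param_add[OF H2(2) hol_param_uminus[OF J(2)]] by simp
  ultimately show ?case by blast
qed

lemma euler_maclaurin:
  assumes "open Z" "symbol Z c G" "hol_param Z G"
  shows "\<exists>H c'. symbol Z c' H \<and> hol_param Z H \<and> small Z M (\<lambda>z u. H z (log_shift u) - H z u - G z u)"
  by (rule euler_maclaurin_aux[OF assms, of M "nat \<lceil>c + M\<rceil>"]) (rule real_nat_ceiling_ge)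

section \<open>Uniqueness for the difference equation\<close>

text \<open>Bootstrapping: each application of the Taylor formula lowers the order of the derivative by one.\<close>
lemma difference_small_imp_deriv_small:
  assumes s: "symbol Z c D" and d: "small Z M (\<lambda>z u. D z (log_shift u) - D z u)"
  shows "symbol Z (1 - M) (\<lambda>z. deriv (D z))"
proof -
  \<comment> \<open>The first-order Taylor formula says that \<open>x_deriv D\<close> is minus the
    given small difference plus a remainder. The remainder involves only the second derivative, of
    order \<open>c' - 2\<close>. Multiplying by \<open>x\<close> returns to
    \<open>deriv D\<close>.\<close>
  have step: "symbol Z (max (1 - M) (c' - 1)) (\<lambda>z. deriv (D z))" if s': "symbol Z c' (\<lambda>z. deriv (D z))" for c'
  proof -
    have s1: "symbol Z (c' - 1) (\<lambda>z. x_deriv (D z))"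
      using symbol_mult[OF symbol_exp[of Z "\<lambda>_. 1" 1 "-1"] s'] by (simp add: x_deriv_def[abs_def])
    have s2: "symbol Z (c' - 2) (\<lambda>z. x_deriv (x_deriv (D z)))" using symbol_x_deriv[OF s1] by simp
    have "small Z (2 - c') (\<lambda>z u. D z (log_shift u) - D z u + x_deriv (D z) u)"
      using log_shift_taylor_gen[OF symbol_holomorphic[OF s], where K=1 and c="c' - 2"] s2
      by (simp add: algebra_simps)
    note t = this
    have "small Z (min M (2 - c')) (\<lambda>z u. (D z (log_shift u) - D z u + x_deriv (D z) u) - (D z (log_shift u) - D z u))"
      by (rule small_diff[OF small_mono[OF t] small_mono[OF d]]) auto
    hence "small Z (min M (2 - c')) (\<lambda>z u. x_deriv (D z) u)" by (rule small_cong) simp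
    from symbol_mult_small[OF symbol_exp[of Z "\<lambda>_. -1" 1 1] this]
    have sm: "small Z (min M (2 - c') - 1) (\<lambda>z u. deriv (D z) u)"
      by (auto intro: small_cong simp: x_deriv_def exp_minus)
    show ?thesis by (rule symbol_mono[OF symbol_of_small[OF s' sm]]) auto
  qed
  have "symbol Z (max (1 - M) (c - real n)) (\<lambda>z. deriv (D z))" for n
  proof (induction n)
    case 0 show ?case by (rule symbol_mono[OF symbol_deriv[OF s]]) auto
  next
    case (Suc n)
    show ?case by (rule symbol_mono[OF step[OF Suc.IH]]) auto
  qed
  from this[of "nat \<lceil>\<bar>c\<bar> + \<bar>M\<bar>\<rceil>"] show ?thesis by (rule symbol_mono) linarith
qed

text \<open>The derivative decays like \<open>1 / \<bar>x\<bar>\<close>, and the two points stay at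
  bounded distance in \<open>u\<close>. So limits at infinity can be compared across different
  arguments, in particular between both sides of the circle.\<close>

lemma symbol_increment_tendsto_0:
  assumes s: "symbol Z (-1) (\<lambda>z. deriv (D z))" and z: "z \<in> Z" and h: "D z holomorphic_on UNIV"
    and a: "\<And>n. \<bar>Im (a n)\<bar> \<le> A" and b: "\<And>n. \<bar>Im (b n)\<bar> \<le> A"
    and ab: "\<And>n. cmod (a n - b n) \<le> K" and lim: "filterlim (\<lambda>n. Re (a n)) at_top sequentially"
  shows "(\<lambda>n. D z (a n) - D z (b n)) \<longlonglongrightarrow> 0"
proof -
  have A: "A \<ge> 0" using a[of 0] by linarith
  obtain C where C: "C \<ge> 0" "\<And>z u. z \<in> Z \<Longrightarrow> \<bar>Im u\<bar> \<le> A \<Longrightarrow> Re u \<ge> -A \<Longrightarrow> cmod (deriv (D z) u) \<le> C * exp (-1 * Re u)"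
    using symbolE[OF s] by blast
  have K: "K \<ge> 0" using ab[of 0] norm_ge_zero order_trans by blast
  have *: "cmod (D z (a n) - D z (b n)) \<le> C * exp (- (Re (a n) - K)) * K" if n: "Re (a n) \<ge> K" for n
  proof -
    have reb: "Re (b n) \<ge> Re (a n) - K" using ab[of n] abs_Re_le_cmod[of "a n - b n"] by auto
    have "cmod (D z (a n) - D z (b n)) \<le> (C * exp (- (Re (a n) - K))) * cmod (a n - b n)"
    proof (rule entire_bound)
      fix x assume x: "x \<in> closed_segment (b n) (a n)"
      have "convex {x. \<bar>Im x\<bar> \<le> A \<and> Re x \<ge> Re (a n) - K}"
      proof -
        have "{x. \<bar>Im x\<bar> \<le> A \<and> Re x \<ge> Re (a n) - K} = {x. Im x \<le> A} \<inter> {x. Im x \<ge> -A} \<inter> {x. Re x \<ge> Re (a n) - K}" by auto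
        thus ?thesis by (simp add: convex_Int convex_halfspace_Im_le convex_halfspace_Im_ge convex_halfspace_Re_ge)
      qed
      hence x': "\<bar>Im x\<bar> \<le> A \<and> Re x \<ge> Re (a n) - K"
        using closed_segment_subset[of "b n" "{x. \<bar>Im x\<bar> \<le> A \<and> Re x \<ge> Re (a n) - K}" "a n"] x a[of n] b[of n] reb K by auto
      have "cmod (deriv (D z) x) \<le> C * exp (-1 * Re x)" by (rule C) (use z x' n A in auto)
      also have "\<dots> \<le> C * exp (- (Re (a n) - K))" using C(1) x' by (intro mult_left_mono) auto
      finally show "cmod (deriv (D z) x) \<le> C * exp (- (Re (a n) - K))" .
    qed (use h entire_has_deriv in auto)
    also have "\<dots> \<le> C * exp (- (Re (a n) - K)) * K" using C(1) ab by (intro mult_left_mono) auto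
    finally show ?thesis .
  qed
  show ?thesis
  proof (rule Lim_null_comparison)
    show "\<forall>\<^sub>F n in sequentially. cmod (D z (a n) - D z (b n)) \<le> C * exp (- (Re (a n) - K)) * K"
    proof -
      have "\<forall>\<^sub>F n in sequentially. K \<le> Re (a n)" using lim by (simp add: filterlim_at_top)
      thus ?thesis by (rule eventually_mono) (rule *)
    qed
    have "filterlim (\<lambda>n. - (Re (a n) - K)) at_bot sequentially"
      using filterlim_tendsto_add_at_top[OF tendsto_const[of "-K"] lim] unfolding filterlim_uminus_at_bot by simp
    hence "(\<lambda>n. exp (- (Re (a n) - K))) \<longlonglongrightarrow> 0" by (rule filterlim_compose[OF exp_at_bot])
    from tendsto_mult_right[OF tendsto_mult_left[OF this, of C], of K]
    show "(\<lambda>n. C * exp (- (Re (a n) - K)) * K) \<longlonglongrightarrow> 0" by simp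
  qed
qed

text \<open>The right-hand side is the integral of \<open>C * exp (- k * x)\<close> from
  \<open>x0\<close> to infinity, a bound independent of \<open>x1\<close>.\<close>

lemma horizontal_bound:
  assumes h: "d holomorphic_on UNIV" and k: "k > 0" and C: "C \<ge> 0" and x: "x0 \<le> x1"
    and b: "\<And>x. x \<ge> x0 \<Longrightarrow> cmod (deriv d (Complex x y)) \<le> C * exp (- k * x)"
  shows "cmod (d (Complex x1 y) - d (Complex x0 y)) \<le> C / k * exp (- k * x0)"
proof (cases "x0 = x1")
  case True thus ?thesis using C k by simp
next
  case False
  have dv: "((\<lambda>x. d (Complex x y)) has_vector_derivative deriv d (Complex x y)) (at x)" for x
  proof -
    have 1: "((\<lambda>x. Complex x y) has_vector_derivative 1) (at x)"
      unfolding Complex_eq by (auto intro!: derivative_eq_intros)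
    show ?thesis using field_vector_diff_chain_at[OF 1 entire_has_deriv[OF h]] by (simp add: o_def)
  qed
  have "norm (d (Complex x1 y) - d (Complex x0 y)) \<le> - C / k * exp (- k * x1) - (- C / k * exp (- k * x0))"
  proof (rule differentiable_bound_general[where f'="\<lambda>x. deriv d (Complex x y)" and \<phi>'="\<lambda>x. C * exp (- k * x)"])
    show "x0 < x1" using x False by simp
    show "continuous_on {x0..x1} (\<lambda>x. d (Complex x y))"
      by (intro continuous_at_imp_continuous_on ballI has_vector_derivative_continuous[OF dv])
    show "continuous_on {x0..x1} (\<lambda>x. - C / k * exp (- k * x))" by (intro continuous_intros)
    fix x assume "x0 < x" "x < x1"
    show "((\<lambda>x. - C / k * exp (- k * x)) has_vector_derivative C * exp (- k * x)) (at x)"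
      unfolding has_real_derivative_iff_has_vector_derivative[symmetric] using k by (auto intro!: derivative_eq_intros)
    show "((\<lambda>x. d (Complex x y)) has_vector_derivative deriv d (Complex x y)) (at x)" by (rule dv)
    show "norm (deriv d (Complex x y)) \<le> C * exp (- k * x)" using b \<open>x0 < x\<close> by simp
  qed
  also have "\<dots> \<le> C / k * exp (- k * x0)" using C k by simp
  finally show ?thesis .
qed

text \<open>By the bootstrapped decay of its derivative, \<open>D\<close> has the same limit on all
  horizontal lines. The sequence \<open>w\<close> shows that this limit is 0, and integrating the
  derivative back from infinity gives the rate.\<close>

lemma difference_small_imp_small:
  assumes s: "symbol Z c D" and d: "small Z M (\<lambda>z u. D z (log_shift u) - D z u)" and M: "M \<ge> 2"
    and w: "\<And>z n. z \<in> Z \<Longrightarrow> \<bar>Im (w z n)\<bar> \<le> A" "\<And>z. z \<in> Z \<Longrightarrow> filterlim (\<lambda>n. Re (w z n)) at_top sequentially"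
    and D0: "\<And>z. z \<in> Z \<Longrightarrow> (\<lambda>n. D z (w z n)) \<longlonglongrightarrow> 0"
  shows "small Z (M - 1) D"
  unfolding small_def growth_def
proof
  fix a
  have sd: "symbol Z (1 - M) (\<lambda>z. deriv (D z))" by (rule difference_small_imp_deriv_small[OF s d])
  obtain C where C: "C \<ge> 0" "\<And>z u. z \<in> Z \<Longrightarrow> \<bar>Im u\<bar> \<le> \<bar>a\<bar> \<Longrightarrow> Re u \<ge> -\<bar>a\<bar> \<Longrightarrow> cmod (deriv (D z) u) \<le> C * exp ((1 - M) * Re u)"
    using symbolE[OF sd] by blast
  show "\<exists>C\<ge>0. \<forall>z\<in>Z. \<forall>u. \<bar>Im u\<bar> \<le> a \<longrightarrow> Re u \<ge> 2 \<longrightarrow> cmod (D z u) \<le> C * exp (- (M - 1) * Re u)"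
  proof (intro exI[of _ "C / (M - 1)"] conjI ballI allI impI)
    fix z u assume *: "z \<in> Z" "\<bar>Im u\<bar> \<le> a" "Re u \<ge> 2"
    \<comment> \<open>The points of \<open>w\<close> are moved vertically onto the horizontal line
      through \<open>u\<close>, keeping their real parts.\<close>
    define v where "v n = Complex (Re (w z n)) (Im u)" for n
    have A: "A \<ge> 0" using w(1)[OF *(1), of 0] by linarith
    have "(\<lambda>n. D z (v n) - D z (w z n)) \<longlonglongrightarrow> 0"
    proof (rule symbol_increment_tendsto_0[where D=D and z=z and Z=Z and a=v and b="w z" and A="\<bar>a\<bar> + A" and K="\<bar>a\<bar> + A"])
      show "symbol Z (-1) (\<lambda>z. deriv (D z))" by (rule symbol_mono[OF sd]) (use M in auto)
      show "D z holomorphic_on UNIV" by (rule symbol_holomorphic[OF s *(1)])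
      fix n
      show "\<bar>Im (v n)\<bar> \<le> \<bar>a\<bar> + A" "\<bar>Im (w z n)\<bar> \<le> \<bar>a\<bar> + A" using * A w(1)[OF *(1), of n] by (auto simp: v_def)
      have "cmod (v n - w z n) \<le> \<bar>Re (v n - w z n)\<bar> + \<bar>Im (v n - w z n)\<bar>" by (rule cmod_le)
      also have "\<dots> \<le> \<bar>a\<bar> + A" using * w(1)[OF *(1), of n] by (simp add: v_def)
      finally show "cmod (v n - w z n) \<le> \<bar>a\<bar> + A" .
    qed (use * w in \<open>auto simp: v_def\<close>)
    from tendsto_add[OF this D0[OF *(1)]] have lim: "(\<lambda>n. D z (v n)) \<longlonglongrightarrow> 0" by simp
    have "\<forall>\<^sub>F n in sequentially. Re (w z n) \<ge> Re u" using w(2)[OF *(1)] by (auto simp: filterlim_at_top)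
    hence bd: "\<forall>\<^sub>F n in sequentially. cmod (D z (v n) - D z u) \<le> C / (M - 1) * exp (- (M - 1) * Re u)"
    proof eventually_elim
      case (elim n)
      have "cmod (D z (Complex (Re (w z n)) (Im u)) - D z (Complex (Re u) (Im u))) \<le> C / (M - 1) * exp (- (M - 1) * Re u)"
      proof (rule horizontal_bound)
        fix x assume x: "x \<ge> Re u"
        show "cmod (deriv (D z) (Complex x (Im u))) \<le> C * exp (- (M - 1) * x)"
          using C(2)[OF *(1), of "Complex x (Im u)"] * x by simp
      qed (use symbol_holomorphic[OF s *(1)] M C elim in auto)
      thus ?case by (simp add: v_def)
    qed
    from tendsto_norm[OF tendsto_diff[OF lim tendsto_const[of "D z u"]]]
    have "(\<lambda>n. cmod (D z (v n) - D z u)) \<longlonglongrightarrow> cmod (D z u)" by simp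
    from tendsto_upperbound[OF this bd] show "cmod (D z u) \<le> C / (M - 1) * exp (- (M - 1) * Re u)" by simp
  qed (use C M in auto)
qed

section \<open>The points of the circle and their logarithms\<close>

text \<open>
  \<open>exp (logm t n) = t - n\<close> with argument near \<open>-pi\<close>: this branch turns \<open>exp (- s * logm t n)\<close> into the
  factor \<open>exp (pi * i * s) * (n - t) powr (- s)\<close> of Komori's sum.
\<close>

definition logp :: "nat \<Rightarrow> complex" where "logp n = complex_of_real (ln (real n))"
definition logm :: "complex \<Rightarrow> nat \<Rightarrow> complex" where "logm t n = Ln (of_nat n - t) - complex_of_real pi * \<i>"

lemma nt_bounds:
  assumes "cmod t < 1/2" "n \<ge> 1"
  shows "Re (of_nat n - t) > 0" "of_nat n - t \<noteq> 0" "cmod (of_nat n - t) \<ge> real n / 2" "cmod (of_nat n - t) \<le> 2 * real n"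
    "cmod (of_nat n - t) \<ge> real n - 1/2"
proof -
  show 1: "Re (of_nat n - t) > 0" using assms complex_Re_le_cmod[of t] by auto
  thus "of_nat n - t \<noteq> 0" by (metis less_irrefl zero_complex.simps(1))
  show 2: "cmod (of_nat n - t) \<ge> real n - 1/2" using norm_triangle_ineq2[of "of_nat n" t] assms by simp
  show "cmod (of_nat n - t) \<ge> real n / 2" using 2 assms(2) by simp
  show "cmod (of_nat n - t) \<le> 2 * real n" using norm_triangle_ineq4[of "of_nat n" t] assms by simp
qed

lemma exp_logm: "cmod t < 1/2 \<Longrightarrow> n \<ge> 1 \<Longrightarrow> exp (logm t n) = t - of_nat n"
  using nt_bounds(2)[of t n] by (simp add: logm_def exp_diff)

lemma exp_logp: "n \<ge> 1 \<Longrightarrow> exp (logp n) = of_nat n"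
  by (simp add: logp_def exp_of_real)

lemma Re_logm: "cmod t < 1/2 \<Longrightarrow> n \<ge> 1 \<Longrightarrow> Re (logm t n) = ln (cmod (of_nat n - t))"
  using nt_bounds(2)[of t n] by (simp add: logm_def)

lemma Im_logm: "cmod t < 1/2 \<Longrightarrow> n \<ge> 1 \<Longrightarrow> \<bar>Im (logm t n)\<bar> \<le> 8"
  using nt_bounds(2)[of t n] mpi_less_Im_Ln[of "of_nat n - t"] Im_Ln_le_pi[of "of_nat n - t"] pi_less_4 by (auto simp: logm_def)

text \<open>\<open>17/2 = 9 - 1/2\<close> bounds \<open>cmod (of_nat n - t)\<close> from below for
  \<open>n \<ge> 9\<close>; this turns the threshold 2 for \<open>Re u\<close> into the threshold 9
  for \<open>n\<close>.\<close>

lemma exp_2_le: "exp (2::real) \<le> 17/2"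
proof -
  have "exp (2::real) = exp 1 * exp 1" by (simp add: exp_add[symmetric])
  also have "\<dots> \<le> (272/100) * (272/100)" using e_less_272 by (intro mult_mono) auto
  finally show ?thesis by simp
qed

lemma ln_ge_2: "(x::real) \<ge> 17/2 \<Longrightarrow> ln x \<ge> 2"
  using exp_2_le by (subst ln_ge_iff) auto

lemma Re_logm_ge: "cmod t < 1/2 \<Longrightarrow> n \<ge> 9 \<Longrightarrow> Re (logm t n) \<ge> 2"
  using nt_bounds(5)[of t n] by (subst Re_logm) (auto intro!: ln_ge_2)

lemma Re_logp_ge: "n \<ge> 9 \<Longrightarrow> Re (logp n) \<ge> 2" by (auto simp: logp_def intro!: ln_ge_2)

lemma Im_logp [simp]: "Im (logp n) = 0" by (simp add: logp_def)

lemma log_shift_logp: "n \<ge> 2 \<Longrightarrow> log_shift (logp n) = logp (n - 1)"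
proof -
  assume n: "n \<ge> 2"
  have "1 - exp (- logp n) = complex_of_real ((real n - 1) / real n)" using n by (simp add: logp_def exp_minus exp_of_real field_simps)
  hence "log_shift (logp n) = logp n + Ln (complex_of_real ((real n - 1) / real n))" by (simp add: log_shift_def)
  also have "\<dots> = complex_of_real (ln (real n) + ln ((real n - 1) / real n))"
    using n by (subst Ln_of_real) (auto simp: logp_def)
  also have "ln (real n) + ln ((real n - 1) / real n) = ln (real (n - 1))" using n by (simp add: ln_div of_nat_diff)
  finally show ?thesis by (simp add: logp_def)
qed

text \<open>On the negative side \<open>x \<mapsto> x - 1\<close> moves outwards, so the index
  increases, whereas it decreases at the positive points. The logarithms of \<open>n - t\<close> and
  of \<open>1 + 1 / (n - t)\<close> add on the principal branch because both arguments have positive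
  real part.\<close>

lemma log_shift_logm:
  assumes t: "cmod t < 1/2" and n: "n \<ge> 9" shows "log_shift (logm t n) = logm t (Suc n)"
proof -
  let ?x = "of_nat n - t" and ?y = "1 - exp (- logm t n)"
  have x: "Re ?x > 0" "?x \<noteq> 0" using nt_bounds[OF t, of n] n by auto
  have y: "Re ?y > 0" using one_minus_bounds(3)[OF Re_logm_ge[OF t n], of 1] by simp
  hence y0: "?y \<noteq> 0" by (metis less_irrefl zero_complex.simps(1))
  have xy: "?x * ?y = of_nat (Suc n) - t"
    using exp_logm[OF t, of n] n x by (simp add: exp_minus field_simps)
  have "\<bar>Im (Ln ?x)\<bar> < pi/2" "\<bar>Im (Ln ?y)\<bar> < pi/2" using Re_Ln_pos_lt_imp x(1) y by blast+
  hence "Ln (?x * ?y) = Ln ?x + Ln ?y" using x y0 by (intro Ln_times_simple) auto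
  thus ?thesis unfolding xy by (simp add: log_shift_def logm_def)
qed

lemma logm_holomorphic:
  assumes "t holomorphic_on Z" "\<And>z. z \<in> Z \<Longrightarrow> cmod (t z) < 1/2" "n \<ge> 1"
  shows "(\<lambda>z. logm (t z) n) holomorphic_on Z"
  unfolding logm_def
  using nt_bounds(1)[OF assms(2) assms(3)] by (intro holomorphic_intros assms(1)) (auto simp: complex_nonpos_Reals_iff not_le)

lemma logm_bounded: "cmod t < 1/2 \<Longrightarrow> n \<ge> 1 \<Longrightarrow> cmod (logm t n) \<le> 2 * real n + 9"
proof -
  assume t: "cmod t < 1/2" and n: "n \<ge> 1"
  note b = nt_bounds[OF t n]
  have "ln (cmod (of_nat n - t)) \<le> cmod (of_nat n - t) - 1" using b by (intro ln_le_minus_one) auto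
  moreover have "ln (1 / cmod (of_nat n - t)) \<le> 1 / cmod (of_nat n - t) - 1" using b by (intro ln_le_minus_one) auto
  moreover have "1 / cmod (of_nat n - t) \<le> 2" using b n by (simp add: field_simps)
  ultimately have "\<bar>ln (cmod (of_nat n - t))\<bar> \<le> 2 * real n" using b n by (simp add: ln_div)
  hence "\<bar>Re (logm t n)\<bar> + \<bar>Im (logm t n)\<bar> \<le> 2 * real n + 8" using Im_logm[OF t n] Re_logm[OF t n] by simp
  thus ?thesis using cmod_le[of "logm t n"] by linarith
qed

section \<open>From half strips to sequences\<close>

lemma small_seq:
  assumes E: "small Z M E" and M: "M \<ge> 0" and t: "\<And>z. z \<in> Z \<Longrightarrow> cmod (t z) < 1/2"
  shows "\<exists>C\<ge>0. \<forall>z\<in>Z. \<forall>n\<ge>9. cmod (E z (logp n)) \<le> C * real n powr - M \<and> cmod (E z (logm (t z) n)) \<le> C * real n powr - M"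
proof -
  obtain C where C: "C \<ge> 0" "\<And>z u. z \<in> Z \<Longrightarrow> \<bar>Im u\<bar> \<le> 8 \<Longrightarrow> Re u \<ge> 2 \<Longrightarrow> cmod (E z u) \<le> C * exp (- M * Re u)"
    using smallE[OF E] by blast
  \<comment> \<open>The factor \<open>2 powr M\<close> pays for
    \<open>cmod (of_nat n - t) \<ge> n / 2\<close>; at least 1, it serves the positive points as
    well.\<close>
  have m: "(2::real) powr M \<ge> 1" using M by (simp add: ge_one_powr_ge_zero)
  show ?thesis
  proof (intro exI[of _ "C * 2 powr M"] conjI ballI allI impI)
    fix z n assume z: "z \<in> Z" and n: "n \<ge> (9::nat)"
    have "cmod (E z (logp n)) \<le> C * exp (- M * Re (logp n))" using z n Re_logp_ge by (intro C) auto
    also have "\<dots> = C * 1 * real n powr - M" using n by (simp add: logp_def powr_def)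
    also have "\<dots> \<le> C * 2 powr M * real n powr - M" using m C(1) by (intro mult_right_mono mult_left_mono) auto
    finally show "cmod (E z (logp n)) \<le> C * 2 powr M * real n powr - M" .
    have "cmod (E z (logm (t z) n)) \<le> C * exp (- M * Re (logm (t z) n))" using z n Re_logm_ge[OF t[OF z]] Im_logm[OF t[OF z]] by (intro C) auto
    also have "\<dots> \<le> C * exp (- M * ln (real n / 2))"
      using nt_bounds[OF t[OF z], of n] n M C(1) by (intro mult_left_mono) (auto simp: Re_logm[OF t[OF z]] intro!: mult_left_mono)
    also have "\<dots> = C * 2 powr M * real n powr - M" using n by (simp add: powr_def ln_div exp_add[symmetric] algebra_simps)
    finally show "cmod (E z (logm (t z) n)) \<le> C * 2 powr M * real n powr - M" .
  qed (use C in auto)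
qed

lemma symbol_seq:
  assumes E: "symbol Z c E" and c: "c \<ge> 0" and t: "\<And>z. z \<in> Z \<Longrightarrow> cmod (t z) < 1/2"
  shows "\<exists>C\<ge>0. \<forall>z\<in>Z. \<forall>n\<ge>9. cmod (E z (logp n)) \<le> C * real n powr c \<and> cmod (E z (logm (t z) n)) \<le> C * real n powr c"
proof -
  obtain C where C: "C \<ge> 0" "\<And>z u. z \<in> Z \<Longrightarrow> \<bar>Im u\<bar> \<le> 8 \<Longrightarrow> Re u \<ge> -8 \<Longrightarrow> cmod (E z u) \<le> C * exp (c * Re u)"
    using symbolE[OF E] by blast
  have m: "(2::real) powr c \<ge> 1" using c by (simp add: ge_one_powr_ge_zero)
  show ?thesis
  proof (intro exI[of _ "C * 2 powr c"] conjI ballI allI impI)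
    fix z n assume z: "z \<in> Z" and n: "n \<ge> (9::nat)"
    have "cmod (E z (logp n)) \<le> C * exp (c * Re (logp n))" using z n Re_logp_ge[OF n] by (intro C) auto
    also have "\<dots> = C * 1 * real n powr c" using n by (simp add: logp_def powr_def)
    also have "\<dots> \<le> C * 2 powr c * real n powr c" using m C(1) by (intro mult_right_mono mult_left_mono) auto
    finally show "cmod (E z (logp n)) \<le> C * 2 powr c * real n powr c" .
    have "cmod (E z (logm (t z) n)) \<le> C * exp (c * Re (logm (t z) n))" using z n Re_logm_ge[OF t[OF z] n] Im_logm[OF t[OF z]] by (intro C) auto
    also have "\<dots> \<le> C * exp (c * ln (2 * real n))"
      using nt_bounds[OF t[OF z], of n] n c C(1) by (intro mult_left_mono) (auto simp: Re_logm[OF t[OF z]] intro!: mult_left_mono)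
    also have "\<dots> = C * 2 powr c * real n powr c" using n by (simp add: powr_def ln_mult exp_add[symmetric] algebra_simps)
    finally show "cmod (E z (logm (t z) n)) \<le> C * 2 powr c * real n powr c" .
  qed (use C in auto)
qed

lemma sum_inverse_squares_le: "(\<Sum>m\<in>{1..<N}. 1 / (real m)\<^sup>2) \<le> 2"
proof -
  have *: "(\<Sum>m\<in>{1..<Suc (Suc n)}. 1 / (real m)\<^sup>2) \<le> 2 - 1 / real (Suc n)" for n
  proof (induction n)
    case (Suc n)
    have "1 / (real (Suc (Suc n)))\<^sup>2 \<le> 1 / real (Suc n) - 1 / real (Suc (Suc n))"
      by (simp add: power2_eq_square divide_simps)
    thus ?case using Suc.IH by (simp del: of_nat_Suc)
  qed simp
  have "(\<Sum>m\<in>{1..<N}. 1 / (real m)\<^sup>2) \<le> (\<Sum>m\<in>{1..<Suc (Suc N)}. 1 / (real m)\<^sup>2)" by (intro sum_mono2) auto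
  also have "\<dots> \<le> 2 - 1 / real (Suc N)" by (rule *)
  also have "\<dots> \<le> 2" by simp
  finally show ?thesis .
qed

text \<open>Taking \<open>n powr - M\<close> out of the tail of the increments leaves a sum of
  inverse squares, at most 2. This step is the source of the 2 in the loss of precision of each
  summation.\<close>

lemma seq_limit:
  fixes e :: "'p \<Rightarrow> nat \<Rightarrow> complex"
  assumes C: "C \<ge> 0" "\<And>z n. z \<in> Z \<Longrightarrow> n \<ge> 9 \<Longrightarrow> cmod (e z (Suc n) - e z n) \<le> C * real n powr - (M + 2)" and M: "M \<ge> 1"
  shows "\<exists>L. \<forall>z\<in>Z. \<forall>n\<ge>9. cmod (e z n - L z) \<le> 2 * C * real n powr - M"
proof -
  have *: "cmod (e z N - e z n) \<le> 2 * C * real n powr - M" if z: "z \<in> Z" and n: "n \<ge> 9" "n \<le> N" for z n N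
  proof -
    have "e z N - e z n = (\<Sum>m\<in>{n..<N}. e z (Suc m) - e z m)" using n by (simp add: sum_Suc_diff')
    also have "cmod \<dots> \<le> (\<Sum>m\<in>{n..<N}. C * real n powr - M * (1 / (real m)\<^sup>2))"
    proof (rule sum_norm_le)
      fix m assume m: "m \<in> {n..<N}"
      have "cmod (e z (Suc m) - e z m) \<le> C * real m powr - (M + 2)" using m n z by (intro C) auto
      also have "real m powr - (M + 2) = real m powr - M * (1 / (real m)\<^sup>2)" using m n by (simp add: powr_diff powr_minus powr_add field_simps powr_numeral)
      also have "C * (real m powr - M * (1 / (real m)\<^sup>2)) \<le> C * (real n powr - M * (1 / (real m)\<^sup>2))"
        using m n M C(1) by (intro mult_left_mono mult_right_mono powr_mono2') auto
      finally show "cmod (e z (Suc m) - e z m) \<le> C * real n powr - M * (1 / (real m)\<^sup>2)" by (simp add: mult.assoc)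
    qed
    also have "\<dots> = C * real n powr - M * (\<Sum>m\<in>{n..<N}. 1 / (real m)\<^sup>2)" by (simp add: sum_distrib_left)
    finally have 1: "cmod (e z N - e z n) \<le> C * real n powr - M * (\<Sum>m\<in>{n..<N}. 1 / (real m)\<^sup>2)" .
    have "(\<Sum>m\<in>{n..<N}. 1 / (real m)\<^sup>2) \<le> (\<Sum>m\<in>{1..<N}. 1 / (real m)\<^sup>2)" using n by (intro sum_mono2) auto
    also have "\<dots> \<le> 2" by (rule sum_inverse_squares_le)
    finally have "C * real n powr - M * (\<Sum>m\<in>{n..<N}. 1 / (real m)\<^sup>2) \<le> C * real n powr - M * 2" using C(1) by (intro mult_left_mono) auto
    with 1 have "cmod (e z N - e z n) \<le> C * real n powr - M * 2" by linarith
    thus ?thesis by (simp add: mult_ac)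
  qed
  have conv: "convergent (e z)" if z: "z \<in> Z" for z
  proof -
    have "Cauchy (e z)"
    proof (rule metric_CauchyI)
      fix \<epsilon> :: real assume \<epsilon>: "\<epsilon> > 0"
      obtain N0 :: nat where N0: "real N0 > 4 * C / \<epsilon>" using reals_Archimedean2 by blast
      define N where "N = max N0 9"
      have "4 * C < \<epsilon> * real N0" using N0 \<epsilon> by (simp add: field_simps)
      also have "\<dots> \<le> \<epsilon> * real N" using \<epsilon> by (intro mult_left_mono) (auto simp: N_def)
      finally have N: "N \<ge> 9" "4 * C < \<epsilon> * real N" by (auto simp: N_def)
      have "real N powr - M \<le> real N powr - 1" using M N by (intro powr_mono) auto
      hence "2 * C * real N powr - M \<le> 2 * C / real N" using C(1) N by (simp add: powr_minus divide_inverse mult_left_mono)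
      moreover have "2 * C / real N < \<epsilon> / 2" using N by (simp add: field_simps)
      ultimately have b: "cmod (e z m - e z N) < \<epsilon> / 2" if "m \<ge> N" for m
        using *[OF z N(1) that] by linarith
      show "\<exists>N. \<forall>m\<ge>N. \<forall>n\<ge>N. dist (e z m) (e z n) < \<epsilon>"
        using dist_triangle_half_l[OF b[folded dist_norm] b[folded dist_norm]] by blast
    qed
    thus ?thesis by (simp add: Cauchy_convergent_iff)
  qed
  show ?thesis
  proof (intro exI[of _ "\<lambda>z. lim (e z)"] ballI allI impI)
    fix z n assume z: "z \<in> Z" and n: "n \<ge> (9::nat)"
    have "(\<lambda>N. cmod (e z n - e z N)) \<longlonglongrightarrow> cmod (e z n - lim (e z))"
      using conv[OF z] by (intro tendsto_intros) (simp add: convergent_LIMSEQ_iff)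
    thus "cmod (e z n - lim (e z)) \<le> 2 * C * real n powr - M"
    proof (rule tendsto_upperbound)
      show "\<forall>\<^sub>F N in sequentially. cmod (e z n - e z N) \<le> 2 * C * real n powr - M"
        using eventually_ge_at_top[of n] by eventually_elim (subst norm_minus_commute, rule *[OF z n])
    qed auto
  qed
qed

section \<open>Regularised tail sums\<close>

text \<open>
  \<open>f n\<close> and \<open>g n\<close> are the values at the points \<open>n\<close> and \<open>t - n\<close> of the circle; \<open>H\<close> is their common expansion.
  From \<open>n = 9\<close> on, both logarithms have real part at least 2, where \<open>small\<close> applies.
\<close>

definition apair :: "'p set \<Rightarrow> ('p \<Rightarrow> complex) \<Rightarrow> real \<Rightarrow> ('p \<Rightarrow> nat \<Rightarrow> complex) \<Rightarrow> ('p \<Rightarrow> nat \<Rightarrow> complex)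
    \<Rightarrow> ('p \<Rightarrow> complex \<Rightarrow> complex) \<Rightarrow> bool" where
  "apair Z t M f g H \<longleftrightarrow> (\<exists>c. symbol Z c H) \<and>
     (\<exists>C. \<forall>z\<in>Z. \<forall>n\<ge>9. cmod (f z n - H z (logp n)) \<le> C * real n powr - M \<and>
                        cmod (g z n - H z (logm (t z) n)) \<le> C * real n powr - M)"

text \<open>A single function is a family over the one-point type, so the estimates uniform in a
  parameter apply to it as they stand.\<close>

abbreviation psymbol :: "real \<Rightarrow> (complex \<Rightarrow> complex) \<Rightarrow> bool" where
  "psymbol c h \<equiv> symbol (UNIV :: unit set) c (\<lambda>_. h)"
abbreviation psmall :: "real \<Rightarrow> (complex \<Rightarrow> complex) \<Rightarrow> bool" where
  "psmall c h \<equiv> small (UNIV :: unit set) c (\<lambda>_. h)"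
abbreviation papair :: "complex \<Rightarrow> real \<Rightarrow> (nat \<Rightarrow> complex) \<Rightarrow> (nat \<Rightarrow> complex) \<Rightarrow> (complex \<Rightarrow> complex) \<Rightarrow> bool" where
  "papair t M f g h \<equiv> apair (UNIV :: unit set) (\<lambda>_. t) M (\<lambda>_. f) (\<lambda>_. g) (\<lambda>_. h)"

text \<open>The bounds at each fixed \<open>n\<close> make the constant of summation bounded on
  \<open>Z\<close>; only then is the expansion still a symbol after the constant has been
  added.\<close>

definition hol_pair :: "complex set \<Rightarrow> (complex \<Rightarrow> complex) \<Rightarrow> real \<Rightarrow> (complex \<Rightarrow> nat \<Rightarrow> complex) \<Rightarrow> (complex \<Rightarrow> nat \<Rightarrow> complex)
    \<Rightarrow> (complex \<Rightarrow> complex \<Rightarrow> complex) \<Rightarrow> bool" where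
  "hol_pair Z t M f g H \<longleftrightarrow> apair Z t M f g H \<and> hol_param Z H \<and>
     (\<forall>n. (\<lambda>z. f z n) holomorphic_on Z \<and> (\<lambda>z. g z n) holomorphic_on Z \<and>
          (\<exists>K. \<forall>z\<in>Z. cmod (f z n) \<le> K \<and> cmod (g z n) \<le> K))"

text \<open>
  \<open>f'\<close> and \<open>g'\<close> are the sums over all later points of the circle, with summand \<open>x powr (- s)\<close> times
  \<open>f\<close> or \<open>g\<close>. The recursion determines \<open>f'\<close> only up to a constant, which \<open>h'\<close> fixes through \<open>apair\<close>.
\<close>

definition tail_sum :: "complex \<Rightarrow> real \<Rightarrow> complex \<Rightarrow> (nat \<Rightarrow> complex) \<Rightarrow> (nat \<Rightarrow> complex) \<Rightarrow> (complex \<Rightarrow> complex)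
    \<Rightarrow> (nat \<Rightarrow> complex) \<Rightarrow> (nat \<Rightarrow> complex) \<Rightarrow> (complex \<Rightarrow> complex) \<Rightarrow> bool" where
  "tail_sum t M s f g h f' g' h' \<longleftrightarrow> papair t M f' g' h' \<and>
     (\<forall>n. f' n = exp (- s * logp (Suc n)) * f (Suc n) + f' (Suc n)) \<and>
     (\<forall>n. g' n = (\<Sum>m\<in>{0<..<n}. exp (- s * logm t m) * g m)) \<and>
     psmall (M + 1) (\<lambda>u. h' (log_shift u) - h' u - exp (- s * u) * h u)"

lemma symbol_point: "symbol Z c H \<Longrightarrow> z \<in> Z \<Longrightarrow> psymbol c (H z)"
  unfolding symbol_def growth_def by (auto) meson

lemma small_point: "small Z c H \<Longrightarrow> z \<in> Z \<Longrightarrow> psmall c (H z)"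
  unfolding small_def growth_def by (auto) meson

lemma apair_point: "apair Z t M f g H \<Longrightarrow> z \<in> Z \<Longrightarrow> papair (t z) M (f z) (g z) (H z)"
proof -
  assume a: "apair Z t M f g H" and z: "z \<in> Z"
  obtain c where "symbol Z c H" using a unfolding apair_def by blast
  from symbol_point[OF this z] a z show ?thesis unfolding apair_def by blast
qed

lemma tail_sum_papair: "tail_sum t M s f g h f' g' h' \<Longrightarrow> papair t M f' g' h'"
  unfolding tail_sum_def by (elim conjE)

lemma tail_sum_f: "tail_sum t M s f g h f' g' h' \<Longrightarrow> f' n = exp (- s * logp (Suc n)) * f (Suc n) + f' (Suc n)"
  unfolding tail_sum_def by (elim conjE) (erule spec)

lemma tail_sum_g: "tail_sum t M s f g h f' g' h' \<Longrightarrow> g' n = (\<Sum>m\<in>{0<..<n}. exp (- s * logm t m) * g m)"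
  unfolding tail_sum_def by (elim conjE) (erule spec)

lemma tail_sum_small: "tail_sum t M s f g h f' g' h' \<Longrightarrow> psmall (M + 1) (\<lambda>u. h' (log_shift u) - h' u - exp (- s * u) * h u)"
  unfolding tail_sum_def by (elim conjE)

lemma tail_sumI:
  assumes "papair t M f' g' h'" "\<And>n. f' n = exp (- s * logp (Suc n)) * f (Suc n) + f' (Suc n)"
    "\<And>n. g' n = (\<Sum>m\<in>{0<..<n}. exp (- s * logm t m) * g m)"
    "psmall (M + 1) (\<lambda>u. h' (log_shift u) - h' u - exp (- s * u) * h u)"
  shows "tail_sum t M s f g h f' g' h'"
  unfolding tail_sum_def by (intro conjI allI assms)

lemma apairE:
  assumes "apair Z t M f g H"
  obtains C where "C \<ge> 0" "\<And>z n. z \<in> Z \<Longrightarrow> n \<ge> 9 \<Longrightarrow> cmod (f z n - H z (logp n)) \<le> C * real n powr - M"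
    "\<And>z n. z \<in> Z \<Longrightarrow> n \<ge> 9 \<Longrightarrow> cmod (g z n - H z (logm (t z) n)) \<le> C * real n powr - M"
proof -
  obtain C where C: "\<And>z n. z \<in> Z \<Longrightarrow> n \<ge> 9 \<Longrightarrow> cmod (f z n - H z (logp n)) \<le> C * real n powr - M \<and> cmod (g z n - H z (logm (t z) n)) \<le> C * real n powr - M"
    using assms unfolding apair_def by blast
  have *: "C * real n powr - M \<le> \<bar>C\<bar> * real n powr - M" for n by (intro mult_right_mono) auto
  show ?thesis by (rule that[of "\<bar>C\<bar>"]) (use C * in \<open>auto intro: order_trans\<close>)
qed

lemma apairI:
  assumes "symbol Z c H" "\<And>z n. z \<in> Z \<Longrightarrow> n \<ge> 9 \<Longrightarrow> cmod (f z n - H z (logp n)) \<le> C * real n powr - M"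
    "\<And>z n. z \<in> Z \<Longrightarrow> n \<ge> 9 \<Longrightarrow> cmod (g z n - H z (logm (t z) n)) \<le> C * real n powr - M"
  shows "apair Z t M f g H"
  unfolding apair_def using assms by blast

lemma apair_sym: "apair Z t M f g H \<Longrightarrow> \<exists>c. symbol Z c H" by (simp add: apair_def)

lemma apair_mono: assumes "apair Z t M f g H" "M' \<le> M" shows "apair Z t M' f g H"
proof -
  obtain C where C: "C \<ge> 0" "\<And>z n. z \<in> Z \<Longrightarrow> n \<ge> 9 \<Longrightarrow> cmod (f z n - H z (logp n)) \<le> C * real n powr - M"
    "\<And>z n. z \<in> Z \<Longrightarrow> n \<ge> 9 \<Longrightarrow> cmod (g z n - H z (logm (t z) n)) \<le> C * real n powr - M" using apairE[OF assms(1)] by blast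
  have *: "C * real n powr - M \<le> C * real n powr - M'" if "n \<ge> 9" for n
    using C(1) assms(2) that by (intro mult_left_mono powr_mono) auto
  obtain c where "symbol Z c H" using apair_sym[OF assms(1)] by blast
  thus ?thesis by (rule apairI[where C=C]) (auto intro: order_trans[OF C(2) *] order_trans[OF C(3) *])
qed

lemma tail_sum_mono: "tail_sum t M s f g h f' g' h' \<Longrightarrow> M' \<le> M \<Longrightarrow> tail_sum t M' s f g h f' g' h'"
proof -
  assume e: "tail_sum t M s f g h f' g' h'" and M: "M' \<le> M"
  show ?thesis
    by (rule tail_sumI[OF apair_mono[OF tail_sum_papair[OF e] M] tail_sum_f[OF e] tail_sum_g[OF e] small_mono[OF tail_sum_small[OF e]]]) (use M in auto)
qed

lemma apair_add:
  assumes "apair Z t M f g H" "apair Z t M f' g' H'"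
  shows "apair Z t M (\<lambda>z n. f z n + f' z n) (\<lambda>z n. g z n + g' z n) (\<lambda>z u. H z u + H' z u)"
proof -
  obtain C where C: "C \<ge> 0" "\<And>z n. z \<in> Z \<Longrightarrow> n \<ge> 9 \<Longrightarrow> cmod (f z n - H z (logp n)) \<le> C * real n powr - M"
    "\<And>z n. z \<in> Z \<Longrightarrow> n \<ge> 9 \<Longrightarrow> cmod (g z n - H z (logm (t z) n)) \<le> C * real n powr - M" using apairE[OF assms(1)] by blast
  obtain D where D: "D \<ge> 0" "\<And>z n. z \<in> Z \<Longrightarrow> n \<ge> 9 \<Longrightarrow> cmod (f' z n - H' z (logp n)) \<le> D * real n powr - M"
    "\<And>z n. z \<in> Z \<Longrightarrow> n \<ge> 9 \<Longrightarrow> cmod (g' z n - H' z (logm (t z) n)) \<le> D * real n powr - M" using apairE[OF assms(2)] by blast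
  obtain c d where cd: "symbol Z c H" "symbol Z d H'" using apair_sym assms by meson
  have cd': "symbol Z (max c d) (\<lambda>z u. H z u + H' z u)" by (rule symbol_add) (auto intro: symbol_mono[OF cd(1)] symbol_mono[OF cd(2)])
  show ?thesis
  proof (rule apairI[OF cd', where C="C + D"])
    fix z n assume zn: "z \<in> Z" "n \<ge> (9::nat)"
    show "cmod (f z n + f' z n - (H z (logp n) + H' z (logp n))) \<le> (C + D) * real n powr - M"
      using norm_triangle_le[OF add_mono[OF C(2)[OF zn] D(2)[OF zn]]] by (simp add: algebra_simps)
    show "cmod (g z n + g' z n - (H z (logm (t z) n) + H' z (logm (t z) n))) \<le> (C + D) * real n powr - M"
      using norm_triangle_le[OF add_mono[OF C(3)[OF zn] D(3)[OF zn]]] by (simp add: algebra_simps)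
  qed
qed

lemma apair_cmult:
  assumes "apair Z t M f g H"
  shows "apair Z t M (\<lambda>z n. k * f z n) (\<lambda>z n. k * g z n) (\<lambda>z u. k * H z u)"
proof -
  obtain C where C: "C \<ge> 0" "\<And>z n. z \<in> Z \<Longrightarrow> n \<ge> 9 \<Longrightarrow> cmod (f z n - H z (logp n)) \<le> C * real n powr - M"
    "\<And>z n. z \<in> Z \<Longrightarrow> n \<ge> 9 \<Longrightarrow> cmod (g z n - H z (logm (t z) n)) \<le> C * real n powr - M" using apairE[OF assms(1)] by blast
  obtain c where c: "symbol Z c H" using apair_sym assms by meson
  show ?thesis
    by (rule apairI[OF symbol_cmult[OF c], where C="cmod k * C"])
      (use C in \<open>auto intro!: mult_left_mono simp: right_diff_distrib[symmetric] norm_mult mult.assoc\<close>)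
qed

lemma tail_sum_add:
  assumes "tail_sum t M s f g h f' g' h'" "tail_sum t M s a b c a' b' c'"
  shows "tail_sum t M s (\<lambda>n. f n + a n) (\<lambda>n. g n + b n) (\<lambda>u. h u + c u) (\<lambda>n. f' n + a' n) (\<lambda>n. g' n + b' n) (\<lambda>u. h' u + c' u)"
proof -
  have 1: "f' n = exp (- s * logp (Suc n)) * f (Suc n) + f' (Suc n)" "a' n = exp (- s * logp (Suc n)) * a (Suc n) + a' (Suc n)" for n
    by (rule tail_sum_f[OF assms(1)], rule tail_sum_f[OF assms(2)])
  have 2: "g' n = (\<Sum>m\<in>{0<..<n}. exp (- s * logm t m) * g m)" "b' n = (\<Sum>m\<in>{0<..<n}. exp (- s * logm t m) * b m)" for n
    by (rule tail_sum_g[OF assms(1)], rule tail_sum_g[OF assms(2)])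
  show ?thesis
  proof (rule tail_sumI)
    show "papair t M (\<lambda>n. f' n + a' n) (\<lambda>n. g' n + b' n) (\<lambda>u. h' u + c' u)"
      by (rule apair_add[OF tail_sum_papair[OF assms(1)] tail_sum_papair[OF assms(2)]])
    show "psmall (M+1) (\<lambda>u. h' (log_shift u) + c' (log_shift u) - (h' u + c' u) - exp (- s * u) * (h u + c u))"
      by (rule small_cong[OF small_add[OF tail_sum_small[OF assms(1)] tail_sum_small[OF assms(2)]]]) (simp add: algebra_simps)
    fix n
    show "f' n + a' n = exp (- s * logp (Suc n)) * (f (Suc n) + a (Suc n)) + (f' (Suc n) + a' (Suc n))"
      unfolding 1[of n] by (simp add: algebra_simps)
    show "g' n + b' n = (\<Sum>m\<in>{0<..<n}. exp (- s * logm t m) * (g m + b m))"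
      by (simp add: 2 sum.distrib algebra_simps)
  qed
qed

lemma tail_sum_cmult:
  assumes "tail_sum t M s f g h f' g' h'"
  shows "tail_sum t M s (\<lambda>n. k * f n) (\<lambda>n. k * g n) (\<lambda>u. k * h u) (\<lambda>n. k * f' n) (\<lambda>n. k * g' n) (\<lambda>u. k * h' u)"
proof -
  have 1: "f' n = exp (- s * logp (Suc n)) * f (Suc n) + f' (Suc n)" for n
    by (rule tail_sum_f[OF assms(1)])
  have 2: "g' n = (\<Sum>m\<in>{0<..<n}. exp (- s * logm t m) * g m)" for n
    by (rule tail_sum_g[OF assms(1)])
  show ?thesis
  proof (rule tail_sumI)
    show "papair t M (\<lambda>n. k * f' n) (\<lambda>n. k * g' n) (\<lambda>u. k * h' u)"
      by (rule apair_cmult[OF tail_sum_papair[OF assms(1)]])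
    show "psmall (M+1) (\<lambda>u. k * h' (log_shift u) - k * h' u - exp (- s * u) * (k * h u))"
      by (rule small_cong[OF small_cmult[OF tail_sum_small[OF assms(1)], of k]]) (simp add: algebra_simps)
    fix n
    show "k * f' n = exp (- s * logp (Suc n)) * (k * f (Suc n)) + k * f' (Suc n)"
      unfolding 1[of n] by (simp add: algebra_simps)
    show "k * g' n = (\<Sum>m\<in>{0<..<n}. exp (- s * logm t m) * (k * g m))"
      by (simp add: 2 sum_distrib_left algebra_simps)
  qed
qed

lemma tail_sum_zero: "tail_sum t M s (\<lambda>_. 0) (\<lambda>_. 0) (\<lambda>_. 0) (\<lambda>_. 0) (\<lambda>_. 0) (\<lambda>_. 0)"
  by (auto simp: tail_sum_def apair_def small_zero symbol_zero intro!: exI[of _ 0])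

text \<open>A formal combination kept as a list: the same list is evaluated on sequences, on
  expansions and on final values, which keeps their coefficients identical.\<close>

definition lcomb :: "(complex \<times> 'k) list \<Rightarrow> ('k \<Rightarrow> 'x \<Rightarrow> complex) \<Rightarrow> 'x \<Rightarrow> complex" where
  "lcomb cs F x = (\<Sum>(c, k)\<leftarrow>cs. c * F k x)"

lemma lcomb_simps [simp]: "lcomb [] F x = 0" "lcomb ((c, k) # cs) F x = c * F k x + lcomb cs F x"
  "lcomb (cs @ ds) F x = lcomb cs F x + lcomb ds F x"
  by (simp_all add: lcomb_def)

lemma lcomb_Cons_fun: "lcomb ((c, k) # cs) F = (\<lambda>x. c * F k x + lcomb cs F x)"
  by (rule ext) simp

lemma tail_sum_lcomb:
  assumes "\<And>c k. (c, k) \<in> set cs \<Longrightarrow> tail_sum t M s (F k) (G k) (H k) (F' k) (G' k) (H' k)"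
  shows "tail_sum t M s (lcomb cs F) (lcomb cs G) (lcomb cs H) (lcomb cs F') (lcomb cs G') (lcomb cs H')"
  using assms
proof (induction cs)
  case Nil show ?case using tail_sum_zero by (simp add: lcomb_def[abs_def])
next
  case (Cons p cs)
  obtain c k where p: "p = (c, k)" by force
  show ?case unfolding p lcomb_Cons_fun
  proof (rule tail_sum_add[OF tail_sum_cmult])
    show "tail_sum t M s (F k) (G k) (H k) (F' k) (G' k) (H' k)" by (rule Cons.prems[of c]) (simp add: p)
    show "tail_sum t M s (lcomb cs F) (lcomb cs G) (lcomb cs H) (lcomb cs F') (lcomb cs G') (lcomb cs H')"
    proof (rule Cons.IH)
      fix c k assume "(c, k) \<in> set cs"
      thus "tail_sum t M s (F k) (G k) (H k) (F' k) (G' k) (H' k)" by (intro Cons.prems[of c]) auto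
    qed
  qed
qed

lemma powr_tendsto_0: "M > 0 \<Longrightarrow> (\<lambda>n. C * real (n + 9) powr - M) \<longlonglongrightarrow> 0"
proof -
  assume "M > 0"
  hence "(\<lambda>n. real n powr - M) \<longlonglongrightarrow> 0" by (intro tendsto_neg_powr filterlim_real_sequentially) simp
  hence "(\<lambda>n. real (n + 9) powr - M) \<longlonglongrightarrow> 0" by (rule LIMSEQ_ignore_initial_segment)
  from tendsto_mult_left[OF this, of C] show ?thesis by simp
qed

lemma Re_logm_at_top: "cmod t < 1/2 \<Longrightarrow> filterlim (\<lambda>n. Re (logm t (n + 9))) at_top sequentially"
proof -
  assume t: "cmod t < 1/2"
  have l: "filterlim (\<lambda>n. ln (real n / 2)) at_top sequentially"
    by (intro filterlim_compose[OF ln_at_top] filterlim_at_top_mult_tendsto_pos[OF tendsto_const _ filterlim_real_sequentially, of "1/2", simplified])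
  have "filterlim (\<lambda>n. Re (logm t n)) at_top sequentially"
  proof (rule filterlim_at_top_mono[OF l])
    show "\<forall>\<^sub>F n in sequentially. ln (real n / 2) \<le> Re (logm t n)"
      using eventually_ge_at_top[of 1]
    proof eventually_elim
      case (elim n)
      thus ?case using nt_bounds[OF t elim] Re_logm[OF t elim] by simp
    qed
  qed
  thus ?thesis using filterlim_compose filterlim_add_const_nat_at_top by fast
qed

text \<open>The two negative sides are the same finite sums. Hence the difference of the expansions
  tends to 0 along \<open>t - n\<close>, and being nearly invariant under the shift it is small
  everywhere. On the positive side the recursion leaves a constant difference, which then must tend
  to 0 as well. Index 0 is no point of the circle, so the summands are compared from 1 on.\<close>

lemma tail_sum_unique:
  assumes t: "cmod t < 1/2" and M: "M \<ge> 1"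
    and f: "\<And>n. n \<ge> 1 \<Longrightarrow> f n = f2 n" and g: "\<And>n. n \<ge> 1 \<Longrightarrow> g n = g2 n" and h: "psmall (M + cmod s + 2) (\<lambda>u. h u - h2 u)"
    and 1: "tail_sum t M s f g h F G H" and 2: "tail_sum t M s f2 g2 h2 F2 G2 H2"
  shows "F = F2" "G = G2" "psmall M (\<lambda>u. H u - H2 u)"
proof -
  have gg: "(\<Sum>m\<in>{0<..<n}. exp (- s * logm t m) * g m) = (\<Sum>m\<in>{0<..<n}. exp (- s * logm t m) * g2 m)" for n
    by (intro sum.cong refl) (use g in auto)
  show G: "G = G2" by (rule ext) (simp only: tail_sum_g[OF 1] tail_sum_g[OF 2] gg)
  define D where "D u = H u - H2 u" for u
  have p1: "papair t M F G H" and p2: "papair t M F2 G2 H2" using tail_sum_papair[OF 1] tail_sum_papair[OF 2] .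
  obtain c d where "psymbol c H" "psymbol d H2" using apair_sym p1 p2 by meson
  hence sD: "psymbol (max c d) D" unfolding D_def by (intro symbol_diff) (auto intro: symbol_mono)
  obtain C where C: "C \<ge> 0" "\<And>n. n \<ge> 9 \<Longrightarrow> cmod (F n - H (logp n)) \<le> C * real n powr - M"
     "\<And>n. n \<ge> 9 \<Longrightarrow> cmod (G n - H (logm t n)) \<le> C * real n powr - M" using apairE[OF p1] by auto
  obtain E where E: "E \<ge> 0" "\<And>n. n \<ge> 9 \<Longrightarrow> cmod (F2 n - H2 (logp n)) \<le> E * real n powr - M"
     "\<And>n. n \<ge> 9 \<Longrightarrow> cmod (G2 n - H2 (logm t n)) \<le> E * real n powr - M" using apairE[OF p2] by auto
  have "psmall (M + cmod s + 2 - cmod s) (\<lambda>u. exp (- s * u) * (h u - h2 u))"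
    by (rule symbol_mult_small[OF symbol_exp' h]) auto
  hence "psmall (M + 1) (\<lambda>u. exp (- s * u) * (h u - h2 u))" by (rule small_mono) auto
  moreover have "psmall (M + 1) (\<lambda>u. (H (log_shift u) - H u - exp (- s * u) * h u) - (H2 (log_shift u) - H2 u - exp (- s * u) * h2 u))"
    by (rule small_diff[OF tail_sum_small[OF 1] tail_sum_small[OF 2]])
  ultimately have "psmall (M + 1) (\<lambda>u. exp (- s * u) * (h u - h2 u) + ((H (log_shift u) - H u - exp (- s * u) * h u) - (H2 (log_shift u) - H2 u - exp (- s * u) * h2 u)))"
    by (rule small_add)
  hence d: "psmall (M + 1) (\<lambda>u. D (log_shift u) - D u)" by (rule small_cong) (simp add: D_def algebra_simps)
  have "psmall (M + 1 - 1) D"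
  proof (rule difference_small_imp_small[OF sD d, where w="\<lambda>_ n. logm t (n + 9)" and A=8])
    show "(\<lambda>n. D (logm t (n + 9))) \<longlonglongrightarrow> 0"
    proof (rule Lim_null_comparison[OF always_eventually powr_tendsto_0[of M "C + E"]], rule allI)
      fix n
      have "D (logm t (n+9)) = (G2 (n+9) - H2 (logm t (n+9))) - (G (n+9) - H (logm t (n+9)))" by (simp add: D_def G)
      also have "cmod \<dots> \<le> E * real (n+9) powr - M + C * real (n+9) powr - M"
        by (intro order_trans[OF norm_triangle_ineq4] add_mono C E) auto
      finally show "cmod (D (logm t (n+9))) \<le> (C + E) * real (n+9) powr - M" by (simp add: algebra_simps)
    qed (use M in auto)
  qed (use M Im_logm[OF t] Re_logm_at_top[OF t] in auto)
  hence sm: "psmall M D" by simp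
  thus "psmall M (\<lambda>u. H u - H2 u)" by (simp add: D_def[abs_def])
  obtain K where K: "K \<ge> 0" "\<And>n. n \<ge> 9 \<Longrightarrow> cmod (D (logp n)) \<le> K * real n powr - M"
    using small_seq[OF sm, of "\<lambda>_. t"] t M by auto
  have rF: "F n = exp (- s * logp (Suc n)) * f (Suc n) + F (Suc n)" "F2 n = exp (- s * logp (Suc n)) * f2 (Suc n) + F2 (Suc n)" for n
    by (rule tail_sum_f[OF 1], rule tail_sum_f[OF 2])
  have const: "F n - F2 n = F 0 - F2 0" for n
  proof (induction n)
    case (Suc n)
    have "F n - F2 n = F (Suc n) - F2 (Suc n)" unfolding rF[of n] using f[of "Suc n"] by simp
    thus ?case using Suc by simp
  qed simp
  have "(\<lambda>n. F (n + 9) - F2 (n + 9)) \<longlonglongrightarrow> 0"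
  proof (rule Lim_null_comparison[OF always_eventually powr_tendsto_0[of M "C + K + E"]], rule allI)
    fix n
    have "F (n+9) - F2 (n+9) = (F (n+9) - H (logp (n+9))) + D (logp (n+9)) - (F2 (n+9) - H2 (logp (n+9)))" by (simp add: D_def)
    also have "cmod \<dots> \<le> C * real (n+9) powr - M + K * real (n+9) powr - M + E * real (n+9) powr - M"
      by (intro order_trans[OF norm_triangle_ineq4] add_mono order_trans[OF norm_triangle_ineq] C E K) auto
    finally show "cmod (F (n+9) - F2 (n+9)) \<le> (C + K + E) * real (n+9) powr - M" by (simp add: algebra_simps)
  qed (use M in auto)
  hence "(\<lambda>n::nat. F 0 - F2 0) \<longlonglongrightarrow> 0" by (subst (asm) const)
  hence "F 0 - F2 0 = 0" by (simp add: LIMSEQ_const_iff)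
  thus "F = F2" using const by (auto simp: fun_eq_iff)
qed

lemma seq_limit_holomorphic:
  fixes e :: "complex \<Rightarrow> nat \<Rightarrow> complex"
  assumes Z: "open Z" and C: "C \<ge> 0" "\<And>z n. z \<in> Z \<Longrightarrow> n \<ge> 9 \<Longrightarrow> cmod (e z (Suc n) - e z n) \<le> C * real n powr - (M + 2)" and M: "M \<ge> 1"
   and e: "\<And>n. n \<ge> 9 \<Longrightarrow> (\<lambda>z. e z n) holomorphic_on Z" and b: "\<And>z. z \<in> Z \<Longrightarrow> cmod (e z 9) \<le> K"
  shows "\<exists>L K'. L holomorphic_on Z \<and> (\<forall>z\<in>Z. cmod (L z) \<le> K') \<and> (\<forall>z\<in>Z. \<forall>n\<ge>9. cmod (e z n - L z) \<le> 2 * C * real n powr - M)"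
proof -
  obtain L where L: "\<And>z n. z \<in> Z \<Longrightarrow> n \<ge> 9 \<Longrightarrow> cmod (e z n - L z) \<le> 2 * C * real n powr - M"
    using seq_limit[where e=e and Z=Z and C=C and M=M] C M by blast
  have "L holomorphic_on Z"
  proof (rule holomorphic_rate_limit[OF Z holomorphic_on_const[of 0], of "\<lambda>n z. e z (n + 9)"])
    show "(\<lambda>z. e z (n + 9)) holomorphic_on Z" for n using e by auto
    fix A :: real
    show "\<exists>K. \<forall>n. \<forall>z\<in>Z. cmod 0 \<le> A \<longrightarrow> cmod (e z (n + 9) - L z) \<le> K / real (Suc n)"
    proof (intro exI[of _ "2 * C"] allI ballI impI)
      fix n z assume z: "z \<in> Z"
      have "cmod (e z (n + 9) - L z) \<le> 2 * C * real (n + 9) powr - M" using L[OF z, of "n + 9"] by simp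
      also have "2 * C * real (n + 9) powr - M \<le> 2 * C * (1 / real (Suc n))"
      proof (rule mult_left_mono)
      have "real (n + 9) powr - M \<le> real (n + 9) powr - 1" using M by (intro powr_mono) auto
      also have "real (n + 9) powr - 1 \<le> 1 / real (Suc n)" by (simp add: powr_minus field_simps)
      finally show "real (n + 9) powr - M \<le> 1 / real (Suc n)" .
      qed (use C in auto)
      finally show "cmod (e z (n + 9) - L z) \<le> 2 * C / real (Suc n)" by simp
    qed
  qed
  moreover have "cmod (L z) \<le> K + 2 * C * 9 powr - M" if "z \<in> Z" for z
    using L[OF that, of 9] b[OF that] norm_triangle_ineq4[of "e z 9" "e z 9 - L z"] by simp
  ultimately show ?thesis using L by blast
qed

text \<open>The solution \<open>H1\<close> of the difference equation carries an arbitrary constant.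
  On the negative side the finite sums \<open>g'\<close> differ from \<open>H1\<close> by a
  convergent quantity with limit \<open>L\<close>, so \<open>H1 + L\<close> is the right expansion.
  On the positive side \<open>f'\<close> is then normalised to agree with \<open>H1 + L\<close> at
  infinity. All limits have a uniform rate, hence are holomorphic.\<close>

lemma tail_sum_exists_hol_pair:
  assumes Z: "open Z" and th: "t holomorphic_on Z" and t: "\<And>z. z \<in> Z \<Longrightarrow> cmod (t z) < 1/2" and M: "M \<ge> 1"
    and sh: "s holomorphic_on Z" and s: "\<And>z. z \<in> Z \<Longrightarrow> cmod (s z) \<le> B" and B: "B \<ge> 0"
    and F: "hol_pair Z t (M + B + 2) f g H"
  shows "\<exists>f' g' H'. hol_pair Z t M f' g' H' \<and> (\<forall>z\<in>Z. tail_sum (t z) M (s z) (f z) (g z) (H z) (f' z) (g' z) (H' z))"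
proof -
  have ap: "apair Z t (M + B + 2) f g H" and hH: "hol_param Z H" and fh: "\<And>n. (\<lambda>z. f z n) holomorphic_on Z"
    and gh: "\<And>n. (\<lambda>z. g z n) holomorphic_on Z" and bd: "\<And>n. \<exists>K. \<forall>z\<in>Z. cmod (f z n) \<le> K \<and> cmod (g z n) \<le> K"
    using F by (auto simp: hol_pair_def)
  obtain C where C: "C \<ge> 0" "\<And>z n. z \<in> Z \<Longrightarrow> n \<ge> 9 \<Longrightarrow> cmod (f z n - H z (logp n)) \<le> C * real n powr - (M + B + 2)"
    "\<And>z n. z \<in> Z \<Longrightarrow> n \<ge> 9 \<Longrightarrow> cmod (g z n - H z (logm (t z) n)) \<le> C * real n powr - (M + B + 2)" using apairE[OF ap] by blast
  obtain c where c: "symbol Z c H" using apair_sym[OF ap] by blast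
  let ?e = "\<lambda>z u. exp (- s z * u)"
  have se: "symbol Z B ?e" by (rule symbol_exp') (rule s)
  obtain H1 c1 where H1: "symbol Z c1 H1" "hol_param Z H1" and sm: "small Z (M + 2) (\<lambda>z u. H1 z (log_shift u) - H1 z u - ?e z u * H z u)"
    using euler_maclaurin[OF Z symbol_mult[OF se c] hol_param_mult[OF hol_param_exp[OF sh] hH], of "M + 2"] by blast
  obtain C1 where C1: "C1 \<ge> 0" "\<And>z n. z \<in> Z \<Longrightarrow> n \<ge> 9 \<Longrightarrow> cmod (?e z (logp n)) \<le> C1 * real n powr B"
    "\<And>z n. z \<in> Z \<Longrightarrow> n \<ge> 9 \<Longrightarrow> cmod (?e z (logm (t z) n)) \<le> C1 * real n powr B"
    using symbol_seq[OF se B, of t] t by blast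
  have M0: "M + 2 \<ge> 0" using M by simp
  obtain C2 where C2: "C2 \<ge> 0" "\<And>z n. z \<in> Z \<Longrightarrow> n \<ge> 9 \<Longrightarrow> cmod (H1 z (log_shift (logp n)) - H1 z (logp n) - ?e z (logp n) * H z (logp n)) \<le> C2 * real n powr - (M + 2)"
    "\<And>z n. z \<in> Z \<Longrightarrow> n \<ge> 9 \<Longrightarrow> cmod (H1 z (log_shift (logm (t z) n)) - H1 z (logm (t z) n) - ?e z (logm (t z) n) * H z (logm (t z) n)) \<le> C2 * real n powr - (M + 2)"
    using small_seq[where t=t, OF sm M0 t] by blast
  define C3 where "C3 = C1 * C + C2"
  have C3: "C3 \<ge> 0" using C C1 C2 by (simp add: C3_def)
  \<comment> \<open>The power is \<open>O(n powr B)\<close> and the error of the inner pair is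
    \<open>O(n powr - (M + B + 2))\<close>, so the product has the order \<open>M + 2\<close> that
    \<open>seq_limit_holomorphic\<close> asks for.\<close>
  have comb: "cmod (a * b - e) \<le> C3 * real n powr - (M + 2)"
    if "n \<ge> 9" "cmod a \<le> C1 * real n powr B" "cmod b \<le> C * real n powr - (M + B + 2)" "cmod e \<le> C2 * real n powr - (M + 2)" for a b e n
  proof -
    have "cmod (a * b) \<le> (C1 * real n powr B) * (C * real n powr - (M + B + 2))" unfolding norm_mult using that C1 C by (intro mult_mono) auto
    also have "\<dots> = C1 * C * real n powr (B + - (M + B + 2))" by (subst powr_add) (simp add: mult_ac)
    also have "B + - (M + B + 2) = - (M + 2)" by simp
    finally show ?thesis using that(4) norm_triangle_ineq4[of "a * b" e] by (simp add: C3_def algebra_simps)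
  qed
  have umh: "(\<lambda>z. logm (t z) n) holomorphic_on Z" if "n \<ge> 1" for n by (rule logm_holomorphic[OF th t that])
  have ebd: "\<exists>K. \<forall>z\<in>Z. cmod (?e z (v z)) \<le> K" if "\<And>z. z \<in> Z \<Longrightarrow> cmod (v z) \<le> A" for v A
    using symbol_disc_bound[OF se, of A] that by blast
  define g' where "g' z n = (\<Sum>m\<in>{0<..<n}. ?e z (logm (t z) m) * g z m)" for z n
  have g'h: "(\<lambda>z. g' z n) holomorphic_on Z" for n unfolding g'_def
    by (intro holomorphic_intros sh gh umh) auto
  have g'b: "\<exists>K. \<forall>z\<in>Z. cmod (g' z n) \<le> K" for n
  proof (induction n)
    case 0 thus ?case by (auto simp: g'_def)
  next
    case (Suc n)
    show ?case
    proof (cases "n = 0")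
      case True
      have "{0<..<Suc 0} = {}" by auto
      thus ?thesis using True by (auto simp: g'_def intro: exI[of _ 0])
    next
      case False
      obtain K1 where K1: "\<And>z. z \<in> Z \<Longrightarrow> cmod (g' z n) \<le> K1" using Suc by blast
      obtain K2 where K2: "\<And>z. z \<in> Z \<Longrightarrow> cmod (g z n) \<le> K2" using bd by blast
      obtain K3 where K3: "\<And>z. z \<in> Z \<Longrightarrow> cmod (?e z (logm (t z) n)) \<le> K3" using ebd[of "\<lambda>z. logm (t z) n", OF logm_bounded[OF t]] False by auto
      have "{0<..<Suc n} = insert n {0<..<n}" using False by auto
      hence r: "g' z (Suc n) = ?e z (logm (t z) n) * g z n + g' z n" for z by (simp add: g'_def)
      have "cmod (g' z (Suc n)) \<le> K3 * K2 + K1" if "z \<in> Z" for z unfolding r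
        by (intro order_trans[OF norm_triangle_ineq] add_mono K1 that)
          (simp only: norm_mult, intro mult_mono' K2[OF that] K3[OF that] norm_ge_zero)
      thus ?thesis by blast
    qed
  qed
  obtain K9 where K9: "\<And>z. z \<in> Z \<Longrightarrow> cmod (g' z 9) \<le> K9" using g'b by blast
  obtain K8 where K8: "\<And>z u. z \<in> Z \<Longrightarrow> cmod u \<le> 30 \<Longrightarrow> cmod (H1 z u) \<le> K8" using symbol_disc_bound[OF H1(1), of 30] by blast
  have "\<exists>L K'. L holomorphic_on Z \<and> (\<forall>z\<in>Z. cmod (L z) \<le> K') \<and> (\<forall>z\<in>Z. \<forall>n\<ge>9. cmod ((g' z n - H1 z (logm (t z) n)) - L z) \<le> 2 * C3 * real n powr - M)"
  proof (rule seq_limit_holomorphic[OF Z C3 _ M])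
    fix z n assume z: "z \<in> Z" and n: "n \<ge> (9::nat)"
    have "{0<..<Suc n} = insert n {0<..<n}" using n by auto
    hence "g' z (Suc n) = ?e z (logm (t z) n) * g z n + g' z n" by (simp add: g'_def)
    hence "g' z (Suc n) - H1 z (logm (t z) (Suc n)) - (g' z n - H1 z (logm (t z) n)) =
       ?e z (logm (t z) n) * (g z n - H z (logm (t z) n)) - (H1 z (log_shift (logm (t z) n)) - H1 z (logm (t z) n) - ?e z (logm (t z) n) * H z (logm (t z) n))"
      using log_shift_logm[OF t[OF z] n] by (simp add: algebra_simps)
    thus "cmod (g' z (Suc n) - H1 z (logm (t z) (Suc n)) - (g' z n - H1 z (logm (t z) n))) \<le> C3 * real n powr - (M + 2)"
      using comb[OF n C1(3)[OF z n] C(3)[OF z n] C2(3)[OF z n]] by (simp only:)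
  next
    fix z assume z: "z \<in> Z"
    have "cmod (H1 z (logm (t z) 9)) \<le> K8" using logm_bounded[OF t[OF z], of 9] by (intro K8 z) auto
    thus "cmod (g' z 9 - H1 z (logm (t z) 9)) \<le> K9 + K8" using K9[OF z] norm_triangle_ineq4[of "g' z 9" "H1 z (logm (t z) 9)"] by linarith
  next
    fix n :: nat assume "n \<ge> 9"
    thus "(\<lambda>z. g' z n - H1 z (logm (t z) n)) holomorphic_on Z" by (intro holomorphic_intros g'h hol_paramD[OF H1(2)] umh) auto
  qed
  then obtain L KL where L: "L holomorphic_on Z" "\<And>z. z \<in> Z \<Longrightarrow> cmod (L z) \<le> KL"
     "\<And>z n. z \<in> Z \<Longrightarrow> n \<ge> 9 \<Longrightarrow> cmod ((g' z n - H1 z (logm (t z) n)) - L z) \<le> 2 * C3 * real n powr - M" by blast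
  \<comment> \<open>The tail sums on the positive side may diverge; instead the partial sums are
    compensated by \<open>H1\<close>, and \<open>L2\<close> is the limit of the compensated
    sums.\<close>
  define S where "S z n = (\<Sum>m\<in>{0<..n}. ?e z (logp m) * f z m)" for z n
  have S_Suc: "S z (Suc n) = ?e z (logp (Suc n)) * f z (Suc n) + S z n" for z n
  proof -
    have "{0<..Suc n} = insert (Suc n) {0<..n}" by auto
    thus ?thesis by (simp add: S_def)
  qed
  have Sh: "(\<lambda>z. S z n) holomorphic_on Z" for n unfolding S_def by (intro holomorphic_intros sh fh)
  have Sb: "\<exists>K. \<forall>z\<in>Z. cmod (S z n) \<le> K" for n
  proof (induction n)
    case 0 thus ?case by (auto simp: S_def)
  next
    case (Suc n)
    obtain K1 where K1: "\<And>z. z \<in> Z \<Longrightarrow> cmod (S z n) \<le> K1" using Suc by blast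
    obtain K2 where K2: "\<And>z. z \<in> Z \<Longrightarrow> cmod (f z (Suc n)) \<le> K2" using bd by blast
    obtain K3 where K3: "\<And>z. z \<in> Z \<Longrightarrow> cmod (?e z (logp (Suc n))) \<le> K3" using ebd[of "\<lambda>_. logp (Suc n)", OF order_refl] by blast
    have "cmod (S z (Suc n)) \<le> K3 * K2 + K1" if "z \<in> Z" for z unfolding S_Suc
      by (intro order_trans[OF norm_triangle_ineq] add_mono K1 that)
        (simp only: norm_mult, intro mult_mono' K2[OF that] K3[OF that] norm_ge_zero)
    thus ?case by blast
  qed
  obtain J9 where J9: "\<And>z. z \<in> Z \<Longrightarrow> cmod (S z 9) \<le> J9" using Sb by blast
  obtain J8 where J8: "\<And>z. z \<in> Z \<Longrightarrow> cmod (H1 z (logp 9)) \<le> J8" using symbol_disc_bound[OF H1(1), of "cmod (logp 9)"] by blast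
  have "\<exists>L K'. L holomorphic_on Z \<and> (\<forall>z\<in>Z. cmod (L z) \<le> K') \<and> (\<forall>z\<in>Z. \<forall>n\<ge>9. cmod ((H1 z (logp n) + S z n) - L z) \<le> 2 * C3 * real n powr - M)"
  proof (rule seq_limit_holomorphic[OF Z C3 _ M])
    fix z n assume z: "z \<in> Z" and n: "n \<ge> (9::nat)"
    have n': "Suc n \<ge> 9" using n by simp
    have "H1 z (logp (Suc n)) + S z (Suc n) - (H1 z (logp n) + S z n) =
       ?e z (logp (Suc n)) * (f z (Suc n) - H z (logp (Suc n))) - (H1 z (log_shift (logp (Suc n))) - H1 z (logp (Suc n)) - ?e z (logp (Suc n)) * H z (logp (Suc n)))"
      using log_shift_logp[of "Suc n"] n by (simp add: S_Suc algebra_simps)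
    hence "cmod (H1 z (logp (Suc n)) + S z (Suc n) - (H1 z (logp n) + S z n)) \<le> C3 * real (Suc n) powr - (M + 2)"
      using comb[OF n' C1(2)[OF z n'] C(2)[OF z n'] C2(2)[OF z n']] by (simp only:)
    also have "\<dots> \<le> C3 * real n powr - (M + 2)" using C3 n M by (intro mult_left_mono powr_mono2') auto
    finally show "cmod (H1 z (logp (Suc n)) + S z (Suc n) - (H1 z (logp n) + S z n)) \<le> C3 * real n powr - (M + 2)" .
  next
    fix z assume z: "z \<in> Z"
    show "cmod (H1 z (logp 9) + S z 9) \<le> J8 + J9" using J9[OF z] J8[OF z] norm_triangle_ineq[of "H1 z (logp 9)" "S z 9"] by linarith
  next
    fix n :: nat assume "n \<ge> 9"
    show "(\<lambda>z. H1 z (logp n) + S z n) holomorphic_on Z" by (intro holomorphic_intros Sh hol_paramD[OF H1(2)])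
  qed
  then obtain L2 KL2 where L2: "L2 holomorphic_on Z" "\<And>z. z \<in> Z \<Longrightarrow> cmod (L2 z) \<le> KL2"
     "\<And>z n. z \<in> Z \<Longrightarrow> n \<ge> 9 \<Longrightarrow> cmod ((H1 z (logp n) + S z n) - L2 z) \<le> 2 * C3 * real n powr - M" by blast
  \<comment> \<open>\<open>L2 - S z n\<close> is the regularised sum over the positive points after
    \<open>n\<close>, relative to \<open>H1\<close>; \<open>L\<close> adds the passage through
    infinity to the negative side.\<close>
  define f' where "f' z n = L z + L2 z - S z n" for z n
  define H' where "H' z u = H1 z u + L z" for z u
  have sH': "symbol Z (max c1 0) H'" unfolding H'_def
    by (intro symbol_add) (auto intro: symbol_mono[OF H1(1)] symbol_mono[OF symbol_coeff[OF L(2)]])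
  have apH': "apair Z t M f' g' H'"
  proof (rule apairI[OF sH', where C="2 * C3"])
    fix z n assume z: "z \<in> Z" and n: "n \<ge> (9::nat)"
    have "f' z n - H' z (logp n) = - ((H1 z (logp n) + S z n) - L2 z)" by (simp add: f'_def H'_def)
    thus "cmod (f' z n - H' z (logp n)) \<le> 2 * C3 * real n powr - M" using L2(3)[OF z n] by (metis norm_minus_cancel)
    have "g' z n - H' z (logm (t z) n) = (g' z n - H1 z (logm (t z) n)) - L z" by (simp add: H'_def)
    thus "cmod (g' z n - H' z (logm (t z) n)) \<le> 2 * C3 * real n powr - M" using L(3)[OF z n] by (simp only:)
  qed
  have "hol_pair Z t M f' g' H'"
    unfolding hol_pair_def
  proof (intro conjI allI apH')
    show "hol_param Z H'" unfolding H'_def by (intro hol_param_add H1 hol_param_coeff L)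
    fix n
    show "(\<lambda>z. f' z n) holomorphic_on Z" unfolding f'_def by (intro holomorphic_intros L L2 Sh)
    show "(\<lambda>z. g' z n) holomorphic_on Z" by (rule g'h)
    obtain K1 where K1: "\<And>z. z \<in> Z \<Longrightarrow> cmod (S z n) \<le> K1" using Sb by blast
    obtain K2 where K2: "\<And>z. z \<in> Z \<Longrightarrow> cmod (g' z n) \<le> K2" using g'b by blast
    have "cmod (f' z n) \<le> KL + KL2 + K1" if "z \<in> Z" for z unfolding f'_def
      by (intro order_trans[OF norm_triangle_ineq4] order_trans[OF norm_triangle_ineq] add_mono L(2) L2(2) K1 that)
    thus "\<exists>K. \<forall>z\<in>Z. cmod (f' z n) \<le> K \<and> cmod (g' z n) \<le> K"
      using K2 by (intro exI[of _ "max (KL + KL2 + K1) K2"]) (auto simp: le_max_iff_disj)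
  qed
  moreover have "tail_sum (t z) M (s z) (f z) (g z) (H z) (f' z) (g' z) (H' z)" if z: "z \<in> Z" for z
  proof (rule tail_sumI)
    show "papair (t z) M (f' z) (g' z) (H' z)" by (rule apair_point[OF apH' z])
    show "f' z n = exp (- s z * logp (Suc n)) * f z (Suc n) + f' z (Suc n)" for n by (simp add: f'_def S_Suc)
    show "g' z n = (\<Sum>m\<in>{0<..<n}. exp (- s z * logm (t z) m) * g z m)" for n by (simp add: g'_def)
    have "psmall (M + 1) (\<lambda>u. H1 z (log_shift u) - H1 z u - ?e z u * H z u)" using small_mono[OF small_point[OF sm z], of "M+1"] by simp
    thus "psmall (M + 1) (\<lambda>u. H' z (log_shift u) - H' z u - exp (- s z * u) * H z u)" by (simp add: H'_def)
  qed
  ultimately show ?thesis by blast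
qed

section \<open>Iterated tail sums\<close>

text \<open>Each step costs \<open>cmod s + 2\<close> in the precision of the expansion, hence the increased \<open>M\<close>.\<close>
fun chain :: "complex \<Rightarrow> real \<Rightarrow> complex list \<Rightarrow> (nat \<Rightarrow> complex) \<Rightarrow> (nat \<Rightarrow> complex) \<Rightarrow> (complex \<Rightarrow> complex) \<Rightarrow> bool" where
  "chain t M [] f g h \<longleftrightarrow> f = (\<lambda>_. 1) \<and> g = (\<lambda>_. 1) \<and> h = (\<lambda>_. 1)"
| "chain t M (s # ss) f' g' h' \<longleftrightarrow> (\<exists>f g h. chain t (M + cmod s + 2) ss f g h \<and> tail_sum t M s f g h f' g' h')"

lemma chain_apair: "chain t M ss f g h \<Longrightarrow> papair t M f g h"
proof (cases ss)
  case Nil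
  assume "chain t M ss f g h"
  thus ?thesis using Nil by (auto simp: apair_def intro!: exI[of _ 0] symbol_coeff[where K=1])
qed (auto intro: tail_sum_papair)

lemma chain_mono: "chain t M ss f g h \<Longrightarrow> M' \<le> M \<Longrightarrow> chain t M' ss f g h"
proof (induction ss arbitrary: M M' f g h)
  case (Cons s ss)
  then obtain f0 g0 h0 where 1: "chain t (M + cmod s + 2) ss f0 g0 h0" "tail_sum t M s f0 g0 h0 f g h" by auto
  have "chain t (M' + cmod s + 2) ss f0 g0 h0" by (rule Cons.IH[OF 1(1)]) (use Cons.prems in auto)
  thus ?case using tail_sum_mono[OF 1(2) Cons.prems(2)] by auto
qed simp

lemma chain_unique:
  assumes t: "cmod t < 1/2"
  shows "M \<ge> 1 \<Longrightarrow> chain t M ss f g h \<Longrightarrow> chain t M ss f' g' h' \<Longrightarrow> f = f' \<and> g = g' \<and> psmall M (\<lambda>u. h u - h' u)"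
proof (induction ss arbitrary: M f g h f' g' h')
  case Nil thus ?case by (simp add: small_zero)
next
  case (Cons s ss)
  obtain a b c where 1: "chain t (M + cmod s + 2) ss a b c" "tail_sum t M s a b c f g h" using Cons.prems by auto
  obtain a' b' c' where 2: "chain t (M + cmod s + 2) ss a' b' c'" "tail_sum t M s a' b' c' f' g' h'" using Cons.prems by auto
  have 3: "a = a' \<and> b = b' \<and> psmall (M + cmod s + 2) (\<lambda>u. c u - c' u)"
    by (rule Cons.IH[OF _ 1(1) 2(1)]) (use Cons.prems in auto)
  from tail_sum_unique[OF t Cons.prems(1) _ _ _ 1(2) 2(2)] 3 show ?case by auto
qed

lemma chain_exists_hol_pair:
  assumes Z: "open Z" and th: "t holomorphic_on Z" and t: "\<And>z. z \<in> Z \<Longrightarrow> cmod (t z) < 1/2" and B: "B \<ge> 0"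
  shows "M \<ge> 1 \<Longrightarrow> (\<And>s. s \<in> set ss \<Longrightarrow> s holomorphic_on Z \<and> (\<forall>z\<in>Z. cmod (s z) \<le> B)) \<Longrightarrow>
    \<exists>f g H. hol_pair Z t M f g H \<and> (\<forall>z\<in>Z. chain (t z) M (map (\<lambda>s. s z) ss) (f z) (g z) (H z))"
proof (induction ss arbitrary: M)
  case Nil
  have "hol_pair Z t M (\<lambda>_ _. 1) (\<lambda>_ _. 1) (\<lambda>_ _. 1)"
    unfolding hol_pair_def
    by (intro conjI apairI[where c=0 and C=0]) (auto simp: hol_param_def intro!: exI[of _ 1] symbol_coeff[where K=1])
  thus ?case by (intro exI[of _ "\<lambda>_ _. 1"]) auto
next
  case (Cons s ss)
  \<comment> \<open>The uniform bound \<open>B\<close> replaces \<open>cmod (s z)\<close> so that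
    one precision serves all of \<open>Z\<close>; \<open>chain_mono\<close> lowers it afterwards at
    each \<open>z\<close>.\<close>
  obtain f g H where 1: "hol_pair Z t (M + B + 2) f g H" "\<And>z. z \<in> Z \<Longrightarrow> chain (t z) (M + B + 2) (map (\<lambda>s. s z) ss) (f z) (g z) (H z)"
    using Cons.IH[of "M + B + 2"] Cons.prems B by auto
  have s: "s holomorphic_on Z" "\<And>z. z \<in> Z \<Longrightarrow> cmod (s z) \<le> B" using Cons.prems by auto
  obtain f' g' H' where 2: "hol_pair Z t M f' g' H'" "\<And>z. z \<in> Z \<Longrightarrow> tail_sum (t z) M (s z) (f z) (g z) (H z) (f' z) (g' z) (H' z)"
    using tail_sum_exists_hol_pair[OF Z th t Cons.prems(1) s B 1(1)] by blast
  have "chain (t z) (M + cmod (s z) + 2) (map (\<lambda>s. s z) ss) (f z) (g z) (H z)" if "z \<in> Z" for z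
    by (rule chain_mono[OF 1(2)[OF that]]) (use s(2)[OF that] in auto)
  hence "\<forall>z\<in>Z. chain (t z) M (map (\<lambda>s. s z) (s # ss)) (f' z) (g' z) (H' z)"
    using 2(2) unfolding list.map chain.simps by blast
  thus ?case using 2(1) by blast
qed

lemma tail_sum_exists:
  assumes t: "cmod t < 1/2" and M: "M \<ge> 1" and p: "papair t (M + cmod s + 2) f g h"
  shows "\<exists>f' g' h'. tail_sum t M s f g h f' g' h'"
proof -
  \<comment> \<open>An auxiliary open set on which all the families are constant.\<close>
  let ?Z = "ball (0::complex) 1"
  obtain C where C: "C \<ge> 0" "\<And>n. n \<ge> 9 \<Longrightarrow> cmod (f n - h (logp n)) \<le> C * real n powr - (M + cmod s + 2)"
     "\<And>n. n \<ge> 9 \<Longrightarrow> cmod (g n - h (logm t n)) \<le> C * real n powr - (M + cmod s + 2)" using apairE[OF p] by auto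
  obtain c where c: "psymbol c h" using apair_sym[OF p] by blast
  have hh: "h holomorphic_on UNIV" using symbol_holomorphic[OF c, of "()"] by simp
  have "symbol ?Z c (\<lambda>_. h)" using c by (auto simp: symbol_def growth_def)
  hence "apair ?Z (\<lambda>_. t) (M + cmod s + 2) (\<lambda>_. f) (\<lambda>_. g) (\<lambda>_. h)" by (rule apairI[where C=C]) (use C in auto)
  moreover have "hol_param ?Z (\<lambda>_. h)" unfolding hol_param_def using holomorphic_on_compose_gen[OF _ hh] by (auto simp: o_def)
  ultimately have "hol_pair ?Z (\<lambda>_. t) (M + cmod s + 2) (\<lambda>_. f) (\<lambda>_. g) (\<lambda>_. h)"
    unfolding hol_pair_def
  proof (intro conjI allI)
    show "\<exists>K. \<forall>z\<in>?Z. cmod (f n) \<le> K \<and> cmod (g n) \<le> K" for n by (rule exI[of _ "cmod (f n) + cmod (g n)"]) auto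
  qed auto
  from tail_sum_exists_hol_pair[where s="\<lambda>_. s", OF _ _ _ M _ _ _ this] t
  obtain f' g' h' where "\<forall>z\<in>?Z. tail_sum t M s f g h (f' z) (g' z) (h' z)" by auto
  thus ?thesis by (metis centre_in_ball zero_less_one)
qed

lemma chain_exists:
  assumes t: "cmod t < 1/2"
  shows "M \<ge> 1 \<Longrightarrow> \<exists>f g h. chain t M ss f g h"
proof (induction ss arbitrary: M)
  case (Cons s ss)
  obtain f g h where 1: "chain t (M + cmod s + 2) ss f g h" using Cons.IH[of "M + cmod s + 2"] Cons.prems norm_ge_zero[of s] by auto
  obtain f' g' h' where "tail_sum t M s f g h f' g' h'" using tail_sum_exists[OF t Cons.prems chain_apair[OF 1]] by blast
  hence "chain t M (s # ss) f' g' h'" using 1 unfolding chain.simps by blast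
  thus ?case by blast
qed (unfold chain.simps, blast)

definition pol :: "(nat \<Rightarrow> complex) \<Rightarrow> nat \<Rightarrow> complex \<Rightarrow> complex" where
  "pol \<beta> m x = (\<Sum>i\<le>Suc m. \<beta> i * x ^ i)"

section \<open>Summation by parts\<close>

text \<open>The sum of \<open>j^m\<close> over \<open>n < j < N\<close> is
  \<open>P(N - 1) - P(n)\<close>. A lower neighbour therefore contributes \<open>- P\<close>, with
  coefficients \<open>- \<beta> i\<close>, and an upper neighbour contributes
  \<open>P(x - 1)\<close>, with coefficients \<open>\<alpha> i\<close>.\<close>

definition faulhaber :: "nat \<Rightarrow> (nat \<Rightarrow> complex) \<Rightarrow> (nat \<Rightarrow> complex) \<Rightarrow> bool" where
  "faulhaber m \<beta> \<alpha> \<longleftrightarrow> \<beta> 0 = 0 \<and> (\<forall>x. pol \<alpha> m x = pol \<beta> m (x - 1)) \<and> (\<forall>x. pol \<beta> m x = pol \<alpha> m x + x ^ m)"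

text \<open>
  The contributions of the two neighbours when an entry \<open>- m\<close> is summed out. For an empty right part
  the upper end of the sum is the end of the circle, where \<open>P (x - 1)\<close> is evaluated at \<open>x = t\<close>.
\<close>
fun upper :: "(nat \<Rightarrow> complex) \<Rightarrow> nat \<Rightarrow> complex \<Rightarrow> 'x::ring_1 list \<Rightarrow> (complex \<times> 'x list) list" where
  "upper \<alpha> m t [] = [(pol \<alpha> m t, [])]"
| "upper \<alpha> m t (s # ss) = map (\<lambda>i. (\<alpha> i, (s - of_nat i) # ss)) [0..<Suc (Suc m)]"

definition lower :: "(nat \<Rightarrow> complex) \<Rightarrow> nat \<Rightarrow> 'x::ring_1 \<Rightarrow> 'x list \<Rightarrow> (complex \<times> 'x list) list" where
  "lower \<beta> m s ss = map (\<lambda>i. (- \<beta> i, (s - of_nat i) # ss)) [0..<Suc (Suc m)]"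

lemma lcomb_upt: "lcomb (map (\<lambda>i. (\<alpha> i, k i)) [0..<Suc (Suc m)]) F x = (\<Sum>i\<le>Suc m. \<alpha> i * F (k i) x)"
proof -
  have "set [0..<Suc (Suc m)] = {..Suc m}" by auto
  thus ?thesis unfolding lcomb_def by (simp only: map_map o_def prod.case interv_sum_list_conv_sum_set_nat)
qed

lemma lcomb_map: "lcomb (map (\<lambda>(c, k). (c, q k)) cs) F x = lcomb cs (\<lambda>k. F (q k)) x"
  by (induction cs) auto

lemma psymbol_exp_power: "psymbol (real i) (\<lambda>u. exp u ^ i)"
  using symbol_exp[of "UNIV::unit set" "\<lambda>_. - of_nat i" "real i" "real i"] by (simp add: exp_of_nat_mult[symmetric])

lemma psymbol_pol: "psymbol (real (Suc m)) (\<lambda>u. pol \<beta> m (exp u))"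
  unfolding pol_def by (intro symbol_sum symbol_cmult symbol_mono[OF psymbol_exp_power]) auto

lemma papair_mult:
  assumes t: "cmod t < 1/2" and q: "psymbol c q" "c \<ge> 0" and p: "papair t (M + c) f g h"
  shows "papair t M (\<lambda>n. q (logp n) * f n) (\<lambda>n. q (logm t n) * g n) (\<lambda>u. q u * h u)"
proof -
  obtain C where C: "C \<ge> 0" "\<And>n. n \<ge> 9 \<Longrightarrow> cmod (f n - h (logp n)) \<le> C * real n powr - (M + c)"
     "\<And>n. n \<ge> 9 \<Longrightarrow> cmod (g n - h (logm t n)) \<le> C * real n powr - (M + c)" using apairE[OF p] by auto
  obtain D where D: "D \<ge> 0" "\<And>n. n \<ge> 9 \<Longrightarrow> cmod (q (logp n)) \<le> D * real n powr c" "\<And>n. n \<ge> 9 \<Longrightarrow> cmod (q (logm t n)) \<le> D * real n powr c"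
    using symbol_seq[OF q, of "\<lambda>_. t"] t by auto
  obtain d where d: "psymbol d h" using apair_sym[OF p] by blast
  have comb: "cmod (a * b - a * b') \<le> D * C * real n powr - M"
    if "cmod a \<le> D * real n powr c" "cmod (b - b') \<le> C * real n powr - (M + c)" "n \<ge> 9" for a b b' n
  proof -
    have "cmod (a * b - a * b') \<le> (D * real n powr c) * (C * real n powr - (M + c))"
      unfolding right_diff_distrib[symmetric] norm_mult using D(1) by (intro mult_mono that) simp_all
    also have "\<dots> = D * C * real n powr (c + - (M + c))" by (subst powr_add) (simp add: mult_ac)
    finally show ?thesis by simp
  qed
  show ?thesis by (rule apairI[OF symbol_mult[OF q(1) d], where C="D * C"]) (intro comb C D; simp)+
qed

lemma papair_lcomb:
  assumes "\<And>c k. (c, k) \<in> set cs \<Longrightarrow> papair t M (F k) (G k) (H k)"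
  shows "papair t M (lcomb cs F) (lcomb cs G) (lcomb cs H)"
  using assms
proof (induction cs)
  case Nil show ?case by (rule apairI[where C=0 and c=0]) (auto simp: lcomb_def[abs_def] symbol_zero)
next
  case (Cons p cs)
  obtain c k where p: "p = (c, k)" by force
  show ?case unfolding p lcomb_Cons_fun
  proof (rule apair_add[OF apair_cmult])
    show "papair t M (F k) (G k) (H k)" by (rule Cons.prems[of c]) (simp add: p)
    show "papair t M (lcomb cs F) (lcomb cs G) (lcomb cs H)"
    proof (rule Cons.IH)
      fix c k assume "(c, k) \<in> set cs"
      thus "papair t M (F k) (G k) (H k)" by (intro Cons.prems[of c]) auto
    qed
  qed
qed

lemma psmall_lcomb:
  assumes "\<And>c k. (c, k) \<in> set cs \<Longrightarrow> psmall M (E k)" shows "psmall M (lcomb cs E)"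
  using assms
proof (induction cs)
  case Nil show ?case by (simp add: lcomb_def[abs_def] small_zero)
next
  case (Cons p cs)
  obtain c k where p: "p = (c, k)" by force
  show ?case unfolding p lcomb_Cons_fun
  proof (rule small_add[OF small_cmult])
    show "psmall M (E k)" by (rule Cons.prems[of c]) (simp add: p)
    show "psmall M (lcomb cs E)"
    proof (rule Cons.IH)
      fix c k assume "(c, k) \<in> set cs"
      thus "psmall M (E k)" by (intro Cons.prems[of c]) auto
    qed
  qed
qed

lemma exp_power_u: "exp (- (s - of_nat i) * u) = exp (- s * u) * exp (u::complex) ^ i"
proof -
  have "- (s - of_nat i) * u = - s * u + of_nat i * u" by (simp add: algebra_simps)
  thus ?thesis by (simp only: exp_add exp_of_nat_mult)
qed

lemma exp_power_logp: "n \<ge> 1 \<Longrightarrow> exp (- (s - of_nat i) * logp n) = exp (- s * logp n) * of_nat n ^ i"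
  unfolding exp_power_u by (simp only: exp_logp)

lemma exp_power_logm: "cmod t < 1/2 \<Longrightarrow> n \<ge> 1 \<Longrightarrow> exp (- (s - of_nat i) * logm t n) = exp (- s * logm t n) * (t - of_nat n) ^ i"
  unfolding exp_power_u by (simp only: exp_logm)

text \<open>At the points of the circle \<open>exp\<close> of the chosen logarithm is the point
  itself, so a factor \<open>x^i\<close> can be moved between the summand and the exponent.\<close>

lemma tail_sum_shift_index:
  assumes t: "cmod t < 1/2" and e: "tail_sum t M (s - of_nat i) f g h F G H"
  shows "tail_sum t M s (\<lambda>n. of_nat n ^ i * f n) (\<lambda>n. (t - of_nat n) ^ i * g n) (\<lambda>u. exp u ^ i * h u) F G H"
proof (rule tail_sumI[OF tail_sum_papair[OF e]])
  show "F n = exp (- s * logp (Suc n)) * (of_nat (Suc n) ^ i * f (Suc n)) + F (Suc n)" for n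
    using tail_sum_f[OF e, of n] exp_power_logp[of "Suc n" s i] by (simp only: mult.assoc)
  show "G n = (\<Sum>m\<in>{0<..<n}. exp (- s * logm t m) * ((t - of_nat m) ^ i * g m))" for n
    unfolding tail_sum_g[OF e, of n] by (intro sum.cong refl, subst exp_power_logm[OF t]) (auto simp: mult.assoc)
  show "psmall (M + 1) (\<lambda>u. H (log_shift u) - H u - exp (- s * u) * (exp u ^ i * h u))"
    by (rule small_cong[OF tail_sum_small[OF e]]) (simp only: exp_power_u mult.assoc)
qed

text \<open>This builds the upper boundary term of the summation by parts. Its increments are
  \<open>P(x - 1)\<close> times those of the tail \<open>R\<close> of the right part. For an empty
  right part it is the constant \<open>P(t - 1)\<close>, which is also why its value at the last
  point is \<open>pol \<alpha> m t * gR 1\<close>: otherwise both sides there are empty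
  sums.\<close>

lemma upper_terms_exist:
  assumes t: "cmod t < 1/2" and M: "M \<ge> 1" and R: "chain t (M + real m + 2) post fR gR hR"
  shows "\<exists>FW GW HW. (\<forall>k. chain t M k (FW k) (GW k) (HW k)) \<and>
     (\<forall>n. lcomb (upper \<alpha> m t post) FW n = lcomb (upper \<alpha> m t post) FW (Suc n) + pol \<alpha> m (of_nat (Suc n)) * (fR n - fR (Suc n))) \<and>
     (\<forall>n\<ge>1. lcomb (upper \<alpha> m t post) GW (Suc n) = lcomb (upper \<alpha> m t post) GW n + pol \<alpha> m (t - of_nat n) * (gR (Suc n) - gR n)) \<and>
     lcomb (upper \<alpha> m t post) GW 1 = pol \<alpha> m t * gR 1 \<and>
     psmall (M + 1) (\<lambda>u. lcomb (upper \<alpha> m t post) HW (log_shift u) - lcomb (upper \<alpha> m t post) HW u - pol \<alpha> m (exp u) * (hR (log_shift u) - hR u))"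
proof (cases post)
  case Nil
  have "\<forall>k. \<exists>f g h. chain t M k f g h" using chain_exists[OF t M] by blast
  then obtain FW GW HW where W: "\<And>k. chain t M k (FW k) (GW k) (HW k)" by metis
  have "FW [] = (\<lambda>_. 1)" "GW [] = (\<lambda>_. 1)" "HW [] = (\<lambda>_. 1)" using W[of "[]"] by auto
  moreover have "fR = (\<lambda>_. 1)" "gR = (\<lambda>_. 1)" "hR = (\<lambda>_. 1)" using R Nil by auto
  ultimately show ?thesis using W Nil by (intro exI[of _ FW] exI[of _ GW] exI[of _ HW]) (auto simp: small_zero)
next
  case (Cons s ss)
  obtain fQ gQ hQ where Q: "chain t (M + real m + 2 + cmod s + 2) ss fQ gQ hQ"
    and R: "tail_sum t (M + real m + 2) s fQ gQ hQ fR gR hR" using R Cons by auto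
  \<comment> \<open>The choice must be total in \<open>k\<close>, but at the lists that occur in
    \<open>upper\<close> it has to share the given inner functions, so that the tail sums can be
    added.\<close>
  have "\<exists>f g h. chain t M k f g h \<and> (\<forall>i\<le>Suc m. k = (s - of_nat i) # ss \<longrightarrow> tail_sum t M (s - of_nat i) fQ gQ hQ f g h)" for k
  proof (cases "\<exists>i\<le>Suc m. k = (s - of_nat i) # ss")
    case False thus ?thesis using chain_exists[OF t M] by blast
  next
    case True
    then obtain i where i: "i \<le> Suc m" "k = (s - of_nat i) # ss" by blast
    have "cmod (s - of_nat i) \<le> cmod s + real (Suc m)"
      using norm_triangle_ineq4[of s "of_nat i"] i(1) by simp
    hence c: "chain t (M + cmod (s - of_nat i) + 2) ss fQ gQ hQ" by (intro chain_mono[OF Q]) auto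
    obtain f g h where e: "tail_sum t M (s - of_nat i) fQ gQ hQ f g h" using tail_sum_exists[OF t M chain_apair[OF c]] by blast
    show ?thesis using c e i by (intro exI[of _ f] exI[of _ g] exI[of _ h]) auto
  qed
  then obtain FW GW HW where W: "\<And>k. chain t M k (FW k) (GW k) (HW k)"
     and W': "\<And>k i. i \<le> Suc m \<Longrightarrow> k = (s - of_nat i) # ss \<Longrightarrow> tail_sum t M (s - of_nat i) fQ gQ hQ (FW k) (GW k) (HW k)"
    by metis
  let ?k = "\<lambda>i. (s - of_nat i) # ss"
  have e: "tail_sum t M s (\<lambda>n. of_nat n ^ i * fQ n) (\<lambda>n. (t - of_nat n) ^ i * gQ n) (\<lambda>u. exp u ^ i * hQ u) (FW (?k i)) (GW (?k i)) (HW (?k i))"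
    if "i \<le> Suc m" for i using tail_sum_shift_index[OF t W'[OF that refl]] .
  let ?cs = "map (\<lambda>i. (\<alpha> i, i)) [0..<Suc (Suc m)]"
  have E: "tail_sum t M s (lcomb ?cs (\<lambda>i n. of_nat n ^ i * fQ n)) (lcomb ?cs (\<lambda>i n. (t - of_nat n) ^ i * gQ n)) (lcomb ?cs (\<lambda>i u. exp u ^ i * hQ u))
     (lcomb ?cs (\<lambda>i. FW (?k i))) (lcomb ?cs (\<lambda>i. GW (?k i))) (lcomb ?cs (\<lambda>i. HW (?k i)))"
  proof (rule tail_sum_lcomb)
    fix c i assume "(c, i) \<in> set ?cs"
    hence "i \<le> Suc m" by auto
    thus "tail_sum t M s (\<lambda>n. of_nat n ^ i * fQ n) (\<lambda>n. (t - of_nat n) ^ i * gQ n) (\<lambda>u. exp u ^ i * hQ u) (FW (?k i)) (GW (?k i)) (HW (?k i))" by (rule e)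
  qed
  have E': "tail_sum t M s (\<lambda>n. pol \<alpha> m (of_nat n) * fQ n) (\<lambda>n. pol \<alpha> m (t - of_nat n) * gQ n) (\<lambda>u. pol \<alpha> m (exp u) * hQ u)
     (lcomb (upper \<alpha> m t post) FW) (lcomb (upper \<alpha> m t post) GW) (lcomb (upper \<alpha> m t post) HW)"
  proof -
    have p1: "lcomb ?cs (\<lambda>i x. p x ^ i * q x) = (\<lambda>x. pol \<alpha> m (p x) * q x)" for p q :: "nat \<Rightarrow> complex"
      by (rule ext) (simp only: lcomb_upt pol_def sum_distrib_right mult.assoc)
    have p2: "lcomb ?cs (\<lambda>i x. p x ^ i * q x) = (\<lambda>x. pol \<alpha> m (p x) * q x)" for p q :: "complex \<Rightarrow> complex"
      by (rule ext) (simp only: lcomb_upt pol_def sum_distrib_right mult.assoc)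
    have p3: "lcomb ?cs (\<lambda>i. X (?k i)) = lcomb (upper \<alpha> m t post) X" for X :: "complex list \<Rightarrow> nat \<Rightarrow> complex"
      by (rule ext) (simp only: Cons upper.simps lcomb_upt)
    have p4: "lcomb ?cs (\<lambda>i. X (?k i)) = lcomb (upper \<alpha> m t post) X" for X :: "complex list \<Rightarrow> complex \<Rightarrow> complex"
      by (rule ext) (simp only: Cons upper.simps lcomb_upt)
    show ?thesis using E unfolding p1 p2 p3 p4 .
  qed
  show ?thesis
  proof (rule exI[of _ FW], rule exI[of _ GW], rule exI[of _ HW], intro conjI allI impI)
    show "chain t M k (FW k) (GW k) (HW k)" for k by (rule W)
    fix n
    show "lcomb (upper \<alpha> m t post) FW n = lcomb (upper \<alpha> m t post) FW (Suc n) + pol \<alpha> m (of_nat (Suc n)) * (fR n - fR (Suc n))"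
      unfolding tail_sum_f[OF E', of n] tail_sum_f[OF R, of n] by simp
  next
    fix n :: nat assume "n \<ge> 1"
    hence "{0<..<Suc n} = insert n {0<..<n}" by auto
    thus "lcomb (upper \<alpha> m t post) GW (Suc n) = lcomb (upper \<alpha> m t post) GW n + pol \<alpha> m (t - of_nat n) * (gR (Suc n) - gR n)"
      unfolding tail_sum_g[OF E'] tail_sum_g[OF R] by (simp add: algebra_simps)
  next
    have "{0<..<1::nat} = {}" by auto
    thus "lcomb (upper \<alpha> m t post) GW 1 = pol \<alpha> m t * gR 1" unfolding tail_sum_g[OF E'] tail_sum_g[OF R] by simp
    \<comment> \<open>The polynomial has degree at most \<open>m + 1\<close>; the surplus
      \<open>real m + 2\<close> in the precision of \<open>R\<close> absorbs it.\<close>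
    have "psmall (M + real m + 2 + 1 - real (Suc m)) (\<lambda>u. pol \<alpha> m (exp u) * (hR (log_shift u) - hR u - exp (- s * u) * hQ u))"
      by (rule symbol_mult_small[OF psymbol_pol tail_sum_small[OF R]])
    hence "psmall (M + 1) (\<lambda>u. pol \<alpha> m (exp u) * (hR (log_shift u) - hR u - exp (- s * u) * hQ u))" by (rule small_mono) auto
    from small_diff[OF tail_sum_small[OF E'] this]
    show "psmall (M + 1) (\<lambda>u. lcomb (upper \<alpha> m t post) HW (log_shift u) - lcomb (upper \<alpha> m t post) HW u - pol \<alpha> m (exp u) * (hR (log_shift u) - hR u))"
      by (rule small_cong) (simp add: algebra_simps)
  qed
qed

text \<open>Abel summation without limits: by the discrete product rule \<open>- P * R + W\<close>
  satisfies the recursion, the finite sums and the expansion that characterise the tail sum with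
  exponent \<open>- m\<close>. Uniqueness then identifies the two, and no boundary term at infinity
  can appear.\<close>

lemma abel_tail:
  fixes post :: "complex list"
  assumes t: "cmod t < 1/2" and M: "M \<ge> 1" and fa: "faulhaber m \<beta> \<alpha>"
  shows "\<exists>fT gT hT fR gR hR FW GW HW.
     chain t M ((- of_nat m) # post) fT gT hT \<and> chain t (M + real m + 2) post fR gR hR \<and>
     (\<forall>k. chain t M k (FW k) (GW k) (HW k)) \<and>
     (\<forall>n. fT n = - pol \<beta> m (of_nat n) * fR n + lcomb (upper \<alpha> m t post) FW n) \<and>
     (\<forall>n\<ge>1. gT n = - pol \<beta> m (t - of_nat n) * gR n + lcomb (upper \<alpha> m t post) GW n) \<and>
     psmall M (\<lambda>u. hT u - (- pol \<beta> m (exp u) * hR u + lcomb (upper \<alpha> m t post) HW u))"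
proof -
  let ?U = "upper \<alpha> m t post"
  have fa': "pol \<beta> m x = pol \<alpha> m x + x ^ m" "pol \<alpha> m x = pol \<beta> m (x - 1)" for x using fa unfolding faulhaber_def by blast+
  obtain fR gR hR where R: "chain t (M + real m + 2) post fR gR hR"
    using chain_exists[OF t, of "M + real m + 2" post] M by fastforce
  note pR = chain_apair[OF R]
  obtain FW GW HW where W: "\<And>k. chain t M k (FW k) (GW k) (HW k)"
     and W1: "\<And>n. lcomb ?U FW n = lcomb ?U FW (Suc n) + pol \<alpha> m (of_nat (Suc n)) * (fR n - fR (Suc n))"
     and W2: "\<And>n. n \<ge> 1 \<Longrightarrow> lcomb ?U GW (Suc n) = lcomb ?U GW n + pol \<alpha> m (t - of_nat n) * (gR (Suc n) - gR n)"
     and W3: "lcomb ?U GW 1 = pol \<alpha> m t * gR 1"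
     and W4: "psmall (M + 1) (\<lambda>u. lcomb ?U HW (log_shift u) - lcomb ?U HW u - pol \<alpha> m (exp u) * (hR (log_shift u) - hR u))"
    using upper_terms_exist[OF t M R, of \<alpha>] by blast
  have pR': "papair t (M + cmod (- of_nat m) + 2) fR gR hR" using pR by simp
  obtain fT gT hT where T: "tail_sum t M (- of_nat m) fR gR hR fT gT hT" using tail_sum_exists[OF t M pR'] by blast
  have cT: "chain t M ((- of_nat m) # post) fT gT hT" using T R by auto
  define fV where "fV n = - pol \<beta> m (of_nat n) * fR n + lcomb ?U FW n" for n
  \<comment> \<open>The negative points start at \<open>t - 1\<close>, that is at
    \<open>n = 1\<close>. At \<open>n = 0\<close> the value is set to 0, the empty sum required by
    \<open>tail_sum\<close>.\<close>
  define gV where "gV n = (if n = 0 then 0 else - pol \<beta> m (t - of_nat n) * gR n + lcomb ?U GW n)" for n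
  define hV where "hV u = - pol \<beta> m (exp u) * hR u + lcomb ?U HW u" for u
  have em: "exp (- (- of_nat m) * logp (Suc n)) = of_nat (Suc n) ^ m" for n using exp_logp[of "Suc n"] by (simp only: minus_minus exp_of_nat_mult)
  have em': "exp (- (- of_nat m) * logm t n) = (t - of_nat n) ^ m" if "n \<ge> 1" for n using exp_logm[OF t that] by (simp only: minus_minus exp_of_nat_mult)
  have "papair t M (\<lambda>n. - pol \<beta> m (exp (logp n)) * fR n) (\<lambda>n. - pol \<beta> m (exp (logm t n)) * gR n) (\<lambda>u. - pol \<beta> m (exp u) * hR u)"
    by (rule papair_mult[OF t symbol_uminus[OF psymbol_pol]]) (use apair_mono[OF pR, of "M + real (Suc m)"] in auto)
  from apair_add[OF this papair_lcomb[of "upper \<alpha> m t post" t M FW GW HW, OF chain_apair[OF W]]]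
  have a: "papair t M (\<lambda>n. - pol \<beta> m (exp (logp n)) * fR n + lcomb ?U FW n) (\<lambda>n. - pol \<beta> m (exp (logm t n)) * gR n + lcomb ?U GW n) hV"
    unfolding hV_def .
  obtain C where C: "C \<ge> 0" "\<And>n. n \<ge> 9 \<Longrightarrow> cmod (- pol \<beta> m (exp (logp n)) * fR n + lcomb ?U FW n - hV (logp n)) \<le> C * real n powr - M"
     "\<And>n. n \<ge> 9 \<Longrightarrow> cmod (- pol \<beta> m (exp (logm t n)) * gR n + lcomb ?U GW n - hV (logm t n)) \<le> C * real n powr - M"
    using apairE[OF a] by auto
  obtain c where c: "psymbol c hV" using apair_sym[OF a] by blast
  have V: "tail_sum t M (- of_nat m) fR gR hR fV gV hV"
  proof (rule tail_sumI)
    show "papair t M fV gV hV"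
    proof (rule apairI[OF c, where C=C])
      fix n assume n: "n \<ge> (9::nat)"
      show "cmod (fV n - hV (logp n)) \<le> C * real n powr - M" using C(2)[OF n] exp_logp[of n] n by (simp add: fV_def)
      show "cmod (gV n - hV (logm t n)) \<le> C * real n powr - M" using C(3)[OF n] exp_logm[OF t, of n] n by (simp add: gV_def)
    qed
    show "fV n = exp (- (- of_nat m) * logp (Suc n)) * fR (Suc n) + fV (Suc n)" for n
      unfolding em fV_def W1[of n] fa'(1)[of "of_nat (Suc n)"] using fa'(2)[of "of_nat (Suc n)"] by (simp add: algebra_simps)
    show "gV n = (\<Sum>j\<in>{0<..<n}. exp (- (- of_nat m) * logm t j) * gR j)" for n
    proof (cases "n = 0")
      case True thus ?thesis by (simp add: gV_def)
    next
      case False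
      hence "n \<ge> 1" by simp
      thus ?thesis
      proof (induction n rule: dec_induct)
        case base
        have "{0<..<1::nat} = {}" by auto
        thus ?case using fa'(2)[of t] by (simp add: gV_def W3 del: One_nat_def)
      next
        case (step n)
        have "{0<..<Suc n} = insert n {0<..<n}" using step by auto
        hence r: "(\<Sum>j\<in>{0<..<Suc n}. exp (- (- of_nat m) * logm t j) * gR j) = (t - of_nat n) ^ m * gR n + gV n"
          using step em'[of n] by simp
        have "t - of_nat n - 1 = t - of_nat (Suc n)" by simp
        with fa'(2)[of "t - of_nat n"] have p: "pol \<alpha> m (t - of_nat n) = pol \<beta> m (t - of_nat (Suc n))" by simp
        show ?case unfolding r using step(1) W2[of n] fa'(1)[of "t - of_nat n"] p by (simp add: gV_def algebra_simps del: of_nat_Suc)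
      qed
    qed
    show "psmall (M + 1) (\<lambda>u. hV (log_shift u) - hV u - exp (- (- of_nat m) * u) * hR u)"
    proof (rule small_cong[OF W4])
      fix u :: complex assume u: "Re u \<ge> 2"
      have "exp (- (- of_nat m) * u) = exp u ^ m" by (simp only: minus_minus exp_of_nat_mult)
      thus "lcomb ?U HW (log_shift u) - lcomb ?U HW u - pol \<alpha> m (exp u) * (hR (log_shift u) - hR u) = hV (log_shift u) - hV u - exp (- (- of_nat m) * u) * hR u"
        unfolding hV_def exp_log_shift[OF u] using fa'(1)[of "exp u"] fa'(2)[of "exp u"] by (simp add: algebra_simps)
    qed
  qed
  have u: "fT = fV" "gT = gV" "psmall M (\<lambda>u. hT u - hV u)" using tail_sum_unique[OF t M refl refl _ T V] by (auto simp: small_zero)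
  show ?thesis
    by (rule exI[of _ fT], rule exI[of _ gT], rule exI[of _ hT], rule exI[of _ fR], rule exI[of _ gR], rule exI[of _ hR],
        rule exI[of _ FW], rule exI[of _ GW], rule exI[of _ HW]) (use cT R W u in \<open>auto simp: fV_def gV_def hV_def\<close>)
qed

text \<open>Quantifying over every precision \<open>M\<close> makes the relation stable under
  putting an entry \<open>s\<close> in front, which consumes \<open>cmod s + 2\<close>. The
  expansions can agree only up to a small error, the sequences agree exactly.\<close>

definition abel_rel :: "complex \<Rightarrow> complex list \<Rightarrow> (complex \<times> complex list) list \<Rightarrow> bool" where
  "abel_rel t l cs \<longleftrightarrow> (\<forall>M\<ge>1. \<forall>F G H. (\<forall>k. chain t M k (F k) (G k) (H k)) \<longrightarrow>
      F l = lcomb cs F \<and> G l = lcomb cs G \<and> psmall M (\<lambda>u. H l u - lcomb cs H u))"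

lemma abel_rel_Cons:
  assumes t: "cmod t < 1/2" and R: "abel_rel t l cs"
  shows "abel_rel t (s # l) (map (\<lambda>(c, k). (c, s # k)) cs)"
  unfolding abel_rel_def
proof (intro allI impI)
  fix M :: real and F G H assume M: "M \<ge> 1" and sel: "\<forall>k. chain t M k (F k) (G k) (H k)"
  have "\<forall>k. \<exists>f g h. chain t (M + cmod s + 2) k f g h \<and> tail_sum t M s f g h (F (s # k)) (G (s # k)) (H (s # k))"
    using sel by (metis chain.simps(2))
  then obtain F2 G2 H2 where s2: "\<And>k. chain t (M + cmod s + 2) k (F2 k) (G2 k) (H2 k)"
    and e2: "\<And>k. tail_sum t M s (F2 k) (G2 k) (H2 k) (F (s # k)) (G (s # k)) (H (s # k))" by metis
  have "M + cmod s + 2 \<ge> 1" using M norm_ge_zero[of s] by linarith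
  with R s2 have r: "F2 l = lcomb cs F2" "G2 l = lcomb cs G2" "psmall (M + cmod s + 2) (\<lambda>u. H2 l u - lcomb cs H2 u)"
    unfolding abel_rel_def by blast+
  have E: "tail_sum t M s (lcomb cs F2) (lcomb cs G2) (lcomb cs H2) (lcomb cs (\<lambda>k. F (s # k))) (lcomb cs (\<lambda>k. G (s # k))) (lcomb cs (\<lambda>k. H (s # k)))"
    by (rule tail_sum_lcomb) (rule e2)
  have a: "lcomb (map (\<lambda>(c, k). (c, s # k)) cs) X = lcomb cs (\<lambda>k. X (s # k))" for X :: "complex list \<Rightarrow> nat \<Rightarrow> complex" by (rule ext) (rule lcomb_map)
  have b: "lcomb (map (\<lambda>(c, k). (c, s # k)) cs) X = lcomb cs (\<lambda>k. X (s # k))" for X :: "complex list \<Rightarrow> complex \<Rightarrow> complex" by (rule ext) (rule lcomb_map)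
  show "F (s # l) = lcomb (map (\<lambda>(c, k). (c, s # k)) cs) F \<and> G (s # l) = lcomb (map (\<lambda>(c, k). (c, s # k)) cs) G \<and>
    psmall M (\<lambda>u. H (s # l) u - lcomb (map (\<lambda>(c, k). (c, s # k)) cs) H u)"
    unfolding a b using tail_sum_unique[OF t M _ _ r(3) e2[of l] E] r by auto
qed

text \<open>The lower end of the sum over the entry \<open>- m\<close> is the point at which the
  entry \<open>s\<close> is evaluated. So \<open>- P * R\<close> is absorbed by lowering
  \<open>s\<close>, while the upper boundary term keeps \<open>s\<close> in front.\<close>

lemma abel_rel_entry:
  assumes t: "cmod t < 1/2" and fa: "faulhaber m \<beta> \<alpha>"
  shows "abel_rel t (s # (- of_nat m) # post) (lower \<beta> m s post @ map (\<lambda>(c, k). (c, s # k)) (upper \<alpha> m t post))"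
  unfolding abel_rel_def
proof (intro allI impI)
  fix M :: real and F G H assume M: "M \<ge> 1" and sel: "\<forall>k. chain t M k (F k) (G k) (H k)"
  define M2 where "M2 = M + cmod s + 2"
  have M2: "M2 \<ge> 1" using M norm_ge_zero[of s] unfolding M2_def by linarith
  obtain fT gT hT fR gR hR FW GW HW where T: "chain t M2 ((- of_nat m) # post) fT gT hT"
    and R: "chain t (M2 + real m + 2) post fR gR hR" and W: "\<And>k. chain t M2 k (FW k) (GW k) (HW k)"
    and fT: "\<And>n. fT n = - pol \<beta> m (of_nat n) * fR n + lcomb (upper \<alpha> m t post) FW n"
    and gT: "\<And>n. n \<ge> 1 \<Longrightarrow> gT n = - pol \<beta> m (t - of_nat n) * gR n + lcomb (upper \<alpha> m t post) GW n"
    and hT: "psmall M2 (\<lambda>u. hT u - (- pol \<beta> m (exp u) * hR u + lcomb (upper \<alpha> m t post) HW u))"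
    using abel_tail[OF t M2 fa, of post] by blast
  obtain fX gX hX where X: "tail_sum t M s fT gT hT fX gX hX" using tail_sum_exists[OF t M, of s] chain_apair[OF T] unfolding M2_def by blast
  have cX: "chain t M (s # (- of_nat m) # post) fX gX hX" using X T unfolding M2_def by (subst chain.simps(2)) blast
  have "\<exists>f g h. i \<le> Suc m \<longrightarrow> tail_sum t M (s - of_nat i) fR gR hR f g h \<and> chain t M ((s - of_nat i) # post) f g h" for i
  proof (cases "i \<le> Suc m")
    case True
    have "cmod (s - of_nat i) \<le> cmod s + real (Suc m)" using norm_triangle_ineq4[of s "of_nat i"] True by simp
    hence c: "chain t (M + cmod (s - of_nat i) + 2) post fR gR hR" by (intro chain_mono[OF R]) (auto simp: M2_def)
    obtain f g h where e: "tail_sum t M (s - of_nat i) fR gR hR f g h" using tail_sum_exists[OF t M chain_apair[OF c]] by blast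
    show ?thesis using c e by (intro exI[of _ f] exI[of _ g] exI[of _ h]) auto
  qed auto
  then obtain FY GY HY where Y: "\<And>i. i \<le> Suc m \<Longrightarrow> tail_sum t M (s - of_nat i) fR gR hR (FY i) (GY i) (HY i)"
    and cY: "\<And>i. i \<le> Suc m \<Longrightarrow> chain t M ((s - of_nat i) # post) (FY i) (GY i) (HY i)" by metis
  have "\<exists>f g h. tail_sum t M s (FW k) (GW k) (HW k) f g h \<and> chain t M (s # k) f g h" for k
  proof -
    obtain f g h where "tail_sum t M s (FW k) (GW k) (HW k) f g h" using tail_sum_exists[OF t M] chain_apair[OF W[of k]] unfolding M2_def by blast
    hence "tail_sum t M s (FW k) (GW k) (HW k) f g h \<and> chain t M (s # k) f g h" using W[of k] unfolding M2_def chain.simps by blast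
    thus ?thesis by blast
  qed
  then obtain FU GU HU where U: "\<And>k. tail_sum t M s (FW k) (GW k) (HW k) (FU k) (GU k) (HU k)"
    and cU: "\<And>k. chain t M (s # k) (FU k) (GU k) (HU k)" by metis
  let ?cs = "map (\<lambda>i. (- \<beta> i, i)) [0..<Suc (Suc m)]"
  have E1: "tail_sum t M s (lcomb ?cs (\<lambda>i n. of_nat n ^ i * fR n)) (lcomb ?cs (\<lambda>i n. (t - of_nat n) ^ i * gR n)) (lcomb ?cs (\<lambda>i u. exp u ^ i * hR u))
     (lcomb ?cs FY) (lcomb ?cs GY) (lcomb ?cs HY)"
  proof (rule tail_sum_lcomb)
    fix c i assume "(c, i) \<in> set ?cs"
    hence "i \<le> Suc m" by auto
    thus "tail_sum t M s (\<lambda>n. of_nat n ^ i * fR n) (\<lambda>n. (t - of_nat n) ^ i * gR n) (\<lambda>u. exp u ^ i * hR u) (FY i) (GY i) (HY i)"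
      by (rule tail_sum_shift_index[OF t Y])
  qed
  have p1: "lcomb ?cs (\<lambda>i x. p x ^ i * q x) = (\<lambda>x. - pol \<beta> m (p x) * q x)" for p q :: "nat \<Rightarrow> complex"
    by (rule ext) (simp only: lcomb_upt pol_def sum_distrib_right mult.assoc mult_minus_left sum_negf)
  have p2: "lcomb ?cs (\<lambda>i x. p x ^ i * q x) = (\<lambda>x. - pol \<beta> m (p x) * q x)" for p q :: "complex \<Rightarrow> complex"
    by (rule ext) (simp only: lcomb_upt pol_def sum_distrib_right mult.assoc mult_minus_left sum_negf)
  have E2: "tail_sum t M s (lcomb (upper \<alpha> m t post) FW) (lcomb (upper \<alpha> m t post) GW) (lcomb (upper \<alpha> m t post) HW)
     (lcomb (upper \<alpha> m t post) FU) (lcomb (upper \<alpha> m t post) GU) (lcomb (upper \<alpha> m t post) HU)" by (rule tail_sum_lcomb) (rule U)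
  note E = tail_sum_add[OF E1[unfolded p1 p2] E2]
  have u: "fX = (\<lambda>n. lcomb ?cs FY n + lcomb (upper \<alpha> m t post) FU n)" "gX = (\<lambda>n. lcomb ?cs GY n + lcomb (upper \<alpha> m t post) GU n)"
    "psmall M (\<lambda>u. hX u - (lcomb ?cs HY u + lcomb (upper \<alpha> m t post) HU u))"
    using tail_sum_unique[OF t M _ _ hT[unfolded M2_def] X E] fT gT by auto
  let ?D = "lower \<beta> m s post @ map (\<lambda>(c, k). (c, s # k)) (upper \<alpha> m t post)"
  have D: "lcomb ?D A x = lcomb ?cs (\<lambda>i. A ((s - of_nat i) # post)) x + lcomb (upper \<alpha> m t post) (\<lambda>k. A (s # k)) x" for A :: "complex list \<Rightarrow> 'x \<Rightarrow> complex" and x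
    by (simp only: lcomb_simps lower_def lcomb_upt lcomb_map)
  \<comment> \<open>The chains above were built with shared inner functions;
    \<open>chain_unique\<close> replaces them by the members of the given selection.\<close>
  have qX: "fX = F (s # (- of_nat m) # post) \<and> gX = G (s # (- of_nat m) # post) \<and> psmall M (\<lambda>u. H (s # (- of_nat m) # post) u - hX u)"
    using chain_unique[OF t M cX spec[OF sel]] chain_unique[OF t M spec[OF sel] cX] by auto
  have qY: "FY i = F ((s - of_nat i) # post) \<and> GY i = G ((s - of_nat i) # post) \<and> psmall M (\<lambda>u. HY i u - H ((s - of_nat i) # post) u)" if "i \<le> Suc m" for i
    using chain_unique[OF t M cY[OF that] spec[OF sel]] by auto
  have qU: "FU k = F (s # k) \<and> GU k = G (s # k) \<and> psmall M (\<lambda>u. HU k u - H (s # k) u)" for k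
    using chain_unique[OF t M cU spec[OF sel]] by auto
  have sY: "psmall M (\<lambda>u. lcomb ?cs HY u - lcomb ?cs (\<lambda>i. H ((s - of_nat i) # post)) u)"
  proof -
    have "psmall M (lcomb ?cs (\<lambda>i u. HY i u - H ((s - of_nat i) # post) u))" by (rule psmall_lcomb) (use qY in auto)
    thus ?thesis by (rule small_cong) (simp only: lcomb_upt right_diff_distrib sum_subtractf)
  qed
  have sU: "psmall M (\<lambda>u. lcomb (upper \<alpha> m t post) HU u - lcomb (upper \<alpha> m t post) (\<lambda>k. H (s # k)) u)"
  proof -
    have "psmall M (lcomb (upper \<alpha> m t post) (\<lambda>k u. HU k u - H (s # k) u))" by (rule psmall_lcomb) (use qU in auto)
    thus ?thesis
    proof (rule small_cong)
      fix u :: complex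
      show "lcomb cs (\<lambda>k u. HU k u - H (s # k) u) u = lcomb cs HU u - lcomb cs (\<lambda>k. H (s # k)) u" for cs
        by (induction cs) (auto simp: algebra_simps)
    qed
  qed
  show "F (s # (- of_nat m) # post) = lcomb ?D F \<and> G (s # (- of_nat m) # post) = lcomb ?D G \<and> psmall M (\<lambda>u. H (s # (- of_nat m) # post) u - lcomb ?D H u)"
  proof (intro conjI)
    show "F (s # (- of_nat m) # post) = lcomb ?D F"
    proof
      fix n
      have "lcomb ?cs FY n = lcomb ?cs (\<lambda>i. F ((s - of_nat i) # post)) n" unfolding lcomb_upt by (intro sum.cong) (use qY in auto)
      moreover have "FU = (\<lambda>k. F (s # k))" using qU by auto
      ultimately show "F (s # (- of_nat m) # post) n = lcomb ?D F n" using qX u(1) unfolding D by (metis (no_types, lifting))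
    qed
    show "G (s # (- of_nat m) # post) = lcomb ?D G"
    proof
      fix n
      have "lcomb ?cs GY n = lcomb ?cs (\<lambda>i. G ((s - of_nat i) # post)) n" unfolding lcomb_upt by (intro sum.cong) (use qY in auto)
      moreover have "GU = (\<lambda>k. G (s # k))" using qU by auto
      ultimately show "G (s # (- of_nat m) # post) n = lcomb ?D G n" using qX u(2) unfolding D by (metis (no_types, lifting))
    qed
    have "psmall M (\<lambda>u. H (s # (- of_nat m) # post) u - hX u)" using qX by blast
    from small_add[OF small_add[OF this u(3)] small_add[OF sY sU]]
    show "psmall M (\<lambda>u. H (s # (- of_nat m) # post) u - lcomb ?D H u)"
      unfolding D by (rule small_cong) (simp only: algebra_simps)
  qed
qed

section \<open>The regularised multiple sum and its relations\<close>

text \<open>Index \<open>0\<close> precedes all points, so this is the regularised sum over the whole circle.\<close>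
definition zreg :: "complex \<Rightarrow> complex list \<Rightarrow> complex" where
  "zreg t l = (SOME v. \<exists>M\<ge>1. \<exists>f g h. chain t M l f g h \<and> v = f 0)"

lemma zreg_eq:
  assumes t: "cmod t < 1/2" and M: "M \<ge> 1" and c: "chain t M l f g h"
  shows "zreg t l = f 0"
  unfolding zreg_def
proof (rule some_equality)
  show "\<exists>M\<ge>1. \<exists>f' g h. chain t M l f' g h \<and> f 0 = f' 0" using M c by blast
  fix v assume "\<exists>M\<ge>1. \<exists>f g h. chain t M l f g h \<and> v = f 0"
  then obtain M' f' g' h' where 1: "M' \<ge> 1" "chain t M' l f' g' h'" "v = f' 0" by blast
  have "f = f'" using chain_unique[OF t, of "min M M'" l f g h f' g' h'] chain_mono[OF c, of "min M M'"] chain_mono[OF 1(2), of "min M M'"] M 1(1)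
    by auto
  thus "v = f 0" using 1 by simp
qed

lemma zreg_abel_rel:
  assumes t: "cmod t < 1/2" and R: "abel_rel t l cs" shows "zreg t l = lcomb cs (\<lambda>k _. zreg t k) ()"
proof -
  have "\<forall>k. \<exists>f g h. chain t 1 k f g h" using chain_exists[OF t, of 1] by auto
  then obtain F G H where s: "\<And>k. chain t 1 k (F k) (G k) (H k)" by metis
  have "F l = lcomb cs F" using R[unfolded abel_rel_def, rule_format, of 1 F G H] s by simp
  moreover have "zreg t k = F k 0" for k using zreg_eq[OF t _ s] by simp
  moreover have "lcomb cs (\<lambda>k _. F k 0) () = lcomb cs F 0" by (simp add: lcomb_def)
  ultimately show ?thesis by simp
qed

lemma zreg_abel_inner:
  assumes t: "cmod t < 1/2" and fa: "faulhaber m \<beta> \<alpha>"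
  shows "zreg t (pre @ s # (- of_nat m) # post) = lcomb (lower \<beta> m s post @ map (\<lambda>(c, k). (c, s # k)) (upper \<alpha> m t post)) (\<lambda>k _. zreg t (pre @ k)) ()"
proof -
  have "abel_rel t (pre @ s # (- of_nat m) # post) (map (\<lambda>(c, k). (c, pre @ k)) (lower \<beta> m s post @ map (\<lambda>(c, k). (c, s # k)) (upper \<alpha> m t post)))"
  proof (induction pre)
    case Nil
    have "map (\<lambda>(c, k). (c, [] @ k)) cs = cs" for cs :: "(complex \<times> complex list) list" by (induction cs) auto
    thus ?case using abel_rel_entry[OF t fa, of s post] by simp
  next
    case (Cons a pre)
    have "map (\<lambda>(c, k). (c, a # k)) (map (\<lambda>(c, k). (c, pre @ k)) cs) = map (\<lambda>(c, k). (c, (a # pre) @ k)) cs" for cs :: "(complex \<times> complex list) list"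
      by (induction cs) auto
    note e = this
    show ?case using abel_rel_Cons[OF t Cons.IH, of a] unfolding e by (simp only: append_Cons)
  qed
  from zreg_abel_rel[OF t this] show ?thesis by (simp only: lcomb_map)
qed

lemma zreg_abel_first:
  assumes t: "cmod t < 1/2" and fa: "faulhaber m \<beta> \<alpha>"
  shows "zreg t ((- of_nat m) # post) = lcomb (upper \<alpha> m t post) (\<lambda>k _. zreg t k) ()"
proof -
  obtain fT gT hT fR gR hR FW GW HW where T: "chain t 1 ((- of_nat m) # post) fT gT hT" and W: "\<And>k. chain t 1 k (FW k) (GW k) (HW k)"
    and fT: "\<And>n. fT n = - pol \<beta> m (of_nat n) * fR n + lcomb (upper \<alpha> m t post) FW n"
    using abel_tail[OF t order_refl fa, of post] by blast
  have "\<beta> 0 = 0" using fa unfolding faulhaber_def by (elim conjE)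
  \<comment> \<open>With no entry in front, the lower end is index 0, where the term
    \<open>- P * R\<close> vanishes.\<close>
  hence "pol \<beta> m 0 = 0" by (auto simp: pol_def power_0_left intro!: sum.neutral)
  hence "fT 0 = lcomb (upper \<alpha> m t post) FW 0" using fT[of 0] by simp
  moreover have "zreg t k = FW k 0" for k using zreg_eq[OF t _ W] by simp
  moreover have "lcomb cs (\<lambda>k _. FW k 0) () = lcomb cs FW 0" for cs by (simp add: lcomb_def)
  ultimately show ?thesis using zreg_eq[OF t _ T] by simp
qed

section \<open>Komori's function\<close>

text \<open>The recursion of \<open>nsum\<close> splits off the smallest summation variable.
  Convergence and the negative side need the largest one, obtained by exchanging the order of
  summation.\<close>

lemma nsum_snoc:
  "nsum f (xs @ [x]) m N = (\<Sum>n\<in>{m<..<N}. nsum f xs m n * f n x)"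
proof (induction xs arbitrary: m)
  case Nil show ?case by simp
next
  case (Cons y xs)
  have "nsum f ((y # xs) @ [x]) m N = (\<Sum>n\<in>{m<..<N}. \<Sum>k\<in>{k\<in>{m<..<N}. n < k}. f n y * (nsum f xs n k * f k x))"
    by (auto simp: Cons.IH sum_distrib_left intro!: sum.cong)
  also have "\<dots> = (\<Sum>k\<in>{m<..<N}. \<Sum>n\<in>{n\<in>{m<..<N}. n < k}. f n y * (nsum f xs n k * f k x))"
    by (rule sum.swap_restrict) auto
  also have "\<dots> = (\<Sum>k\<in>{m<..<N}. nsum f (y # xs) m k * f k x)"
    by (auto simp: sum_distrib_right mult.assoc intro!: sum.cong)
  finally show ?case .
qed

text \<open>With the largest variable outermost, the inner sums converge by induction, hence are
  bounded, and the outer sum is dominated by inverse squares.\<close>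

lemma nsum_convergent:
  fixes f :: "nat \<Rightarrow> 'x \<Rightarrow> complex"
  assumes "\<And>x. x \<in> set xs \<Longrightarrow> \<exists>C. \<forall>n\<ge>1. cmod (f n x) \<le> C / (real n)\<^sup>2"
  shows "convergent (\<lambda>N. nsum f xs 0 N)"
  using assms
proof (induction xs rule: rev_induct)
  case Nil show ?case by (simp add: convergent_const)
next
  case (snoc x xs)
  have "convergent (\<lambda>N. nsum f xs 0 N)" by (rule snoc.IH) (use snoc.prems in auto)
  then obtain K where K: "\<And>N. cmod (nsum f xs 0 N) \<le> K" using convergent_imp_Bseq BseqE by metis
  obtain C where C: "\<And>n. n \<ge> 1 \<Longrightarrow> cmod (f n x) \<le> C / (real n)\<^sup>2" using snoc.prems[of x] by auto
  have K0: "K \<ge> 0" using K[of 0] norm_ge_zero order_trans by blast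
  define a where "a n = (if n = 0 then 0 else nsum f xs 0 n * f n x)" for n
  have "summable a"
  proof (rule summable_comparison_test'[where N=1])
    show "summable (\<lambda>n. K * (C * inverse (real n ^ 2)))" by (intro summable_mult inverse_power_summable) auto
    fix n :: nat assume "n \<ge> 1"
    hence "cmod (a n) \<le> K * (C / (real n)\<^sup>2)" using mult_mono[OF K[of n] C[of n] K0 norm_ge_zero] by (simp add: a_def norm_mult)
    thus "norm (a n) \<le> K * (C * inverse (real n ^ 2))" by (simp add: divide_inverse)
  qed
  hence "convergent (\<lambda>N. \<Sum>n<N. a n)" by (simp add: summable_iff_convergent)
  moreover have "nsum f (xs @ [x]) 0 N = (\<Sum>n<N. a n)" for N
  proof -
    have "(\<Sum>n\<in>{0<..<N}. nsum f xs 0 n * f n x) = (\<Sum>n\<in>{0<..<N}. a n)" by (rule sum.cong) (auto simp: a_def)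
    also have "\<dots> = (\<Sum>n<N. a n)" by (rule sum.mono_neutral_left) (auto simp: a_def)
    finally show ?thesis by (simp add: nsum_snoc)
  qed
  ultimately show ?case by simp
qed

lemma powr_logp: "n \<ge> 1 \<Longrightarrow> (of_nat n - 0) powr (- e) = exp (- e * logp n)"
  by (simp add: powr_def logp_def Ln_of_nat)

lemma powr_logm: "cmod t < 1/2 \<Longrightarrow> n \<ge> 1 \<Longrightarrow> exp (- e * logm t n) = exp (complex_of_real pi * \<i> * e) * (of_nat n - t) powr (- e)"
  using nt_bounds(2)[of t n] by (simp add: powr_def logm_def exp_add[symmetric] algebra_simps)

lemma exp_logp_bound: "Re e \<ge> 2 \<Longrightarrow> n \<ge> 1 \<Longrightarrow> cmod (exp (- e * logp n)) \<le> 1 / (real n)\<^sup>2"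
proof -
  assume e: "Re e \<ge> 2" and n: "n \<ge> 1"
  have "cmod (exp (- e * logp n)) = exp (- (Re e * ln (real n)))" by (simp add: logp_def)
  also have "\<dots> \<le> exp (- (2 * ln (real n)))" using e n by (simp add: mult_right_mono)
  also have "exp (2 * ln (real n)) = (real n)\<^sup>2" unfolding exp_double using n by simp
  hence "exp (- (2 * ln (real n))) = 1 / (real n)\<^sup>2" by (simp only: exp_minus inverse_eq_divide)
  finally show ?thesis .
qed

lemma powr_nt_bound:
  assumes t: "cmod t < 1/2" and e: "Re e \<ge> 2" shows "\<exists>C. \<forall>n\<ge>1. cmod ((of_nat n - t) powr (- e)) \<le> C / (real n)\<^sup>2"
proof (intro exI[of _ "exp (4 * \<bar>Im e\<bar>) * 2 powr Re e"] allI impI)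
  fix n :: nat assume n: "n \<ge> 1"
  note b = nt_bounds[OF t n]
  let ?L = "Ln (of_nat n - t)"
  have "\<bar>Im ?L\<bar> \<le> 4" using mpi_less_Im_Ln[OF b(2)] Im_Ln_le_pi[OF b(2)] pi_less_4 by auto
  hence "\<bar>Im e * Im ?L\<bar> \<le> \<bar>Im e\<bar> * 4" unfolding abs_mult by (intro mult_left_mono) auto
  hence 1: "Im e * Im ?L \<le> 4 * \<bar>Im e\<bar>" by linarith
  have "cmod ((of_nat n - t) powr (- e)) = exp (Im e * Im ?L - Re e * ln (cmod (of_nat n - t)))"
    using b(2) by (simp add: powr_def)
  also have "\<dots> \<le> exp (4 * \<bar>Im e\<bar> - Re e * ln (real n / 2))"
    using 1 b n e by (auto intro!: diff_mono mult_left_mono)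
  also have "Re e * ln (real n / 2) = Re e * ln (real n) - Re e * ln 2" using n by (simp add: ln_div algebra_simps)
  also have "exp (4 * \<bar>Im e\<bar> - (Re e * ln (real n) - Re e * ln 2)) = exp (4 * \<bar>Im e\<bar>) * 2 powr Re e * exp (- (Re e * ln (real n)))"
    by (simp add: powr_def exp_add[symmetric] algebra_simps)
  also have "exp (- (Re e * ln (real n))) \<le> 1 / (real n)\<^sup>2" using exp_logp_bound[OF e n] by (simp add: logp_def)
  finally show "cmod ((of_nat n - t) powr (- e)) \<le> exp (4 * \<bar>Im e\<bar>) * 2 powr Re e / (real n)\<^sup>2" by (simp add: mult_left_mono)
qed

text \<open>Along the circle the negative points come with decreasing \<open>n\<close>, so the first
  entry of \<open>l\<close> belongs to the largest \<open>n\<close>; this explains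
  \<open>rev\<close>. The phase collects the factors produced by the branch of
  \<open>logm\<close>.\<close>

definition neg_sum :: "complex \<Rightarrow> complex list \<Rightarrow> nat \<Rightarrow> complex" where
  "neg_sum t l N = exp (complex_of_real pi * \<i> * sum_list l) * nsum (\<lambda>n e. (of_nat n - t) powr (- e)) (rev l) 0 N"

text \<open>Only finitely many points follow \<open>t - N\<close>, so the negative side is Komori's
  truncated sum exactly.\<close>

lemma chain_g:
  assumes t: "cmod t < 1/2" shows "chain t M ss f g h \<Longrightarrow> g N = neg_sum t ss N"
proof (induction ss arbitrary: M f g h N)
  case Nil thus ?case by (simp add: neg_sum_def)
next
  case (Cons s ss)
  then obtain f0 g0 h0 where 1: "chain t (M + cmod s + 2) ss f0 g0 h0" "tail_sum t M s f0 g0 h0 f g h" by auto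
  have "g N = (\<Sum>m\<in>{0<..<N}. exp (- s * logm t m) * neg_sum t ss m)" unfolding tail_sum_g[OF 1(2), of N] by (simp only: Cons.IH[OF 1(1)])
  also have "\<dots> = (\<Sum>m\<in>{0<..<N}. exp (complex_of_real pi * \<i> * sum_list (s # ss)) * (nsum (\<lambda>n e. (of_nat n - t) powr (- e)) (rev ss) 0 m * (of_nat m - t) powr (- s)))"
  proof (rule sum.cong[OF refl])
    fix m assume "m \<in> {0<..<N}"
    hence m: "m \<ge> 1" by auto
    show "exp (- s * logm t m) * neg_sum t ss m = exp (complex_of_real pi * \<i> * sum_list (s # ss)) * (nsum (\<lambda>n e. (of_nat n - t) powr (- e)) (rev ss) 0 m * (of_nat m - t) powr (- s))"
      unfolding powr_logm[OF t m] neg_sum_def by (simp add: exp_add algebra_simps)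
  qed
  also have "\<dots> = neg_sum t (s # ss) N" by (simp add: neg_sum_def nsum_snoc sum_distrib_left)
  finally show ?case .
qed

text \<open>A derivative of order \<open>-1\<close> is integrable along horizontal rays, so
  \<open>h\<close> stays within a bounded distance of its values on \<open>Re u = 2\<close>.\<close>

lemma psymbol_zero_of_deriv:
  assumes h: "psymbol c h" and d: "psymbol (-1) (deriv h)" shows "psymbol 0 h"
proof -
  have ent: "h holomorphic_on UNIV" using symbol_holomorphic[OF h, of "()"] by simp
  have "psmall 0 h" unfolding small_def growth_def
  proof
    fix a
    obtain C where C: "C \<ge> 0" "\<And>u. \<bar>Im u\<bar> \<le> \<bar>a\<bar> \<Longrightarrow> Re u \<ge> -\<bar>a\<bar> \<Longrightarrow> cmod (deriv h u) \<le> C * exp (-1 * Re u)" using symbolE[OF d, of "\<bar>a\<bar>"] by auto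
    obtain K where K: "K \<ge> 0" "\<And>u. cmod u \<le> \<bar>a\<bar> + 2 \<Longrightarrow> cmod (h u) \<le> K" using symbol_disc_bound[OF h, of "\<bar>a\<bar> + 2"] by auto
    show "\<exists>C\<ge>0. \<forall>z\<in>(UNIV::unit set). \<forall>u. \<bar>Im u\<bar> \<le> a \<longrightarrow> Re u \<ge> 2 \<longrightarrow> cmod (h u) \<le> C * exp (- 0 * Re u)"
    proof (intro exI[of _ "K + C"] conjI ballI allI impI)
      fix u assume u: "\<bar>Im u\<bar> \<le> a" "Re u \<ge> 2"
      have "cmod (h (Complex (Re u) (Im u)) - h (Complex 2 (Im u))) \<le> C / 1 * exp (- 1 * 2)"
      proof (rule horizontal_bound[OF ent _ C(1) u(2)])
        fix x :: real assume "x \<ge> 2"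
        thus "cmod (deriv h (Complex x (Im u))) \<le> C * exp (- 1 * x)" using C(2)[of "Complex x (Im u)"] u by simp
      qed simp
      also have "\<dots> \<le> C * 1" using C(1) by (simp only: div_by_1) (intro mult_left_mono, auto)
      finally have 1: "cmod (h u - h (Complex 2 (Im u))) \<le> C" by simp
      have "cmod (Complex 2 (Im u)) \<le> 2 + \<bar>Im u\<bar>" using cmod_le[of "Complex 2 (Im u)"] by simp
      hence "cmod (h (Complex 2 (Im u))) \<le> K" using u by (intro K) auto
      thus "cmod (h u) \<le> (K + C) * exp (- 0 * Re u)" using 1 norm_triangle_sub[of "h u" "h (Complex 2 (Im u))"] by simp
    qed (use K C in auto)
  qed
  from symbol_of_small[OF h this] show ?thesis by simp
qed

text \<open>A bounded inner expansion times a power with \<open>Re s > 2\<close> is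
  \<open>O(x^(-2))\<close>. So the next expansion is nearly shift invariant, has a derivative of
  order \<open>-1\<close>, and is again bounded.\<close>

lemma chain_convergent_region:
  assumes t: "cmod t < 1/2"
  shows "M \<ge> 1 \<Longrightarrow> chain t M ss f g h \<Longrightarrow> (\<And>s. s \<in> set ss \<Longrightarrow> Re s > 2) \<Longrightarrow> psymbol 0 h \<and> psymbol (-1) (deriv h)"
proof (induction ss arbitrary: M f g h)
  case Nil
  hence "h = (\<lambda>_. 1)" by simp
  thus ?case by (auto simp: symbol_zero intro: symbol_coeff[where K=1])
next
  case (Cons s ss)
  then obtain f0 g0 h0 where 1: "chain t (M + cmod s + 2) ss f0 g0 h0" "tail_sum t M s f0 g0 h0 f g h" by auto
  have "M + cmod s + 2 \<ge> 1" using Cons.prems(1) norm_ge_zero[of s] by linarith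
  hence h0: "psymbol 0 h0" using Cons.IH[OF _ 1(1)] Cons.prems by auto
  have "psymbol (-2 + 0) (\<lambda>u. exp (- s * u) * h0 u)"
    by (rule symbol_mult[OF symbol_exp[where B="cmod s"] h0]) (use Cons.prems(3)[of s] in auto)
  from symbol_imp_small[OF this] have "psmall 2 (\<lambda>u. exp (- s * u) * h0 u)" by simp
  moreover have "psmall 2 (\<lambda>u. h (log_shift u) - h u - exp (- s * u) * h0 u)"
    by (rule small_mono[OF tail_sum_small[OF 1(2)]]) (use Cons.prems in auto)
  ultimately have "psmall 2 (\<lambda>u. exp (- s * u) * h0 u + (h (log_shift u) - h u - exp (- s * u) * h0 u))" by (rule small_add)
  hence s2: "psmall 2 (\<lambda>u. h (log_shift u) - h u)" by (rule small_cong) simp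
  obtain c where c: "psymbol c h" using apair_sym[OF tail_sum_papair[OF 1(2)]] by blast
  have "psymbol (1 - 2) (deriv h)" by (rule difference_small_imp_deriv_small[OF c s2])
  hence d: "psymbol (-1) (deriv h)" by simp
  show ?case using psymbol_zero_of_deriv[OF c d] d by blast
qed

text \<open>\<open>f (N - 1)\<close> sums over the points \<open>N, N + 1, ...\<close> and the whole
  negative side, \<open>g N\<close> only over \<open>t - (N - 1), ..., t - 1\<close>. Thus the
  points with index at least \<open>N\<close> on either side contribute nothing in the
  limit.\<close>

lemma ends_agree:
  assumes t: "cmod t < 1/2" and M: "M \<ge> 1" and p: "papair t M f g h" and d: "psymbol (-1) (deriv h)"
  shows "(\<lambda>N. g N - f (N - 1)) \<longlonglongrightarrow> 0"
proof -
  obtain C where C: "C \<ge> 0" "\<And>n. n \<ge> 9 \<Longrightarrow> cmod (f n - h (logp n)) \<le> C * real n powr - M"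
     "\<And>n. n \<ge> 9 \<Longrightarrow> cmod (g n - h (logm t n)) \<le> C * real n powr - M" using apairE[OF p] by auto
  obtain c where c: "psymbol c h" using apair_sym[OF p] by blast
  have ent: "h holomorphic_on UNIV" using symbol_holomorphic[OF c, of "()"] by simp
  have h: "(\<lambda>n. h (logm t (n + 1 + 9)) - h (logp (n + 9))) \<longlonglongrightarrow> 0"
  \<comment> \<open>The imaginary parts differ by at most 8 and the real parts by at most 3, since
    the moduli are within a factor 4; hence \<open>K = 12\<close>.\<close>
  proof (rule symbol_increment_tendsto_0[where D="\<lambda>_. h" and z="()" and Z=UNIV and a="\<lambda>n. logm t (n + 1 + 9)" and b="\<lambda>n. logp (n + 9)" and A=8 and K=12])
    show "psymbol (-1) (deriv h)" by (rule d)
    show "h holomorphic_on UNIV" by (rule ent)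
    show "\<bar>Im (logm t (n + 1 + 9))\<bar> \<le> 8" for n using Im_logm[OF t, of "n + 1 + 9"] by simp
    show "\<bar>Im (logp (n + 9))\<bar> \<le> 8" for n by simp
    show "filterlim (\<lambda>n. Re (logm t (n + 1 + 9))) at_top sequentially"
      using filterlim_compose[OF Re_logm_at_top[OF t] filterlim_add_const_nat_at_top[of 1]] by simp
    fix n
    define x where "x = cmod (of_nat (n + 1 + 9) - t)"
    define y where "y = real (n + 9)"
    note b = nt_bounds[OF t, of "n + 1 + 9", folded x_def]
    have xy: "x > 0" "y > 0" "x \<le> 4 * y" "y \<le> 4 * x" using b by (auto simp: y_def x_def)
    have "ln (x / y) \<le> x / y - 1" "ln (y / x) \<le> y / x - 1" using xy by (intro ln_le_minus_one; simp)+
    moreover have "x / y \<le> 4" "y / x \<le> 4" using xy by (simp_all add: field_simps)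
    ultimately have "\<bar>ln x - ln y\<bar> \<le> 3" using xy by (simp add: ln_div abs_le_iff)
    moreover have "Re (logm t (n + 1 + 9)) = ln x" "Re (logp (n + 9)) = ln y" using Re_logm[OF t, of "n+1+9"] by (simp_all add: x_def y_def logp_def)
    ultimately show "cmod (logm t (n + 1 + 9) - logp (n + 9)) \<le> 12"
      using cmod_le[of "logm t (n + 1 + 9) - logp (n + 9)"] Im_logm[OF t, of "n + 1 + 9"] by simp
  qed auto
  have 1: "(\<lambda>n. g (n + 1 + 9) - h (logm t (n + 1 + 9))) \<longlonglongrightarrow> 0"
  proof (rule Lim_null_comparison[OF always_eventually LIMSEQ_ignore_initial_segment[OF powr_tendsto_0[of M C], of 1]], rule allI)
    fix n show "cmod (g (n + 1 + 9) - h (logm t (n + 1 + 9))) \<le> C * real (n + 1 + 9) powr - M" by (rule C) simp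
  qed (use M in auto)
  have 2: "(\<lambda>n. f (n + 9) - h (logp (n + 9))) \<longlonglongrightarrow> 0"
  proof (rule Lim_null_comparison[OF always_eventually powr_tendsto_0[of M C]], rule allI)
    fix n show "cmod (f (n + 9) - h (logp (n + 9))) \<le> C * real (n + 9) powr - M" by (rule C) simp
  qed (use M in auto)
  have "(\<lambda>n. g (n + 10) - f (n + 10 - 1)) \<longlonglongrightarrow> 0" using tendsto_diff[OF tendsto_add[OF 1 h] 2] by (simp add: algebra_simps)
  thus ?thesis by (rule LIMSEQ_offset)
qed

text \<open>The nested sum over those points of the circle that lie after \<open>m\<close> and have modulus below \<open>N\<close>.\<close>
definition trunc :: "complex \<Rightarrow> nat \<Rightarrow> complex list \<Rightarrow> nat \<Rightarrow> complex" where
  "trunc t N ss m = (\<Sum>i\<le>length ss. nsum (\<lambda>n e. (of_nat n - 0) powr (- e)) (take i ss) m N * neg_sum t (drop i ss) N)"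

lemma trunc_Nil: "trunc t N [] m = 1" by (simp add: trunc_def neg_sum_def)

lemma trunc_Cons: "trunc t N (s # ss) m = neg_sum t (s # ss) N + (\<Sum>n\<in>{m<..<N}. (of_nat n - 0) powr (- s) * trunc t N ss n)"
proof -
  have "trunc t N (s # ss) m = neg_sum t (s # ss) N + (\<Sum>i\<le>length ss. \<Sum>n\<in>{m<..<N}. (of_nat n - 0) powr (- s) * (nsum (\<lambda>n e. (of_nat n - 0) powr (- e)) (take i ss) n N * neg_sum t (drop i ss) N))"
    unfolding trunc_def by (simp add: sum.atMost_Suc_shift sum_distrib_right mult.assoc del: sum.atMost_Suc)
  also have "(\<Sum>i\<le>length ss. \<Sum>n\<in>{m<..<N}. (of_nat n - 0) powr (- s) * (nsum (\<lambda>n e. (of_nat n - 0) powr (- e)) (take i ss) n N * neg_sum t (drop i ss) N))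
     = (\<Sum>n\<in>{m<..<N}. (of_nat n - 0) powr (- s) * trunc t N ss n)"
    unfolding trunc_def by (subst sum.swap) (simp add: sum_distrib_left)
  finally show ?thesis .
qed

text \<open>The error is uniform in \<open>m < N\<close>, so the induction passes under the outer
  sum, whose weights are at most \<open>1 / n^2\<close> and add up to at most 2. The ends of the
  truncation are handled by \<open>ends_agree\<close>.\<close>

lemma trunc_approx:
  assumes t: "cmod t < 1/2"
  shows "M \<ge> 1 \<Longrightarrow> chain t M ss f g h \<Longrightarrow> (\<And>s. s \<in> set ss \<Longrightarrow> Re s > 2) \<Longrightarrow>
    \<exists>\<epsilon>. \<epsilon> \<longlonglongrightarrow> 0 \<and> (\<forall>N. \<forall>m<N. cmod (trunc t N ss m - f m) \<le> \<epsilon> N)"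
proof (induction ss arbitrary: M f g h)
  case Nil
  thus ?case by (intro exI[of _ "\<lambda>_. 0"]) (auto simp: trunc_Nil)
next
  case (Cons s ss)
  then obtain f0 g0 h0 where 1: "chain t (M + cmod s + 2) ss f0 g0 h0" "tail_sum t M s f0 g0 h0 f g h" by auto
  have "M + cmod s + 2 \<ge> 1" using Cons.prems(1) norm_ge_zero[of s] by linarith
  then obtain \<epsilon> where e: "\<epsilon> \<longlonglongrightarrow> 0" "\<And>N m. m < N \<Longrightarrow> cmod (trunc t N ss m - f0 m) \<le> \<epsilon> N" using Cons.IH[OF _ 1(1)] Cons.prems by auto
  have d: "psymbol (-1) (deriv h)" using chain_convergent_region[OF t Cons.prems] by blast
  note ea = ends_agree[OF t Cons.prems(1) tail_sum_papair[OF 1(2)] d]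
  have g: "g N = neg_sum t (s # ss) N" for N by (rule chain_g[OF t Cons.prems(2)])
  have f: "f m = (\<Sum>n\<in>{m<..<N}. exp (- s * logp n) * f0 n) + f (N - 1)" if "m < N" for m N
    using that
  proof (induction N)
    case (Suc N)
    show ?case
    proof (cases "m = N")
      case True
      have "{N<..<Suc N} = {}" by auto
      thus ?thesis using True by simp
    next
      case False
      hence m: "m < N" using Suc.prems by simp
      have "{m<..<Suc N} = insert N {m<..<N}" using m by auto
      moreover have "f (N - 1) = exp (- s * logp N) * f0 N + f N" using tail_sum_f[OF 1(2), of "N - 1"] m by simp
      ultimately show ?thesis using Suc.IH[OF m] by simp
    qed
  qed simp
  have bound: "cmod (trunc t N (s # ss) m - f m) \<le> 2 * \<epsilon> N + cmod (g N - f (N - 1))" if m: "m < N" for m N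
  proof -
    have eN: "\<epsilon> N \<ge> 0" using e(2)[of 0 N] m norm_ge_zero order_trans by (metis gr_implies_not0 neq0_conv)
    have "trunc t N (s # ss) m - f m = (\<Sum>n\<in>{m<..<N}. exp (- s * logp n) * (trunc t N ss n - f0 n)) + (g N - f (N - 1))"
    proof -
      have "(\<Sum>n\<in>{m<..<N}. (of_nat n - 0) powr (- s) * trunc t N ss n) = (\<Sum>n\<in>{m<..<N}. exp (- s * logp n) * trunc t N ss n)"
        by (rule sum.cong[OF refl], subst powr_logp) auto
      thus ?thesis unfolding trunc_Cons f[OF m] g by (simp add: sum_subtractf right_diff_distrib)
    qed
    also have "cmod \<dots> \<le> (\<Sum>n\<in>{m<..<N}. 1 / (real n)\<^sup>2 * \<epsilon> N) + cmod (g N - f (N - 1))"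
    proof (intro order_trans[OF norm_triangle_ineq] add_right_mono sum_norm_le)
      fix n assume n: "n \<in> {m<..<N}"
      show "cmod (exp (- s * logp n) * (trunc t N ss n - f0 n)) \<le> 1 / (real n)\<^sup>2 * \<epsilon> N"
        unfolding norm_mult by (intro mult_mono exp_logp_bound e(2)) (use n Cons.prems(3)[of s] in auto)
    qed
    also have "(\<Sum>n\<in>{m<..<N}. 1 / (real n)\<^sup>2 * \<epsilon> N) = (\<Sum>n\<in>{m<..<N}. 1 / (real n)\<^sup>2) * \<epsilon> N" by (simp only: sum_distrib_right)
    also have "\<dots> \<le> 2 * \<epsilon> N"
    proof (intro mult_right_mono eN)
      have "(\<Sum>n\<in>{m<..<N}. 1 / (real n)\<^sup>2) \<le> (\<Sum>n\<in>{1..<N}. 1 / (real n)\<^sup>2)" by (intro sum_mono2) auto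
      thus "(\<Sum>n\<in>{m<..<N}. 1 / (real n)\<^sup>2) \<le> 2" using sum_inverse_squares_le[of N] by linarith
    qed
    finally show ?thesis by simp
  qed
  have "(\<lambda>N. 2 * \<epsilon> N + cmod (g N - f (N - 1))) \<longlonglongrightarrow> 2 * 0 + 0"
    by (intro tendsto_add tendsto_mult tendsto_const e(1) tendsto_norm_zero ea)
  thus ?case using bound by (intro exI[of _ "\<lambda>N. 2 * \<epsilon> N + cmod (g N - f (N - 1))"]) auto
qed

text \<open>At \<open>m = 0\<close> the truncated circle sum is Komori's finite sum with each
  \<open>zeta_t\<close> truncated at \<open>N\<close>. For \<open>Re s > 2\<close> its limit can be
  taken term by term.\<close>

lemma zreg_eq_series:
  assumes t: "cmod t < 1/2" and s: "\<And>s. s \<in> set ss \<Longrightarrow> Re s > 2"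
  shows "zreg t ss = zetaU_series ss 0 t"
proof -
  obtain f g h where c: "chain t 1 ss f g h" using chain_exists[OF t, of 1 ss] by auto
  obtain \<epsilon> where e: "\<epsilon> \<longlonglongrightarrow> 0" "\<And>N m. m < N \<Longrightarrow> cmod (trunc t N ss m - f m) \<le> \<epsilon> N" using trunc_approx[OF t order_refl c s] by auto
  have "(\<lambda>N. trunc t N ss 0 - f 0) \<longlonglongrightarrow> 0"
    by (rule Lim_null_comparison[OF _ e(1)]) (use e(2)[of 0] in \<open>auto intro!: eventually_mono[OF eventually_gt_at_top[of 0]]\<close>)
  hence 1: "(\<lambda>N. trunc t N ss 0) \<longlonglongrightarrow> f 0" by (simp add: LIM_zero_iff)
  have s': "Re e \<ge> 2" if "e \<in> set (take i ss) \<or> e \<in> set (drop i ss)" for e i using s[of e] that by (auto dest: in_set_takeD in_set_dropD)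
  have "(\<lambda>N. trunc t N ss 0) \<longlonglongrightarrow> (\<Sum>i\<le>length ss. zeta_t (take i ss) 0 * (exp (complex_of_real pi * \<i> * sum_list (drop i ss)) * zeta_t (rev (drop i ss)) t))"
    unfolding trunc_def neg_sum_def zeta_t_def
  proof (intro tendsto_sum tendsto_mult tendsto_const convergent_LIMSEQ_iff[THEN iffD1] nsum_convergent)
    fix i x assume "x \<in> set (take i ss)"
    thus "\<exists>C. \<forall>n\<ge>1. cmod ((of_nat n - 0) powr - x) \<le> C / (real n)\<^sup>2" using exp_logp_bound[of x] s'[of x i] by (intro exI[of _ 1]) (auto simp: powr_logp[unfolded diff_zero])
  next
    fix i x assume "x \<in> set (rev (drop i ss))"
    thus "\<exists>C. \<forall>n\<ge>1. cmod ((of_nat n - t) powr - x) \<le> C / (real n)\<^sup>2" using s'[of x i] by (intro powr_nt_bound[OF t]) auto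
  qed
  from LIMSEQ_unique[OF 1 this] have "f 0 = zetaU_series ss 0 t"
    by (simp add: zetaU_series_def mult_ac)
  thus ?thesis using zreg_eq[OF t _ c] by simp
qed

text \<open>One lemma for two purposes: continuation in a single exponent, with \<open>t\<close>
  constant, and the Taylor expansion in \<open>t\<close>, with all exponents constant.\<close>

lemma zreg_holomorphic:
  assumes Z: "open Z" "bounded Z" and th: "t holomorphic_on Z" and t: "\<And>z. z \<in> Z \<Longrightarrow> cmod (t z) < 1/2"
    and ss: "\<And>s. s \<in> set ss \<Longrightarrow> s = (\<lambda>z. z) \<or> (\<exists>c. s = (\<lambda>_. c))"
  shows "(\<lambda>z. zreg (t z) (map (\<lambda>s. s z) ss)) holomorphic_on Z"
proof -
  obtain A where A: "\<And>z. z \<in> Z \<Longrightarrow> cmod z \<le> A" using Z(2) bounded_iff by metis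
  define B where "B = \<bar>A\<bar> + (\<Sum>s\<leftarrow>ss. cmod (s 0))"
  have pos: "(\<Sum>s\<leftarrow>ss. cmod (s 0)) \<ge> 0" by (rule sum_list_nonneg) auto
  hence B: "B \<ge> 0" by (simp add: B_def)
  have "s holomorphic_on Z \<and> (\<forall>z\<in>Z. cmod (s z) \<le> B)" if s: "s \<in> set ss" for s
    using ss[OF s]
  proof
    assume "s = (\<lambda>z. z)"
    thus ?thesis using A pos unfolding B_def by (auto intro: order_trans[of _ A])
  next
    assume "\<exists>c. s = (\<lambda>_. c)"
    then obtain c where c: "s = (\<lambda>_. c)" by blast
    have "cmod (s 0) \<le> (\<Sum>s\<leftarrow>ss. cmod (s 0))" using s by (intro member_le_sum_list) auto
    thus ?thesis unfolding B_def using c by auto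
  qed
  then obtain f g H where F: "hol_pair Z t 1 f g H" "\<And>z. z \<in> Z \<Longrightarrow> chain (t z) 1 (map (\<lambda>s. s z) ss) (f z) (g z) (H z)"
    using chain_exists_hol_pair[OF Z(1) th t B order_refl, of ss] by blast
  have "(\<lambda>z. f z 0) holomorphic_on Z" using F(1) by (simp add: hol_pair_def)
  thus ?thesis using zreg_eq[OF t order_refl F(2)] by (simp cong: holomorphic_cong)
qed

lemma zreg_holomorphic_coord:
  assumes t: "cmod t < 1/2"
  shows "(\<lambda>z. zreg t (zs[j := z])) holomorphic_on UNIV"
proof -
  \<comment> \<open>The estimates need bounded exponents, so the plane is exhausted by
    discs.\<close>
  have *: "(\<lambda>z. zreg t (zs[j := z])) holomorphic_on ball 0 r" for r
  proof -
    have "(\<lambda>z. zreg t (map (\<lambda>s. s z) ((map (\<lambda>c _. c) zs)[j := (\<lambda>z. z)]))) holomorphic_on ball 0 r"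
    proof (rule zreg_holomorphic)
      fix s assume "s \<in> set ((map (\<lambda>c _. c) zs)[j := (\<lambda>z. z)])"
      thus "s = (\<lambda>z. z) \<or> (\<exists>c. s = (\<lambda>_. c))" using set_update_subset_insert[of "map (\<lambda>c _. c) zs" j "\<lambda>z. z"] by auto
    qed (use t in auto)
    thus ?thesis by (simp add: map_update o_def)
  qed
  have "(\<lambda>z. zreg t (zs[j := z])) field_differentiable (at z)" for z
    by (rule holomorphic_on_imp_differentiable_at[OF *[of "cmod z + 1"]]) auto
  thus ?thesis by (simp add: holomorphic_on_def)
qed

text \<open>The identity theorem is applied to one coordinate at a time: the first \<open>k\<close>
  coordinates are already arbitrary, the others still lie in the half plane.\<close>

lemma separately_entire_unique:
  fixes F G :: "complex list \<Rightarrow> complex"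
  assumes F: "\<And>zs j. length zs = n \<Longrightarrow> j < n \<Longrightarrow> (\<lambda>z. F (zs[j := z])) holomorphic_on UNIV"
    and G: "\<And>zs j. length zs = n \<Longrightarrow> j < n \<Longrightarrow> (\<lambda>z. G (zs[j := z])) holomorphic_on UNIV"
    and eq: "\<And>zs. length zs = n \<Longrightarrow> (\<forall>z\<in>set zs. Re z > 2) \<Longrightarrow> F zs = G zs"
    and l: "length zs = n"
  shows "F zs = G zs"
proof -
  have "k \<le> n \<Longrightarrow> length zs = n \<Longrightarrow> (\<forall>j<n. k \<le> j \<longrightarrow> Re (zs ! j) > 2) \<Longrightarrow> F zs = G zs" for k zs
  proof (induction k arbitrary: zs)
    case 0
    thus ?case by (intro eq) (auto simp: set_conv_nth)
  next
    case (Suc k)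
    have k: "k < n" using Suc.prems by simp
    have "F (zs[k := zs ! k]) = G (zs[k := zs ! k])"
    proof (rule analytic_continuation_open[of "{z. Re z > 2}" UNIV "\<lambda>z. F (zs[k := z])" "\<lambda>z. G (zs[k := z])"])
      show "open {z. Re z > 2}" by (rule open_halfspace_Re_gt)
      show "{z. Re z > 2} \<noteq> {}" by (auto intro!: exI[of _ 3])
      show "(\<lambda>z. F (zs[k := z])) holomorphic_on UNIV" "(\<lambda>z. G (zs[k := z])) holomorphic_on UNIV" using F G Suc.prems k by auto
      fix z assume "z \<in> {z. Re z > 2}"
      thus "F (zs[k := z]) = G (zs[k := z])" using Suc.prems k by (intro Suc.IH) (auto simp: nth_list_update)
    qed auto
    thus ?case by simp
  qed
  from this[of n zs] l show ?thesis by auto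
qed

text \<open>\<open>zreg t\<close> is a witness for the entire function in the definite description,
  and the values on \<open>Re z > 2\<close> determine that function.\<close>

lemma zetaU_eq_zreg:
  assumes t: "cmod t < 1/2" shows "zetaU s 0 t = zreg t s"
  unfolding zetaU_def
proof (rule the_equality)
  show "\<exists>F. (\<forall>zs. length zs = length s \<longrightarrow> (\<forall>j<length s. (\<lambda>z. F (zs[j := z])) holomorphic_on UNIV)) \<and>
      (\<forall>zs. length zs = length s \<and> (\<forall>z\<in>set zs. Re z > 2) \<longrightarrow> F zs = zetaU_series zs 0 t) \<and> zreg t s = F s"
    using zreg_holomorphic_coord[OF t] zreg_eq_series[OF t] by (intro exI[of _ "zreg t"]) auto
next
  fix v assume "\<exists>F. (\<forall>zs. length zs = length s \<longrightarrow> (\<forall>j<length s. (\<lambda>z. F (zs[j := z])) holomorphic_on UNIV)) \<and>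
      (\<forall>zs. length zs = length s \<and> (\<forall>z\<in>set zs. Re z > 2) \<longrightarrow> F zs = zetaU_series zs 0 t) \<and> v = F s"
  then obtain F where F: "\<And>zs j. length zs = length s \<Longrightarrow> j < length s \<Longrightarrow> (\<lambda>z. F (zs[j := z])) holomorphic_on UNIV"
     "\<And>zs. length zs = length s \<Longrightarrow> (\<forall>z\<in>set zs. Re z > 2) \<Longrightarrow> F zs = zetaU_series zs 0 t" "v = F s" by blast
  have "F s = zreg t s"
    by (rule separately_entire_unique[where n="length s", OF F(1) zreg_holomorphic_coord[OF t]]) (use F(2) zreg_eq_series[OF t] in auto)
  thus "v = zreg t s" using F(3) by simp
qed

lemma zetaS_expansion: "(\<lambda>t. zreg t (map of_int k)) has_fps_expansion zetaS k"
proof -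
  let ?G = "\<lambda>t. zetaU (map of_int k) 0 t"
  have "(\<lambda>t. zreg t (map (\<lambda>s. s t) (map (\<lambda>x _. of_int x) k))) holomorphic_on ball 0 (1/2)"
    by (rule zreg_holomorphic) auto
  hence F: "(\<lambda>t. zreg t (map of_int k)) holomorphic_on ball 0 (1/2)" by (simp add: o_def)
  hence "?G holomorphic_on ball 0 (1/2)" by (rule holomorphic_transform) (simp add: zetaU_eq_zreg)
  hence "?G has_fps_expansion fps_expansion ?G 0" by (intro has_fps_expansion_fps_expansion[of "ball 0 (1/2)"]) auto
  hence G: "?G has_fps_expansion zetaS k" by (simp add: fps_expansion_def zetaS_def)
  have "eventually (\<lambda>t. t \<in> ball (0::complex) (1/2)) (nhds 0)" by (rule eventually_nhds_in_open) auto
  hence "eventually (\<lambda>t. ?G t = zreg t (map of_int k)) (nhds 0)" by eventually_elim (simp add: zetaU_eq_zreg)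
  thus ?thesis using G by (subst (asm) has_fps_expansion_cong) auto
qed

section \<open>Reduction to positive indices\<close>

text \<open>The last point of summation is \<open>x - 1\<close>, with \<open>x = t\<close> or
  \<open>x = p\<close>; \<open>x\<close> enters only through \<open>upper\<close> with an empty
  right part. The first identity serves a leading entry, the second one an entry preceded by
  \<open>s\<close>.\<close>

definition abel_system :: "(int list \<Rightarrow> complex) \<Rightarrow> complex \<Rightarrow> bool" where
  "abel_system E x \<longleftrightarrow> (\<forall>m \<beta> \<alpha>. faulhaber m \<beta> \<alpha> \<longrightarrow>
     (\<forall>post. E ((- int m) # post) = lcomb (upper \<alpha> m x post) (\<lambda>k _. E k) ()) \<and>
     (\<forall>pre s post. E (pre @ s # (- int m) # post) =
        lcomb (lower \<beta> m s post @ map (\<lambda>(c, k). (c, s # k)) (upper \<alpha> m x post)) (\<lambda>k _. E (pre @ k)) ()))"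

lemma upper_of_int: "upper \<alpha> m x (map of_int post) = map (\<lambda>(c, k). (c, map of_int k)) (upper \<alpha> m x (post :: int list))"
  by (cases post) auto

lemma lower_of_int: "lower \<beta> m (of_int s) (map of_int post) = map (\<lambda>(c, k). (c, map of_int k)) (lower \<beta> m (s::int) post)"
  by (auto simp: lower_def)

lemma abel_system_zreg:
  assumes t: "cmod t < 1/2" shows "abel_system (\<lambda>l. zreg t (map of_int l)) t"
  unfolding abel_system_def
proof (intro allI impI conjI)
  fix m \<beta> \<alpha> and post :: "int list" assume fa: "faulhaber m \<beta> \<alpha>"
  show "zreg t (map of_int (- int m # post)) = lcomb (upper \<alpha> m t post) (\<lambda>k _. zreg t (map of_int k)) ()"
    using zreg_abel_first[OF t fa, of "map of_int post"] by (simp add: upper_of_int lcomb_map)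
  fix pre s
  have "zreg t (map of_int pre @ of_int s # (- of_nat m) # map of_int post) =
    lcomb (lower \<beta> m (of_int s) (map of_int post) @ map (\<lambda>(c, k). (c, of_int s # k)) (upper \<alpha> m t (map of_int post))) (\<lambda>k _. zreg t (map of_int pre @ k)) ()"
    by (rule zreg_abel_inner[OF t fa])
  thus "zreg t (map of_int (pre @ s # (- int m) # post)) =
    lcomb (lower \<beta> m s post @ map (\<lambda>(c, k). (c, s # k)) (upper \<alpha> m t post)) (\<lambda>k _. zreg t (map of_int (pre @ k))) ()"
    by (simp add: upper_of_int lower_of_int lcomb_map del: map_map)
qed

section \<open>The truncated sums at a prime\<close>

abbreviation powsum :: "nat \<Rightarrow> int list \<Rightarrow> nat \<Rightarrow> complex" where
  "powsum p l n \<equiv> nsum (\<lambda>n e. (of_nat n :: complex) powi (- e)) l n p"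

lemma powsum_Cons_Suc:
  assumes "Suc n < p" shows "powsum p (x # xs) n = of_nat (Suc n) powi (- x) * powsum p xs (Suc n) + powsum p (x # xs) (Suc n)"
proof -
  have "{n<..<p} = insert (Suc n) {Suc n<..<p}" using assms by auto
  thus ?thesis by simp
qed

lemma powsum_Cons_end: "powsum p (x # xs) (p - 1) = 0"
proof -
  have "{p - 1<..<p} = {}" by auto
  thus ?thesis by simp
qed

lemma powi_shift: "n \<noteq> 0 \<Longrightarrow> (of_nat n :: complex) powi (- (s - int i)) = of_nat n powi (- s) * of_nat n ^ i"
  using power_int_add[of "of_nat n :: complex" "- s" "int i"] by (simp add: algebra_simps)

lemma powsum_upper_step:
  assumes "Suc n < p"
  shows "lcomb (upper \<alpha> m x post) (powsum p) n = lcomb (upper \<alpha> m x post) (powsum p) (Suc n) + pol \<alpha> m (of_nat (Suc n)) * (powsum p post n - powsum p post (Suc n))"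
proof (cases post)
  case Nil thus ?thesis by simp
next
  case (Cons s ss)
  have "lcomb (upper \<alpha> m x post) (powsum p) n = (\<Sum>i\<le>Suc m. \<alpha> i * powsum p ((s - int i) # ss) n)" unfolding Cons upper.simps lcomb_upt by simp
  also have "\<dots> = (\<Sum>i\<le>Suc m. \<alpha> i * powsum p ((s - int i) # ss) (Suc n) + \<alpha> i * of_nat (Suc n) ^ i * (of_nat (Suc n) powi (- s) * powsum p ss (Suc n)))"
    by (intro sum.cong refl, subst powsum_Cons_Suc[OF assms], subst powi_shift) (simp_all add: algebra_simps)
  also have "\<dots> = lcomb (upper \<alpha> m x post) (powsum p) (Suc n) + pol \<alpha> m (of_nat (Suc n)) * (of_nat (Suc n) powi (- s) * powsum p ss (Suc n))"
    unfolding sum.distrib Cons upper.simps lcomb_upt pol_def sum_distrib_right by simp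
  also have "of_nat (Suc n) powi (- s) * powsum p ss (Suc n) = powsum p post n - powsum p post (Suc n)"
    unfolding Cons powsum_Cons_Suc[OF assms] by simp
  finally show ?thesis .
qed

text \<open>Classical Abel summation with the upper limit \<open>p\<close> fixed, by downward
  induction on the lower limit \<open>n\<close>.\<close>

lemma powsum_abel:
  assumes fa: "faulhaber m \<beta> \<alpha>" and n: "n < p"
  shows "powsum p ((- int m) # post) n = - pol \<beta> m (of_nat n) * powsum p post n + lcomb (upper \<alpha> m (of_nat p) post) (powsum p) n"
proof -
  have fa': "pol \<beta> m x = pol \<alpha> m x + x ^ m" "pol \<alpha> m x = pol \<beta> m (x - 1)" for x using fa unfolding faulhaber_def by blast+
  have "n \<le> p - 1" using n by simp
  thus ?thesis
  proof (induction n rule: inc_induct)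
    \<comment> \<open>All sums are empty here. For an empty right part \<open>- P(p - 1)\<close>
      cancels against the coefficient \<open>pol \<alpha> m p = P(p - 1)\<close> from
      \<open>upper\<close>.\<close>
    case base
    have r: "powsum p ((- int m) # post) (p - 1) = 0" by (rule powsum_Cons_end)
    show ?case
    proof (cases post)
      case Nil
      have "of_nat (p - 1) = (of_nat p :: complex) - 1" using n by (simp add: of_nat_diff)
      thus ?thesis unfolding r using Nil fa'(2)[of "of_nat p"] by simp
    next
      case (Cons s ss)
      have "lcomb (upper \<alpha> m (of_nat p) post) (powsum p) (p - 1) = (\<Sum>i\<le>Suc m. \<alpha> i * powsum p ((s - int i) # ss) (p - 1))" unfolding Cons upper.simps lcomb_upt by simp
      also have "\<dots> = 0" by (intro sum.neutral ballI) (simp only: powsum_Cons_end mult_zero_right)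
      finally show ?thesis unfolding r Cons powsum_Cons_end by simp
    qed
  next
    case (step k)
    have k: "Suc k < p" using step by simp
    have "of_nat (Suc k) - 1 = (of_nat k :: complex)" by simp
    hence 1: "pol \<alpha> m (of_nat (Suc k)) = pol \<beta> m (of_nat k)" using fa'(2)[of "of_nat (Suc k)"] by simp
    have "powsum p ((- int m) # post) k = of_nat (Suc k) ^ m * powsum p post (Suc k) + powsum p ((- int m) # post) (Suc k)"
      unfolding powsum_Cons_Suc[OF k] by simp
    also have "\<dots> = of_nat (Suc k) ^ m * powsum p post (Suc k) - pol \<beta> m (of_nat (Suc k)) * powsum p post (Suc k) + lcomb (upper \<alpha> m (of_nat p) post) (powsum p) (Suc k)"
      unfolding step.IH by simp
    also have "\<dots> = - pol \<beta> m (of_nat k) * powsum p post k + lcomb (upper \<alpha> m (of_nat p) post) (powsum p) k"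
      unfolding powsum_upper_step[OF k] fa'(1)[of "of_nat (Suc k)"] 1 by (simp add: algebra_simps del: of_nat_Suc)
    finally show ?case .
  qed
qed

lemma lcomb_sum: "(\<Sum>j\<in>J. a j * lcomb cs F j) = lcomb cs (\<lambda>k _. \<Sum>j\<in>J. a j * F k j) ()"
  by (induction cs) (auto simp: sum.distrib sum_distrib_left algebra_simps)

lemma powsum_abel_inner:
  assumes fa: "faulhaber m \<beta> \<alpha>"
  shows "n < p \<Longrightarrow> powsum p (pre @ s # (- int m) # post) n =
    lcomb (lower \<beta> m s post @ map (\<lambda>(c, k). (c, s # k)) (upper \<alpha> m (of_nat p) post)) (\<lambda>k. powsum p (pre @ k)) n"
proof (induction pre arbitrary: n)
  case Nil
  have "powsum p (s # (- int m) # post) n = (\<Sum>j\<in>{n<..<p}. of_nat j powi (- s) * (- pol \<beta> m (of_nat j) * powsum p post j + lcomb (upper \<alpha> m (of_nat p) post) (powsum p) j))"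
    unfolding nsum.simps(2)[of _ s] by (intro sum.cong refl, subst powsum_abel[OF fa]) auto
  also have "\<dots> = (\<Sum>j\<in>{n<..<p}. \<Sum>i\<le>Suc m. - \<beta> i * (of_nat j powi (- (s - int i)) * powsum p post j)) + (\<Sum>j\<in>{n<..<p}. of_nat j powi (- s) * lcomb (upper \<alpha> m (of_nat p) post) (powsum p) j)"
    unfolding sum.distrib[symmetric]
  proof (rule sum.cong[OF refl])
    fix j assume "j \<in> {n<..<p}"
    hence j: "j \<noteq> 0" by auto
    show "of_nat j powi (- s) * (- pol \<beta> m (of_nat j) * powsum p post j + lcomb (upper \<alpha> m (of_nat p) post) (powsum p) j) =
      (\<Sum>i\<le>Suc m. - \<beta> i * (of_nat j powi (- (s - int i)) * powsum p post j)) + of_nat j powi (- s) * lcomb (upper \<alpha> m (of_nat p) post) (powsum p) j"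
      unfolding pol_def powi_shift[OF j] by (simp add: sum_distrib_left sum_distrib_right sum_negf algebra_simps del: sum.atMost_Suc)
  qed
  also have "(\<Sum>j\<in>{n<..<p}. \<Sum>i\<le>Suc m. - \<beta> i * (of_nat j powi (- (s - int i)) * powsum p post j)) = (\<Sum>i\<le>Suc m. - \<beta> i * powsum p ((s - int i) # post) n)"
    by (subst sum.swap) (simp only: nsum.simps sum_distrib_left)
  also have "\<dots> = lcomb (lower \<beta> m s post) (powsum p) n" unfolding lower_def lcomb_upt by simp
  also have "(\<Sum>j\<in>{n<..<p}. of_nat j powi (- s) * lcomb (upper \<alpha> m (of_nat p) post) (powsum p) j) = lcomb (upper \<alpha> m (of_nat p) post) (\<lambda>k. powsum p (s # k)) n"
    unfolding lcomb_sum by (simp add: lcomb_def)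
  finally show ?case by (simp only: append_Nil lcomb_simps lcomb_map)
next
  case (Cons a pre)
  let ?cs = "lower \<beta> m s post @ map (\<lambda>(c, k). (c, s # k)) (upper \<alpha> m (of_nat p) post)"
  have "powsum p ((a # pre) @ s # (- int m) # post) n = (\<Sum>j\<in>{n<..<p}. of_nat j powi (- a) * lcomb ?cs (\<lambda>k. powsum p (pre @ k)) j)"
    unfolding append_Cons nsum.simps(2)[of _ a] by (intro sum.cong refl, subst Cons.IH) auto
  also have "\<dots> = lcomb ?cs (\<lambda>k. powsum p ((a # pre) @ k)) n" unfolding lcomb_sum by (simp add: lcomb_def)
  finally show ?case .
qed

lemma abel_system_powsum:
  assumes p: "p \<ge> 1" shows "abel_system (\<lambda>l. powsum p l 0) (of_nat p)"
  unfolding abel_system_def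
proof (intro allI impI conjI)
  fix m \<beta> \<alpha> and post :: "int list" assume fa: "faulhaber m \<beta> \<alpha>"
  have "\<beta> 0 = 0" using fa unfolding faulhaber_def by (elim conjE)
  hence "pol \<beta> m 0 = 0" by (auto simp: pol_def power_0_left intro!: sum.neutral)
  thus "powsum p (- int m # post) 0 = lcomb (upper \<alpha> m (of_nat p) post) (\<lambda>k _. powsum p k 0) ()"
    using powsum_abel[OF fa, of 0 p post] p by (simp add: lcomb_def)
  fix pre s
  show "powsum p (pre @ s # (- int m) # post) 0 =
    lcomb (lower \<beta> m s post @ map (\<lambda>(c, k). (c, s # k)) (upper \<alpha> m (of_nat p) post)) (\<lambda>k _. powsum p (pre @ k) 0) ()"
    using powsum_abel_inner[OF fa, of 0 p pre s post] p by (simp add: lcomb_def)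
qed

text \<open>The rational sums are treated inside the complex numbers, so that they and
  \<open>zreg\<close> satisfy one and the same predicate; injectivity of \<open>of_rat\<close> leads
  back to rationals.\<close>

lemma zeta_p_complex: "of_rat (zeta_p k p) = powsum p k 0"
proof -
  have p: "of_rat ((of_nat n :: rat) powi e) = (of_nat n :: complex) powi e" for n e
    by (cases "e \<ge> 0") (auto simp: power_int_def of_rat_power of_rat_inverse)
  have "of_rat (nsum (\<lambda>n e. (of_nat n :: rat) powi (- e)) k m p) = powsum p k m" for m
    by (induction k arbitrary: m) (auto simp: of_rat_sum of_rat_mult p)
  thus ?thesis by (simp add: zeta_p_def)
qed

section \<open>Rational coefficients of the summation polynomials\<close>

lemma faulhaber_coefficients:
  "\<exists>\<beta>::nat \<Rightarrow> rat. \<beta> 0 = 0 \<and> (\<forall>i>Suc m. \<beta> i = 0) \<and> (\<forall>x::complex. (\<Sum>i\<le>Suc m. of_rat (\<beta> i) * (x ^ i - (x - 1) ^ i)) = x ^ m)"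
proof (induction m rule: less_induct)
  case (less m)
  have "\<forall>k. \<exists>\<beta>::nat \<Rightarrow> rat. k < m \<longrightarrow> \<beta> 0 = 0 \<and> (\<forall>i>Suc k. \<beta> i = 0) \<and> (\<forall>x::complex. (\<Sum>i\<le>Suc k. of_rat (\<beta> i) * (x ^ i - (x - 1) ^ i)) = x ^ k)"
    using less.IH by blast
  then obtain B :: "nat \<Rightarrow> nat \<Rightarrow> rat" where B: "\<And>k. k < m \<Longrightarrow> B k 0 = 0" "\<And>k i. k < m \<Longrightarrow> i > Suc k \<Longrightarrow> B k i = 0"
    "\<And>k x. k < m \<Longrightarrow> (\<Sum>i\<le>Suc k. of_rat (B k i) * (x ^ i - (x - 1 :: complex) ^ i)) = x ^ k" by metis
  have B': "(\<Sum>i\<le>Suc m. of_rat (B k i) * (x ^ i - (x - 1 :: complex) ^ i)) = x ^ k" if k: "k < m" for k x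
  proof -
    have "(\<Sum>i\<le>Suc m. of_rat (B k i) * (x ^ i - (x - 1) ^ i)) = (\<Sum>i\<le>Suc k. of_rat (B k i) * (x ^ i - (x - 1 :: complex) ^ i))"
      by (rule sum.mono_neutral_right) (use k B(2)[OF k] in auto)
    thus ?thesis using B(3)[OF k] by simp
  qed
  define d :: "nat \<Rightarrow> rat" where "d k = of_nat (Suc m choose k) * (-1) ^ (Suc m - k)" for k
  \<comment> \<open>By the binomial theorem
    \<open>x^(m+1) - (x-1)^(m+1) = (m+1) * x^m - (\<Sum>k<m. d k * x^k)\<close>. Solving for
    \<open>x^m\<close> and inserting the solutions \<open>B k\<close> for the lower powers gives
    \<open>\<beta>\<close>.\<close>
  define \<beta> where "\<beta> i = ((if i = Suc m then 1 else 0) + (\<Sum>k<m. d k * B k i)) / of_nat (Suc m)" for i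
  have bin: "(x - 1) ^ Suc m = x ^ Suc m - of_nat (Suc m) * x ^ m + (\<Sum>k<m. of_rat (d k) * x ^ k)" for x :: complex
  proof -
    have "(x + (-1)) ^ Suc m = (\<Sum>k\<le>Suc m. of_nat (Suc m choose k) * x ^ k * (-1) ^ (Suc m - k))" by (rule binomial_ring)
    also have "\<dots> = (\<Sum>k<m. of_nat (Suc m choose k) * x ^ k * (-1) ^ (Suc m - k)) + of_nat (Suc m) * x ^ m * (-1) + x ^ Suc m"
      by (simp add: lessThan_Suc_atMost[symmetric] del: binomial_Suc_Suc of_nat_Suc power_Suc)
    also have "(\<Sum>k<m. of_nat (Suc m choose k) * x ^ k * (-1) ^ (Suc m - k)) = (\<Sum>k<m. of_rat (d k) * x ^ k)"
      by (intro sum.cong refl) (simp add: d_def of_rat_mult of_rat_power mult_ac del: binomial_Suc_Suc)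
    finally show ?thesis by (simp add: algebra_simps)
  qed
  show ?case
  proof (intro exI[of _ \<beta>] conjI allI impI)
    show "\<beta> 0 = 0" using B(1) by (simp add: \<beta>_def)
    show "\<beta> i = 0" if "i > Suc m" for i using that B(2) by (simp add: \<beta>_def)
    fix x :: complex
    let ?D = "\<lambda>i. x ^ i - (x - 1) ^ i"
    have "of_nat (Suc m) * (\<Sum>i\<le>Suc m. of_rat (\<beta> i) * ?D i) = (\<Sum>i\<le>Suc m. (if i = Suc m then ?D i else 0) + (\<Sum>k<m. of_rat (d k) * (of_rat (B k i) * ?D i)))"
      unfolding sum_distrib_left
    proof (rule sum.cong[OF refl])
      fix i
      have "of_nat (Suc m) * of_rat (\<beta> i) = (of_rat (of_nat (Suc m) * \<beta> i) :: complex)" by (simp only: of_rat_mult of_rat_of_nat_eq)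
      also have "of_nat (Suc m) * \<beta> i = (if i = Suc m then 1 else 0) + (\<Sum>k<m. d k * B k i)" by (simp add: \<beta>_def del: of_nat_Suc)
      finally have "of_nat (Suc m) * of_rat (\<beta> i) = ((if i = Suc m then 1 else 0) + (\<Sum>k<m. of_rat (d k) * of_rat (B k i)) :: complex)"
        by (simp add: of_rat_add of_rat_sum of_rat_mult)
      hence "of_nat (Suc m) * of_rat (\<beta> i) * ?D i = ((if i = Suc m then 1 else 0) + (\<Sum>k<m. of_rat (d k) * of_rat (B k i))) * ?D i" by (simp only:)
      thus "of_nat (Suc m) * (of_rat (\<beta> i) * ?D i) = (if i = Suc m then ?D i else 0) + (\<Sum>k<m. of_rat (d k) * (of_rat (B k i) * ?D i))"
        by (simp add: distrib_right sum_distrib_right mult.assoc del: of_nat_Suc)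
    qed
    also have "\<dots> = ?D (Suc m) + (\<Sum>k<m. of_rat (d k) * (\<Sum>i\<le>Suc m. of_rat (B k i) * ?D i))"
      unfolding sum.distrib sum_distrib_left by (subst sum.swap) (simp del: sum.atMost_Suc power_Suc)
    also have "\<dots> = ?D (Suc m) + (\<Sum>k<m. of_rat (d k) * x ^ k)" using B' by simp
    also have "\<dots> = of_nat (Suc m) * x ^ m" unfolding bin by simp
    finally show "(\<Sum>i\<le>Suc m. of_rat (\<beta> i) * ?D i) = x ^ m" by (simp del: of_nat_Suc sum.atMost_Suc)
  qed
qed

lemma pol_shift: "\<exists>\<alpha>::nat \<Rightarrow> rat. \<forall>x. pol (\<lambda>i. of_rat (\<alpha> i)) m x = pol (\<lambda>i. of_rat (\<beta> i)) m (x - 1)"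
proof -
  define \<alpha> where "\<alpha> k = (\<Sum>i\<le>Suc m. \<beta> i * (if k \<le> i then of_nat (i choose k) * (-1) ^ (i - k) else 0))" for k
  have "pol (\<lambda>i. of_rat (\<alpha> i)) m x = pol (\<lambda>i. of_rat (\<beta> i)) m (x - 1)" for x
  proof -
    have "(x - 1) ^ i = (\<Sum>k\<le>Suc m. of_rat (if k \<le> i then of_nat (i choose k) * (-1) ^ (i - k) else 0) * x ^ k)" if "i \<le> Suc m" for i
    proof -
      have "(x + (-1)) ^ i = (\<Sum>k\<le>i. of_nat (i choose k) * x ^ k * (-1) ^ (i - k))" by (rule binomial_ring)
      also have "\<dots> = (\<Sum>k\<le>i. of_rat (if k \<le> i then of_nat (i choose k) * (-1) ^ (i - k) else 0) * x ^ k)"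
        by (intro sum.cong refl) (simp add: of_rat_mult of_rat_power mult_ac)
      also have "\<dots> = (\<Sum>k\<le>Suc m. of_rat (if k \<le> i then of_nat (i choose k) * (-1) ^ (i - k) else 0) * x ^ k)"
        by (rule sum.mono_neutral_left) (use that in auto)
      finally show ?thesis by simp
    qed
    hence "pol (\<lambda>i. of_rat (\<beta> i)) m (x - 1) = (\<Sum>i\<le>Suc m. of_rat (\<beta> i) * (\<Sum>k\<le>Suc m. of_rat (if k \<le> i then of_nat (i choose k) * (-1) ^ (i - k) else 0) * x ^ k))"
      unfolding pol_def by (intro sum.cong refl) auto
    also have "\<dots> = (\<Sum>k\<le>Suc m. \<Sum>i\<le>Suc m. of_rat (\<beta> i * (if k \<le> i then of_nat (i choose k) * (-1) ^ (i - k) else 0)) * x ^ k)"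
      unfolding sum_distrib_left by (subst sum.swap) (simp only: of_rat_mult mult.assoc)
    also have "\<dots> = pol (\<lambda>i. of_rat (\<alpha> i)) m x" unfolding pol_def \<alpha>_def of_rat_sum sum_distrib_right ..
    finally show ?thesis ..
  qed
  thus ?thesis by blast
qed

lemma faulhaber_exists: "\<exists>\<beta> \<alpha>. faulhaber m (\<lambda>i. of_rat (\<beta> i)) (\<lambda>i. of_rat (\<alpha> i))"
proof -
  obtain \<beta> :: "nat \<Rightarrow> rat" where b: "\<beta> 0 = 0" "\<And>x::complex. (\<Sum>i\<le>Suc m. of_rat (\<beta> i) * (x ^ i - (x - 1) ^ i)) = x ^ m"
    using faulhaber_coefficients by blast
  obtain \<alpha> :: "nat \<Rightarrow> rat" where a: "\<And>x. pol (\<lambda>i. of_rat (\<alpha> i)) m x = pol (\<lambda>i. of_rat (\<beta> i)) m (x - 1)" using pol_shift by blast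
  have d: "pol (\<lambda>i. of_rat (\<beta> i)) m x - pol (\<lambda>i. of_rat (\<alpha> i)) m x = x ^ m" for x
    unfolding a using b(2)[of x] unfolding pol_def sum_subtractf[symmetric] right_diff_distrib .
  have "faulhaber m (\<lambda>i. of_rat (\<beta> i)) (\<lambda>i. of_rat (\<alpha> i))"
    unfolding faulhaber_def
  proof (intro conjI allI)
    show "pol (\<lambda>i. of_rat (\<beta> i)) m x = pol (\<lambda>i. of_rat (\<alpha> i)) m x + x ^ m" for x
      by (metis d diff_eq_eq add.commute)
  qed (simp add: b(1), rule a)
  thus ?thesis by blast
qed

definition rpoly :: "rat poly \<Rightarrow> complex \<Rightarrow> complex" where "rpoly c x = poly (map_poly of_rat c) x"

lemma rpoly_pCons: "rpoly (pCons a c) x = of_rat a + x * rpoly c x"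
  by (simp add: rpoly_def map_poly_pCons)

lemma rpoly_0 [simp]: "rpoly 0 x = 0" by (simp add: rpoly_def)

lemma rpoly_const: "rpoly [:a:] x = of_rat a" by (simp add: rpoly_pCons)

lemma rpoly_1: "rpoly 1 x = 1" using rpoly_const[of 1 x] by (simp add: one_pCons)

lemma rpoly_add: "rpoly (c + d) x = rpoly c x + rpoly d x"
  by (induction c d rule: poly_induct2) (simp_all add: rpoly_pCons of_rat_add algebra_simps)

lemma rpoly_smult: "rpoly (smult a c) x = of_rat a * rpoly c x"
  by (induction c) (simp_all add: rpoly_pCons of_rat_mult algebra_simps)

lemma rpoly_mult: "rpoly (c * d) x = rpoly c x * rpoly d x"
  by (induction c) (simp_all add: rpoly_pCons rpoly_add rpoly_smult algebra_simps)

lemma rpoly_of_rat: "rpoly c (of_rat q) = of_rat (poly c q)"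
  by (induction c) (simp_all add: rpoly_pCons of_rat_add of_rat_mult)

lemma pol_rpoly: "\<exists>c. \<forall>x. pol (\<lambda>i. of_rat (\<alpha> i)) m x = rpoly c x"
proof -
  have "\<exists>c. \<forall>x. (\<Sum>i\<le>n. of_rat (\<alpha> i) * x ^ i) = rpoly c x" for n
  proof (induction n)
    case 0 show ?case by (intro exI[of _ "[:\<alpha> 0:]"]) (simp add: rpoly_const)
  next
    case (Suc n)
    then obtain c where c: "\<And>x. (\<Sum>i\<le>n. of_rat (\<alpha> i) * x ^ i) = rpoly c x" by blast
    have m: "rpoly (monom a j) x = of_rat a * x ^ j" for a j x
      by (induction j) (simp_all add: monom_0 monom_Suc rpoly_pCons)
    show ?case by (intro exI[of _ "c + monom (\<alpha> (Suc n)) (Suc n)"]) (simp add: c rpoly_add m)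
  qed
  thus ?thesis unfolding pol_def by blast
qed

section \<open>Elimination of the nonpositive entries\<close>

definition pos_indices :: "nat \<Rightarrow> int \<Rightarrow> int list set" where
  "pos_indices d w = {l. (\<forall>x\<in>set l. x > 0) \<and> length l \<le> d \<and> sum_list l \<le> w}"

lemma finite_pos_indices: "finite (pos_indices d w)"
proof (rule finite_subset)
  show "pos_indices d w \<subseteq> {l. set l \<subseteq> {1..w} \<and> length l \<le> d}"
  proof
    fix l assume l: "l \<in> pos_indices d w"
    have "x \<le> w" if "x \<in> set l" for x
    proof -
      have "x \<le> sum_list l" using that l by (intro member_le_sum_list) (auto simp: pos_indices_def intro: less_imp_le)
      thus ?thesis using l by (simp add: pos_indices_def)
    qed
    thus "l \<in> {l. set l \<subseteq> {1..w} \<and> length l \<le> d}" using l by (force simp: pos_indices_def)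
  qed
  show "finite {l. set l \<subseteq> {1..w} \<and> length l \<le> d}" by (rule finite_lists_length_le) auto
qed

text \<open>The coefficients \<open>c\<close> are chosen before \<open>E\<close> and
  \<open>x\<close>. This order of quantifiers makes them common to the values at all primes and to
  all small \<open>t\<close>.\<close>

definition reducible :: "nat \<Rightarrow> int \<Rightarrow> ((int list \<Rightarrow> complex) \<Rightarrow> complex \<Rightarrow> complex) \<Rightarrow> bool" where
  "reducible d w \<phi> \<longleftrightarrow> (\<exists>c. \<forall>E x. abel_system E x \<longrightarrow> \<phi> E x = (\<Sum>l\<in>pos_indices d w. rpoly (c l) x * E l))"

lemma reducible_mono:
  assumes "reducible d w \<phi>" "d \<le> d'" "w \<le> w'" shows "reducible d' w' \<phi>"
proof -
  obtain c where c: "\<And>E x. abel_system E x \<Longrightarrow> \<phi> E x = (\<Sum>l\<in>pos_indices d w. rpoly (c l) x * E l)" using assms(1) unfolding reducible_def by blast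
  have s: "pos_indices d w \<subseteq> pos_indices d' w'" using assms by (auto simp: pos_indices_def)
  show ?thesis unfolding reducible_def
  proof (intro exI[of _ "\<lambda>l. if l \<in> pos_indices d w then c l else 0"] allI impI)
    fix E x assume e: "abel_system E x"
    have "(\<Sum>l\<in>pos_indices d' w'. rpoly (if l \<in> pos_indices d w then c l else 0) x * E l) = (\<Sum>l\<in>pos_indices d w. rpoly (if l \<in> pos_indices d w then c l else 0) x * E l)"
      by (rule sum.mono_neutral_right) (use s finite_pos_indices in auto)
    thus "\<phi> E x = (\<Sum>l\<in>pos_indices d' w'. rpoly (if l \<in> pos_indices d w then c l else 0) x * E l)" using c[OF e] by simp
  qed
qed

lemma reducible_add:
  assumes "reducible d w \<phi>" "reducible d w \<psi>" shows "reducible d w (\<lambda>E x. \<phi> E x + \<psi> E x)"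
proof -
  obtain c where c: "\<And>E x. abel_system E x \<Longrightarrow> \<phi> E x = (\<Sum>l\<in>pos_indices d w. rpoly (c l) x * E l)" using assms(1) unfolding reducible_def by blast
  obtain b where b: "\<And>E x. abel_system E x \<Longrightarrow> \<psi> E x = (\<Sum>l\<in>pos_indices d w. rpoly (b l) x * E l)" using assms(2) unfolding reducible_def by blast
  show ?thesis unfolding reducible_def
    by (intro exI[of _ "\<lambda>l. c l + b l"]) (simp add: c b rpoly_add algebra_simps sum.distrib)
qed

lemma reducible_mult:
  assumes "reducible d w \<phi>" shows "reducible d w (\<lambda>E x. rpoly q x * \<phi> E x)"
proof -
  obtain c where c: "\<And>E x. abel_system E x \<Longrightarrow> \<phi> E x = (\<Sum>l\<in>pos_indices d w. rpoly (c l) x * E l)" using assms(1) unfolding reducible_def by blast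
  show ?thesis unfolding reducible_def
    by (intro exI[of _ "\<lambda>l. q * c l"]) (simp add: c rpoly_mult algebra_simps sum_distrib_left)
qed

lemma reducible_zero: "reducible d w (\<lambda>E x. 0)"
  unfolding reducible_def by (intro exI[of _ "\<lambda>l. 0"]) simp

lemma reducible_sum: "finite I \<Longrightarrow> (\<And>i. i \<in> I \<Longrightarrow> reducible d w (\<phi> i)) \<Longrightarrow> reducible d w (\<lambda>E x. \<Sum>i\<in>I. \<phi> i E x)"
  by (induction I rule: finite_induct) (auto intro: reducible_zero reducible_add)

lemma reducible_base: "l \<in> pos_indices d w \<Longrightarrow> reducible d w (\<lambda>E x. E l)"
  unfolding reducible_def
proof (intro exI[of _ "\<lambda>k. if k = l then 1 else 0"] allI impI)
  fix E :: "int list \<Rightarrow> complex" and x assume l: "l \<in> pos_indices d w"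
  have "(\<Sum>k\<in>pos_indices d w. rpoly (if k = l then 1 else 0) x * E k) = (\<Sum>k\<in>pos_indices d w. if k = l then E k else 0)"
    by (intro sum.cong) (auto simp: rpoly_1)
  thus "E l = (\<Sum>k\<in>pos_indices d w. rpoly (if k = l then 1 else 0) x * E k)" using l finite_pos_indices by simp
qed

lemma reducible_cong: "(\<And>E x. abel_system E x \<Longrightarrow> \<phi> E x = \<psi> E x) \<Longrightarrow> reducible d w \<psi> \<Longrightarrow> reducible d w \<phi>"
  unfolding reducible_def by metis

definition npos :: "int list \<Rightarrow> nat" where "npos k = length (filter (\<lambda>x. x > 0) k)"
definition wpos :: "int list \<Rightarrow> int" where "wpos k = sum_list (filter (\<lambda>x. x > 0) k)"

lemma npos_simps [simp]: "npos [] = 0" "npos (x # k) = (if x > 0 then 1 else 0) + npos k" "npos (k @ l) = npos k + npos l"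
  by (simp_all add: npos_def)

lemma wpos_simps [simp]: "wpos [] = 0" "wpos (x # k) = max x 0 + wpos k" "wpos (k @ l) = wpos k + wpos l"
  by (simp_all add: wpos_def)

lemma wpos_nonneg [simp]: "wpos k \<ge> 0"
  by (induction k) auto

text \<open>Each step removes a nonpositive entry, so the length drops. The neighbour that changes
  is only lowered, so neither the number nor the sum of the positive entries can grow; this gives
  the bounds on depth and weight.\<close>

lemma reducible_list: "reducible (npos k) (wpos k) (\<lambda>E x. E k)"
proof (induction "length k" arbitrary: k rule: less_induct)
  case less
  have IH: "reducible (npos k) (wpos k) (\<lambda>E x. E l)" if "length l < length k" "npos l \<le> npos k" "wpos l \<le> wpos k" for l
    using reducible_mono[OF less[OF that(1)] that(2,3)] .
  have mult: "reducible (npos k) (wpos k) (\<lambda>E x. of_rat a * E l)" if "length l < length k" "npos l \<le> npos k" "wpos l \<le> wpos k" for l a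
    using reducible_mult[OF IH[OF that], of "[:a:]"] by (simp add: rpoly_const)
  show ?case
  proof (cases "\<forall>x\<in>set k. x > 0")
    case True
    hence "filter (\<lambda>x. x > 0) k = k" by simp
    hence "k \<in> pos_indices (npos k) (wpos k)" using True by (simp add: pos_indices_def npos_def wpos_def)
    thus ?thesis by (rule reducible_base)
  next
    case False
    then obtain a where a: "a \<in> set k" "a \<le> 0" by (auto simp: not_less)
    define m where "m = nat (- a)"
    have am: "a = - int m" using a by (simp add: m_def)
    obtain pre post where k: "k = pre @ (- int m) # post" using split_list[OF a(1)] am by blast
    obtain \<beta> \<alpha> :: "nat \<Rightarrow> rat" where fa: "faulhaber m (\<lambda>i. of_rat (\<beta> i)) (\<lambda>i. of_rat (\<alpha> i))" using faulhaber_exists by blast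
    obtain q where q: "\<And>x. pol (\<lambda>i. of_rat (\<alpha> i)) m x = rpoly q x" using pol_rpoly by blast
    have upper: "reducible (npos k) (wpos k) (\<lambda>E x. lcomb (upper (\<lambda>i. of_rat (\<alpha> i)) m x post) (\<lambda>l _. E (pre @ l)) ())"
    proof (cases post)
      case Nil
      \<comment> \<open>Only here does a nonconstant polynomial coefficient arise: an empty right
        part leaves the boundary value \<open>P(x - 1)\<close>.\<close>
      have "reducible (npos k) (wpos k) (\<lambda>E x. rpoly q x * E pre)" by (intro reducible_mult IH) (simp_all add: k)
      thus ?thesis using Nil by (simp add: q)
    next
      case (Cons s ss)
      have "reducible (npos k) (wpos k) (\<lambda>E x. \<Sum>i\<le>Suc m. of_rat (\<alpha> i) * E (pre @ (s - of_nat i) # ss))"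
        by (intro reducible_sum mult) (auto simp: k Cons)
      thus ?thesis unfolding Cons upper.simps lcomb_upt .
    qed
    show ?thesis
    proof (cases pre rule: rev_cases)
      case Nil
      show ?thesis
      proof (rule reducible_cong[OF _ upper])
        fix E x assume e: "abel_system E x"
        show "E k = lcomb (upper (\<lambda>i. of_rat (\<alpha> i)) m x post) (\<lambda>l _. E (pre @ l)) ()"
          using e[unfolded abel_system_def, rule_format, OF fa] by (simp add: k Nil)
      qed
    next
      case (snoc pre' s)
      have lower: "reducible (npos k) (wpos k) (\<lambda>E x. \<Sum>i\<le>Suc m. of_rat (- \<beta> i) * E (pre' @ (s - of_nat i) # post))"
        by (intro reducible_sum mult) (auto simp: k snoc)
      show ?thesis
      proof (rule reducible_cong[OF _ reducible_add[OF lower upper]])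
        fix E x assume e: "abel_system E x"
        have "E k = lcomb (lower (\<lambda>i. of_rat (\<beta> i)) m s post @ map (\<lambda>(c, k). (c, s # k)) (upper (\<lambda>i. of_rat (\<alpha> i)) m x post)) (\<lambda>k _. E (pre' @ k)) ()"
          using e[unfolded abel_system_def, rule_format, OF fa] by (simp add: k snoc)
        also have "\<dots> = (\<Sum>i\<le>Suc m. of_rat (- \<beta> i) * E (pre' @ (s - of_nat i) # post)) + lcomb (upper (\<lambda>i. of_rat (\<alpha> i)) m x post) (\<lambda>l _. E (pre @ l)) ()"
          unfolding lcomb_simps(3) lower_def lcomb_upt lcomb_map snoc by (simp add: of_rat_minus del: sum.atMost_Suc)
        finally show "E k = (\<Sum>i\<le>Suc m. of_rat (- \<beta> i) * E (pre' @ (s - of_nat i) # post)) + lcomb (upper (\<lambda>i. of_rat (\<alpha> i)) m x post) (\<lambda>l _. E (pre @ l)) ()" .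
      qed
    qed
  qed
qed

lemma has_fps_expansion_poly: "(\<lambda>x. poly p x) has_fps_expansion fps_of_poly (p :: complex poly)"
  by (simp add: has_fps_expansion_def)

lemma zero_in_piI_ideal: "0 \<in> piI_ideal"
proof -
  have "0 \<in> MZV_alg" using MZV_alg.rat[of 0] by simp
  hence "0 \<in> MZV_alg_piI" unfolding MZV_alg_piI_def by (auto intro!: exI[of _ 0] exI[of _ "\<lambda>_. 0"])
  thus ?thesis unfolding piI_ideal_def by (auto intro!: exI[of _ 0])
qed

theorem theorem1p2:
  fixes k :: "int list"
  shows "\<exists>(L :: int list set) (c :: int list \<Rightarrow> rat poly).
           finite L \<and>
           (\<forall>l\<in>L. (\<forall>x\<in>set l. x > 0) \<and>
                   length l \<le> length (filter (\<lambda>x. x > 0) k) \<and>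
                   sum_list l \<le> sum_list (filter (\<lambda>x. x > 0) k)) \<and>
           Ahat_eq (zeta_p k) (\<lambda>p. \<Sum>l\<in>L. poly (c l) (of_nat p) * zeta_p l p) \<and>
           (\<forall>m. fps_nth (zetaS k - (\<Sum>l\<in>L. fps_of_poly (map_poly of_rat (c l)) * zetaS l)) m
                  \<in> piI_ideal)"
proof -
  obtain c where c: "\<And>E x. abel_system E x \<Longrightarrow> E k = (\<Sum>l\<in>pos_indices (npos k) (wpos k). rpoly (c l) x * E l)"
    using reducible_list[of k] unfolding reducible_def by blast
  let ?L = "pos_indices (npos k) (wpos k)"
  have A: "zeta_p k p = (\<Sum>l\<in>?L. poly (c l) (of_nat p) * zeta_p l p)" if "p \<ge> 1" for p
  proof -
    have "(of_rat (zeta_p k p) :: complex) = (\<Sum>l\<in>?L. rpoly (c l) (of_rat (of_nat p)) * of_rat (zeta_p l p))"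
      using c[OF abel_system_powsum[OF that]] by (simp add: zeta_p_complex)
    also have "\<dots> = of_rat (\<Sum>l\<in>?L. poly (c l) (of_nat p) * zeta_p l p)" by (simp only: rpoly_of_rat of_rat_sum of_rat_mult)
    finally show ?thesis by (simp only: of_rat_eq_iff)
  qed
  have "padic_div p n 0" if "prime p" for p n
    unfolding padic_div_def using that prime_gt_1_nat[OF that] by (intro exI[of _ 0] exI[of _ 1]) auto
  \<comment> \<open>The two families of rationals are equal at every prime, so there are no
    exceptional primes for any power of \<open>p\<close>.\<close>
  hence e: "{p. prime p \<and> \<not> padic_div p n (zeta_p k p - (\<Sum>l\<in>?L. poly (c l) (of_nat p) * zeta_p l p))} = {}" for n
    using A prime_ge_1_nat by auto
  hence 1: "Ahat_eq (zeta_p k) (\<lambda>p. \<Sum>l\<in>?L. poly (c l) (of_nat p) * zeta_p l p)" unfolding Ahat_eq_def e by simp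
  have "(\<lambda>t. \<Sum>l\<in>?L. poly (map_poly of_rat (c l)) t * zreg t (map of_int l)) has_fps_expansion (\<Sum>l\<in>?L. fps_of_poly (map_poly of_rat (c l)) * zetaS l)"
    by (intro has_fps_expansion_sum has_fps_expansion_mult has_fps_expansion_poly zetaS_expansion)
  moreover have "eventually (\<lambda>t. (\<Sum>l\<in>?L. poly (map_poly of_rat (c l)) t * zreg t (map of_int l)) = zreg t (map of_int k)) (nhds 0)"
  proof -
    have "eventually (\<lambda>t. t \<in> ball (0::complex) (1/2)) (nhds 0)" by (rule eventually_nhds_in_open) auto
    thus ?thesis
    proof eventually_elim
      case (elim t)
      hence "cmod t < 1/2" by simp
      from c[OF abel_system_zreg[OF this]] show ?case by (simp add: rpoly_def)
    qed
  qed
  ultimately have "(\<lambda>t. zreg t (map of_int k)) has_fps_expansion (\<Sum>l\<in>?L. fps_of_poly (map_poly of_rat (c l)) * zetaS l)"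
    by (subst (asm) has_fps_expansion_cong) auto
  hence "zetaS k = (\<Sum>l\<in>?L. fps_of_poly (map_poly of_rat (c l)) * zetaS l)" by (rule fps_expansion_unique_complex[OF zetaS_expansion])
  hence 2: "\<forall>m. fps_nth (zetaS k - (\<Sum>l\<in>?L. fps_of_poly (map_poly of_rat (c l)) * zetaS l)) m \<in> piI_ideal"
    using zero_in_piI_ideal by simp
  show ?thesis
    by (rule exI[of _ ?L], rule exI[of _ c]) (use 1 2 finite_pos_indices in \<open>auto simp: pos_indices_def npos_def wpos_def\<close>)
qed

end
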